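(* Let $T$ be a Markov–Rényi map associated with $\{I_n\}_{n\in\mathbb N}$, with parameter $\gamma>1$ and repeller $\Lambda$. Let $\psi:\mathbb{N}\to\mathbb{R}_{>0}$ be a function satisfying $\psi(n)/n\to\infty$ as $n\to\infty$. For $\alpha\in[0,\infty]$ let $$\overline J_\psi(\alpha)=\Big\{x\in\Lambda:\limsup_{n\to\infty}\tfrac{1}{\psi(n)}\log|(T^n)'(x)|=\alpha\Big\},\qquad \underline J_\psi(\alpha)=\Big\{x\in\Lambda:\liminf_{n\to\infty}\tfrac{1}{\psi(n)}\log|(T^n)'(x)|=\alpha\Big\},$$ and $\overline F_\psi(\alpha)=\dim_{\rm H}\overline J_\psi(\alpha)$, $\underline F_\psi(\alpha)=\dim_{\rm H}\underline J_\psi(\alpha)$. Put $b_\psi=\liminf_{n\to\infty}\sqrt[n]{\psi(n)}$ and $B_\psi=\limsup_{n\to\infty}\sqrt[n]{\psi(n)}$. Then: (i) when $\alpha=0$, both $\overline J_\psi(0)$ and $\underline J_\psi(0)$ have Lebesgue measure $\sum_{n\in\mathbb N}|I_n|$; in particular $\overline F_\psi(0)=\underline F_\psi(0)=1$; (ii) when $0<\alpha\le\infty$, $$\overline F_\psi(\alpha)=\frac{1}{(\gamma-1)b_\psi+1}\qquad\text{and}\qquad \underline F_\psi(\alpha)=\frac{1}{(\gamma-1)B_\psi+1}.$$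
   Context: $\mathbb N=\{1,2,3,\dots\}$, $I=[0,1]$; $|A|$ is the diameter of $A\subseteq\mathbb R$; $\dim_{\rm H}$ is Hausdorff dimension. Markov–Rényi map: let $\{I_n\}_{n\in\mathbb N}$ be a collection of disjoint open subintervals of $[0,1]$. A piecewise differentiable interval map $T:\bigcup_{n}\overline{I}_n\to[0,1]$ is a Markov–Rényi map associated with $\{I_n\}$ if: (1) for every $n$, $I_n$ and $I_{n+1}$ share a common endpoint, i.e. $\partial I_n\cap\partial I_{n+1}$ is a singleton; (2) for every $n$, $T|_{I_n}$ extends to a $C^1$ diffeomorphism $T_n$ on an open neighborhood of $\overline I_n$; (3) there exist $p\in\bigcup_n\overline I_n$ and $m\in\mathbb N$ such that $T(p)=p$, $|T'(p)|\ge1$ and $|(T^m)'(x)|>1$ for all $x\in\bigcup_n\overline I_n\setminus\{p\}$; (4) $\overline{T(I_n)}=[0,1]$ for every $n$; (5) there exist constants $\gamma>1$ and $C>1$ such that $C^{-1}n^\gamma\le|T_n'(x)|\le Cn^\gamma$ for all $n\in\mathbb N$, $x\in\overline I_n$. Let $I^*=\bigcup_n\overline I_n$ (a subinterval of $[0,1]$), let $\mathcal Q=\bigcup_{k=0}^\infty T^{-k}\big(\{0,1\}\cup\bigcup_n\partial I_n\big)$ (a countable set), and define the repeller of $T$ as $\Lambda=I^*\setminus\mathcal Q$. Convention: $1/\infty=0$, so the formulas give $0$ when $b_\psi=\infty$ or $B_\psi=\infty$.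
   Formalization: If Σ|I_n|<1, almost every orbit in Λ leaves I*, so (T^n)'(x) becomes undefined and (i) fails if such x are discarded; here T is extended by the identity outside I*, which puts these x in the α=0 sets. Nothing changes when Σ|I_n|=1. *)

theory Defs
  imports "HOL-Analysis.Analysis"
begin

section \<open>Hausdorff dimension\<close>

text \<open>The case distinction fixes the usual convention that a nonempty set has gauge \<open>1\<close> for
  \<open>s = 0\<close>; the library has \<open>0 powr 0 = 0\<close>.\<close>

definition hausdorff_gauge :: "real \<Rightarrow> 'a::metric_space set \<Rightarrow> ennreal" where
  "hausdorff_gauge s U =
     (if U = {} then 0 else if s = 0 then 1 else ennreal (diameter U powr s))"

text \<open>Boundedness is required explicitly because \<open>diameter\<close> is unspecified on unbounded sets.\<close>

definition hausdorff_premeasure :: "real \<Rightarrow> real \<Rightarrow> 'a::metric_space set \<Rightarrow> ennreal" where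
  "hausdorff_premeasure s \<delta> A =
     Inf {(\<Sum>i. hausdorff_gauge s (U i)) | U :: nat \<Rightarrow> 'a set.
            A \<subseteq> (\<Union>i. U i) \<and> (\<forall>i. bounded (U i) \<and> diameter (U i) \<le> \<delta>)}"

definition hausdorff_measure :: "real \<Rightarrow> 'a::metric_space set \<Rightarrow> ennreal" where
  "hausdorff_measure s A = (SUP \<delta>\<in>{0<..}. hausdorff_premeasure s \<delta> A)"

definition hausdorff_dim :: "'a::metric_space set \<Rightarrow> ereal" where
  "hausdorff_dim A = Inf {ereal s | s. 0 \<le> s \<and> hausdorff_measure s A = 0}"

section \<open>Markov--Renyi maps\<close>

text \<open>Intervals are indexed by the positive integers; \<open>I 0\<close> is never used. Likewise only the values
  of \<open>T\<close> on \<open>branch_domain I\<close> matter.\<close>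

definition branch_domain :: "(nat \<Rightarrow> real set) \<Rightarrow> real set" where
  "branch_domain I = (\<Union>n\<in>{1..}. closure (I n))"

definition C1_diffeomorphism_on :: "(real \<Rightarrow> real) \<Rightarrow> real set \<Rightarrow> bool" where
  "C1_diffeomorphism_on f U \<longleftrightarrow>
     open U \<and> inj_on f U \<and> open (f ` U) \<and>
     f C1_differentiable_on U \<and> inv_into U f C1_differentiable_on f ` U"

text \<open>On \<open>I n\<close> this is the ordinary derivative. At an endpoint of \<open>I n\<close> it is a one-sided derivative;
  since the difference quotient involves \<open>T x\<close>, it exists only if \<open>T\<close> is continuous at \<open>x\<close>
  from that side. So at a common endpoint where \<open>T\<close> jumps (as the Gauss map does) only
  one of the two adjacent intervals contributes.\<close>

definition has_piece_deriv ::
    "(nat \<Rightarrow> real set) \<Rightarrow> (real \<Rightarrow> real) \<Rightarrow> real \<Rightarrow> real \<Rightarrow> bool" where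
  "has_piece_deriv I T x D \<longleftrightarrow>
     (\<exists>n\<ge>1. x \<in> closure (I n) \<and> (T has_real_derivative D) (at x within I n))"

text \<open>In the expansion condition the derivative of \<open>T ^^ m\<close> at \<open>x\<close>, where \<open>x\<close> may be an endpoint, is
  the product of the piecewise derivatives along the orbit, for any admissible choice \<open>d\<close> of
  them. Points whose orbit leaves the domain before time \<open>m\<close>, where \<open>T ^^ m\<close> is undefined,
  are not constrained, because \<open>has_piece_deriv\<close> fails outside \<open>branch_domain I\<close>.\<close>

definition markov_renyi :: "(nat \<Rightarrow> real set) \<Rightarrow> (real \<Rightarrow> real) \<Rightarrow> real \<Rightarrow> bool" where
  "markov_renyi I T \<gamma> \<longleftrightarrow>
     (\<forall>n\<ge>1. open (I n) \<and> is_interval (I n) \<and> I n \<noteq> {} \<and> I n \<subseteq> {0..1}) \<and>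
     disjoint_family_on I {1..} \<and>
     T ` branch_domain I \<subseteq> {0..1} \<and>
     (\<forall>x\<in>branch_domain I. \<exists>D. has_piece_deriv I T x D) \<and>
     (\<forall>n\<ge>1. \<exists>e. frontier (I n) \<inter> frontier (I (Suc n)) = {e}) \<and>
     (\<exists>p\<in>branch_domain I. \<exists>m\<ge>1. T p = p \<and>
        (\<forall>D. has_piece_deriv I T p D \<longrightarrow> \<bar>D\<bar> \<ge> 1) \<and>
        (\<forall>x\<in>branch_domain I - {p}. \<forall>d.
           (\<forall>j<m. has_piece_deriv I T ((T ^^ j) x) (d j)) \<longrightarrow> \<bar>\<Prod>j<m. d j\<bar> > 1)) \<and>
     (\<forall>n\<ge>1. closure (T ` I n) = {0..1}) \<and>
     \<gamma> > 1 \<and>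
     (\<exists>Tn :: nat \<Rightarrow> real \<Rightarrow> real.
        (\<forall>n\<ge>1. \<exists>U. closure (I n) \<subseteq> U \<and> C1_diffeomorphism_on (Tn n) U \<and>
           (\<forall>x\<in>I n. Tn n x = T x)) \<and>
        (\<exists>C>1. \<forall>n\<ge>1. \<forall>x\<in>closure (I n).
           inverse C * real n powr \<gamma> \<le> \<bar>deriv (Tn n) x\<bar> \<and>
           \<bar>deriv (Tn n) x\<bar> \<le> C * real n powr \<gamma>))"

text \<open>If the intervals do not fill \<open>[0,1]\<close>, a point of \<open>branch_domain I\<close> may leave the domain of
  \<open>T\<close> after finitely many steps. Orbits are then kept constant from the exit time on, so that the
  derivatives of the iterates stay constant as well. This is irrelevant for points all of whose
  iterates lie in \<open>branch_domain I\<close>, and it does not change the exceptional set inside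
  \<open>branch_domain I\<close>.\<close>

definition total_map :: "(nat \<Rightarrow> real set) \<Rightarrow> (real \<Rightarrow> real) \<Rightarrow> real \<Rightarrow> real" where
  "total_map I T x = (if x \<in> branch_domain I then T x else x)"

definition exceptional_set :: "(nat \<Rightarrow> real set) \<Rightarrow> (real \<Rightarrow> real) \<Rightarrow> real set" where
  "exceptional_set I T =
     (\<Union>k. (total_map I T ^^ k) -` ({0, 1} \<union> (\<Union>n\<in>{1..}. frontier (I n))))"

definition repeller :: "(nat \<Rightarrow> real set) \<Rightarrow> (real \<Rightarrow> real) \<Rightarrow> real set" where
  "repeller I T = branch_domain I - exceptional_set I T"

definition fast_exponent ::
    "(nat \<Rightarrow> real set) \<Rightarrow> (real \<Rightarrow> real) \<Rightarrow> (nat \<Rightarrow> real) \<Rightarrow> real \<Rightarrow> nat \<Rightarrow> ereal" where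
  "fast_exponent I T \<psi> x n = ereal (1 / \<psi> n * ln \<bar>deriv (total_map I T ^^ n) x\<bar>)"

definition upper_level_set ::
    "(nat \<Rightarrow> real set) \<Rightarrow> (real \<Rightarrow> real) \<Rightarrow> (nat \<Rightarrow> real) \<Rightarrow> ereal \<Rightarrow> real set" where
  "upper_level_set I T \<psi> \<alpha> = {x \<in> repeller I T. limsup (fast_exponent I T \<psi> x) = \<alpha>}"

definition lower_level_set ::
    "(nat \<Rightarrow> real set) \<Rightarrow> (real \<Rightarrow> real) \<Rightarrow> (nat \<Rightarrow> real) \<Rightarrow> ereal \<Rightarrow> real set" where
  "lower_level_set I T \<psi> \<alpha> = {x \<in> repeller I T. liminf (fast_exponent I T \<psi> x) = \<alpha>}"

definition lower_root_growth :: "(nat \<Rightarrow> real) \<Rightarrow> ereal" where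
  "lower_root_growth \<psi> = liminf (\<lambda>n. ereal (root n (\<psi> n)))"

definition upper_root_growth :: "(nat \<Rightarrow> real) \<Rightarrow> ereal" where
  "upper_root_growth \<psi> = limsup (\<lambda>n. ereal (root n (\<psi> n)))"

end

theory Submission
  imports Defs
begin

text \<open>Let \<open>a\<^sub>0, a\<^sub>1, \<dots>\<close> be the indices of the intervals visited by the orbit of \<open>x\<close> and
  \<open>S\<^sub>n = ln a\<^sub>0 + \<dots> + ln a\<^sub>n\<^sub>-\<^sub>1\<close>. By condition (5), \<open>ln \<bar>(T ^ n)' x\<bar> = \<gamma> S\<^sub>n + O(n)\<close>, and the error is
  negligible against \<open>\<psi> n\<close>; no distortion estimate is needed, since one step of the mean value
  theorem at a time compares distances of points with a common itinerary up to a factor \<open>C ^ n\<close>.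

  Upper bounds: the cylinders with \<open>S\<^sub>n \<ge> K n\<close> have summable \<open>s\<close>-th powers of diameters if
  \<open>\<gamma> s > 1\<close> and \<open>K\<close> is large. For \<open>s = 1\<close> this gives the null sets of part (i), and in general the
  bound \<open>1 / \<gamma>\<close>. If \<open>S\<^sub>n\<close> exceeds \<open>\<beta>' ^ n\<close> infinitely often and \<open>1 < \<beta> < \<beta>'\<close>, then at every record of
  \<open>S\<^sub>n / \<beta> ^ n\<close> the next digit is so large that one interval of length about
  \<open>exp (- ((\<gamma> - 1) \<beta> + 1) S\<^sub>n)\<close> covers all continuations of the word read so far.

  Lower bounds: if \<open>R\<close> is nondecreasing, \<open>R (n + 1) \<le> \<theta> R n\<close> and \<open>R n / n \<rightarrow> \<infinity>\<close>, the digits with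
  \<open>a\<^sub>n\<close> of order \<open>exp ((R (n + 1) - R n) / \<gamma>)\<close> code a Cantor set whose mixed radix
  parametrisation by \<open>[0,1)\<close> has a Hoelder inverse of every exponent below \<open>1 / ((\<gamma> - 1) \<theta> + 1)\<close>.
  Taking for \<open>R\<close> an envelope of \<open>\<alpha> \<psi>\<close> (of \<open>n \<psi> n\<close> if \<open>\<alpha> = \<infinity>\<close>) from below or from above puts this
  set into the upper or lower level set.\<close>

section \<open>Hausdorff measure and dimension\<close>

text \<open>Both bounds come from one count. Roughly \<open>exp S\<close> words have logarithmic
  digit sum \<open>S\<close>. The cylinder of such a word has length about
  \<open>exp (- \<gamma> S)\<close>. The intervals of index at least \<open>X\<close> have total
  length of order \<open>X powr (1 - \<gamma>)\<close>, so if the next digit is at least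
  \<open>exp ((\<theta> - 1) S)\<close>, all continuations together occupy only a fraction
  \<open>exp (- (\<gamma> - 1) (\<theta> - 1) S)\<close> of the cylinder. The product of the two
  lengths is \<open>exp (- ((\<gamma> - 1) \<theta> + 1) S)\<close>, and the critical exponent
  solves \<open>s ((\<gamma> - 1) \<theta> + 1) = 1\<close>. Covers by single cylinders give the
  case \<theta> = 1. As \<psi> may oscillate, the digits cannot follow it directly; the envelope
  limits the jumps to the factor \<theta> and still meets \<psi> infinitely often. It does so for
  \<theta> > b from below and for \<theta> > B from above, because an envelope that lost contact
  would grow like \<open>\<theta> ^ n\<close> in the first case and stay constant in the
  second.\<close>

lemma hausdorff_premeasure_le:
  assumes "A \<subseteq> (\<Union>i. U i)" "\<And>i. bounded (U i)" "\<And>i. diameter (U i) \<le> \<delta>"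
  shows "hausdorff_premeasure s \<delta> A \<le> (\<Sum>i. hausdorff_gauge s (U i))"
  unfolding hausdorff_premeasure_def by (rule Inf_lower) (use assms in blast)

lemma hausdorff_measure_zeroI:
  assumes "\<And>\<delta> \<epsilon>. \<delta> > 0 \<Longrightarrow> \<epsilon> > 0 \<Longrightarrow> hausdorff_premeasure s \<delta> A \<le> ennreal \<epsilon>"
  shows "hausdorff_measure s A = 0"
proof -
  have "hausdorff_premeasure s \<delta> A = 0" if "\<delta> > 0" for \<delta>
  proof -
    have "hausdorff_premeasure s \<delta> A \<le> 0"
      by (rule ennreal_le_epsilon) (use assms[OF that] in simp)
    then show ?thesis by simp
  qed
  then show ?thesis
    unfolding hausdorff_measure_def by (simp add: SUP_eq_const)
qed

lemma hausdorff_measure_zeroD: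
  assumes "hausdorff_measure s A = 0" "\<delta> > 0" "\<epsilon> > 0"
  obtains U :: "nat \<Rightarrow> 'a::metric_space set"
  where "A \<subseteq> (\<Union>i. U i)" "\<And>i. bounded (U i)" "\<And>i. diameter (U i) \<le> \<delta>"
    "(\<Sum>i. hausdorff_gauge s (U i)) < ennreal \<epsilon>"
proof -
  have "hausdorff_premeasure s \<delta> A \<le> hausdorff_measure s A"
    unfolding hausdorff_measure_def by (rule SUP_upper) (use assms in simp)
  then have "hausdorff_premeasure s \<delta> A < ennreal \<epsilon>"
    using assms by simp
  then show ?thesis
    unfolding hausdorff_premeasure_def Inf_less_iff using that by blast
qed

lemma hausdorff_measure_mono:
  assumes "A \<subseteq> B" shows "hausdorff_measure s A \<le> hausdorff_measure s B"
  unfolding hausdorff_measure_def hausdorff_premeasure_def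
  by (intro SUP_mono' Inf_superset_mono) (use assms in blast)

lemma hausdorff_measure_zero_subset:
  "A \<subseteq> B \<Longrightarrow> hausdorff_measure s B = 0 \<Longrightarrow> hausdorff_measure s A = 0"
  using hausdorff_measure_mono[of A B s] by simp

text \<open>The easy half of Borel-Cantelli: every tail of the sequence still covers
  \<open>A\<close>, tails of a convergent series are small, and the terms tend to 0, which forces
  the diameters below any \<open>\<delta>\<close>.\<close>

lemma hausdorff_measure_limsup_zero_nat:
  fixes U :: "nat \<Rightarrow> 'a::metric_space set"
  assumes s: "s > 0" and bd: "\<And>i. bounded (U i)"
    and fin: "(\<Sum>i. hausdorff_gauge s (U i)) < \<infinity>"
    and inf: "\<And>x. x \<in> A \<Longrightarrow> infinite {i. x \<in> U i}"
  shows "hausdorff_measure s A = 0"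
proof (rule hausdorff_measure_zeroI)
  fix \<delta> \<epsilon> :: real assume "\<delta> > 0" "\<epsilon> > 0"
  define r where "r i = (if U i = {} then 0 else diameter (U i) powr s)" for i
  have r0: "0 \<le> r i" for i by (simp add: r_def)
  have g: "hausdorff_gauge s (U i) = ennreal (r i)" for i
    using s by (simp add: r_def hausdorff_gauge_def)
  have sm: "summable r"
    by (rule summable_suminf_not_top) (use fin r0 g in auto)
  obtain N1 where N1: "\<And>n. n \<ge> N1 \<Longrightarrow> norm (\<Sum>i. r (i + n)) < \<epsilon>"
    using suminf_exist_split[OF \<open>\<epsilon> > 0\<close> sm] by blast
  have "r \<longlonglongrightarrow> 0" using sm by (rule summable_LIMSEQ_zero)
  then have "eventually (\<lambda>n. r n < \<delta> powr s) sequentially"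
    by (rule order_tendstoD) (use \<open>\<delta> > 0\<close> in simp)
  then obtain N2 where N2: "\<And>n. n \<ge> N2 \<Longrightarrow> r n < \<delta> powr s"
    by (auto simp: eventually_sequentially)
  define N where "N = max N1 N2"
  have diam: "diameter (U (i + N)) \<le> \<delta>" for i
  proof (cases "U (i + N) = {}")
    case False
    then have "diameter (U (i + N)) powr s < \<delta> powr s"
      using N2[of "i + N"] by (simp add: r_def N_def)
    then show ?thesis
      using s \<open>\<delta> > 0\<close> powr_mono2[of s \<delta> "diameter (U (i + N))"] by linarith
  qed (use \<open>\<delta> > 0\<close> in simp)
  have "A \<subseteq> (\<Union>i. U (i + N))"
  proof
    fix x assume "x \<in> A"
    then obtain i where "i \<ge> N" "x \<in> U i"
      using inf[of x] unfolding infinite_nat_iff_unbounded_le by blast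
    then show "x \<in> (\<Union>i. U (i + N))"
      by (intro UN_I[of "i - N"]) auto
  qed
  then have "hausdorff_premeasure s \<delta> A \<le> (\<Sum>i. hausdorff_gauge s (U (i + N)))"
    by (rule hausdorff_premeasure_le) (use bd diam in auto)
  also have "\<dots> = ennreal (\<Sum>i. r (i + N))"
    unfolding g by (rule suminf_ennreal2) (use r0 sm summable_ignore_initial_segment in auto)
  also have "\<dots> \<le> ennreal \<epsilon>"
    using N1[of N] by (intro ennreal_leI) (auto simp: N_def)
  finally show "hausdorff_premeasure s \<delta> A \<le> ennreal \<epsilon>" .
qed

text \<open>Indexing by words, with the sum written as an integral over counting measure, is the
  form in which sums over all words factor letter by letter.\<close>

lemma hausdorff_measure_limsup_zero:
  fixes U :: "nat list \<Rightarrow> 'a::metric_space set"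
  assumes "s > 0" "\<And>w. bounded (U w)"
    and fin: "(\<integral>\<^sup>+w. hausdorff_gauge s (U w) \<partial>count_space UNIV) < \<infinity>"
    and inf: "\<And>x. x \<in> A \<Longrightarrow> infinite {w. x \<in> U w}"
  shows "hausdorff_measure s A = 0"
proof -
  define E where "E = from_nat_into (UNIV :: nat list set)"
  have bij: "bij_betw E UNIV (UNIV :: nat list set)"
    unfolding E_def by (intro bij_betw_from_nat_into infinite_UNIV_listI) auto
  have sum: "(\<Sum>i. hausdorff_gauge s (U (E i))) = (\<integral>\<^sup>+w. hausdorff_gauge s (U w) \<partial>count_space UNIV)"
    using nn_integral_bij_count_space[OF bij, of "\<lambda>w. hausdorff_gauge s (U w)"]
    by (simp add: nn_integral_count_space_nat)
  show ?thesis
  proof (rule hausdorff_measure_limsup_zero_nat[where U = "\<lambda>i. U (E i)"])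
    fix x assume "x \<in> A"
    have "E ` {i. x \<in> U (E i)} = {w. x \<in> U w}"
      using bij unfolding bij_betw_def by (auto simp: surj_def)
    then show "infinite {i. x \<in> U (E i)}"
      using inf[OF \<open>x \<in> A\<close>] by (metis finite_imageI)
  qed (use assms sum in auto)
qed

lemma hausdorff_measure_UN_zero:
  fixes A :: "nat \<Rightarrow> 'a::metric_space set"
  assumes "\<And>n. hausdorff_measure s (A n) = 0"
  shows "hausdorff_measure s (\<Union>n. A n) = 0"
proof (rule hausdorff_measure_zeroI)
  fix \<delta> \<epsilon> :: real assume de: "\<delta> > 0" "\<epsilon> > 0"
  have "\<forall>n. \<exists>U. A n \<subseteq> (\<Union>i. U i) \<and> (\<forall>i. bounded (U i)) \<and> (\<forall>i. diameter (U i) \<le> \<delta>) \<and>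
      (\<Sum>i. hausdorff_gauge s (U i)) < ennreal (\<epsilon> / 2 ^ Suc n)"
  proof
    fix n
    show "\<exists>U. A n \<subseteq> (\<Union>i. U i) \<and> (\<forall>i. bounded (U i)) \<and> (\<forall>i. diameter (U i) \<le> \<delta>) \<and>
      (\<Sum>i. hausdorff_gauge s (U i)) < ennreal (\<epsilon> / 2 ^ Suc n)"
      by (rule hausdorff_measure_zeroD[OF assms[of n] de(1), of "\<epsilon> / 2 ^ Suc n"]) (use de in auto)
  qed
  then obtain U where U: "\<And>n. A n \<subseteq> (\<Union>i. U n i)" "\<And>n i. bounded (U n i)"
      "\<And>n i. diameter (U n i) \<le> \<delta>"
      "\<And>n. (\<Sum>i. hausdorff_gauge s (U n i)) < ennreal (\<epsilon> / 2 ^ Suc n)"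
    by metis
  define V where "V k = (case prod_decode k of (n, i) \<Rightarrow> U n i)" for k
  have "hausdorff_premeasure s \<delta> (\<Union>n. A n) \<le> (\<Sum>k. hausdorff_gauge s (V k))"
  proof (rule hausdorff_premeasure_le)
    show "(\<Union>n. A n) \<subseteq> (\<Union>i. V i)"
    proof
      fix x assume "x \<in> (\<Union>n. A n)"
      then obtain n i where "x \<in> U n i" using U(1) by blast
      then show "x \<in> (\<Union>i. V i)"
        by (intro UN_I[of "prod_encode (n, i)"]) (auto simp: V_def)
    qed
  qed (auto simp: V_def U split: prod.splits)
  also have "\<dots> = (\<Sum>k. (case prod_decode k of (n, i) \<Rightarrow> hausdorff_gauge s (U n i)))"
    by (simp add: V_def case_prod_beta)
  also have "\<dots> = (\<Sum>n. \<Sum>i. hausdorff_gauge s (U n i))"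
    by (subst suminf_ennreal_2dimen[where f = "\<lambda>(n, i). hausdorff_gauge s (U n i)"
          and g = "\<lambda>n. \<Sum>i. hausdorff_gauge s (U n i)", symmetric]) (simp_all add: comp_def)
  also have "\<dots> \<le> (\<Sum>n. ennreal (\<epsilon> / 2 ^ Suc n))"
    by (intro suminf_le) (use U(4) in \<open>auto intro: less_imp_le\<close>)
  also have "\<dots> = ennreal \<epsilon>"
  proof (rule suminf_ennreal_eq)
    show "(\<lambda>n. \<epsilon> / 2 ^ Suc n) sums \<epsilon>"
      using sums_mult[OF power_half_series, of \<epsilon>] by (simp add: power_one_over field_simps)
  qed (use de in simp)
  finally show "hausdorff_premeasure s \<delta> (\<Union>n. A n) \<le> ennreal \<epsilon>" .
qed

lemma hausdorff_measure_Un_zero: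
  assumes "hausdorff_measure s A = 0" "hausdorff_measure s B = 0"
  shows "hausdorff_measure s (A \<union> B) = 0"
proof -
  have "A \<union> B = (\<Union>n. if n = (0::nat) then A else B)" by (auto split: if_splits)
  then show ?thesis using hausdorff_measure_UN_zero[of s "\<lambda>n. if n = 0 then A else B"] assms by auto
qed

lemma hausdorff_measure_countable:
  assumes "countable A" "s > 0"
  shows "hausdorff_measure s A = 0"
proof (cases "A = {}")
  case True
  show ?thesis
    by (rule hausdorff_measure_limsup_zero_nat[where U = "\<lambda>_. {}"])
       (use assms True in \<open>auto simp: hausdorff_gauge_def\<close>)
next
  case False
  have "hausdorff_measure s {a} = 0" for a
    by (rule hausdorff_measure_limsup_zero_nat[where U = "\<lambda>_. {a}"])
       (use assms in \<open>auto simp: hausdorff_gauge_def\<close>)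
  then have "hausdorff_measure s (\<Union>n. {from_nat_into A n}) = 0"
    by (intro hausdorff_measure_UN_zero)
  also have "(\<Union>n. {from_nat_into A n}) = A"
    using range_from_nat_into[OF False assms(1)] by auto
  finally show ?thesis .
qed

section \<open>Dimension bounds and comparison with Lebesgue measure\<close>

lemma hausdorff_dim_le:
  assumes "\<And>s. s > 0 \<Longrightarrow> ereal s > d \<Longrightarrow> hausdorff_measure s A = 0" "0 \<le> d"
  shows "hausdorff_dim A \<le> d"
proof (rule ccontr)
  assume "\<not> ?thesis"
  then have "d < hausdorff_dim A" by simp
  then obtain s where s: "d < ereal s" "ereal s < hausdorff_dim A"
    using ereal_dense2 by blast
  then have "s > 0" using assms(2) by (metis ereal_less(2) order_le_less_trans)
  then have "hausdorff_dim A \<le> ereal s"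
    unfolding hausdorff_dim_def using assms(1)[of s] s by (intro Inf_lower) auto
  with s show False by simp
qed

lemma hausdorff_dim_ge:
  assumes "\<And>s. 0 \<le> s \<Longrightarrow> ereal s < d \<Longrightarrow> hausdorff_measure s A \<noteq> 0"
  shows "d \<le> hausdorff_dim A"
  unfolding hausdorff_dim_def
  by (rule Inf_greatest) (use assms in \<open>auto simp: not_less[symmetric]\<close>)

lemma hausdorff_dim_nonneg: "0 \<le> hausdorff_dim A"
  by (rule hausdorff_dim_ge) simp

text \<open>A mass distribution principle without a measure on \<open>E\<close>: a cover of
  \<open>E\<close> with small sum of gauges pulls back along \<open>g\<close> to intervals of small
  total length covering \<open>P\<close>. Only outer measure is estimated, so \<open>g\<close> may
  come from arbitrary choices. The passage from \<open>s\<close> to \<open>s'\<close> uses that the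
  covering sets have diameter at most 1.\<close>

lemma negligible_of_expanding_map:
  fixes g :: "real \<Rightarrow> 'a::metric_space"
  assumes ex: "\<And>t u. t \<in> P \<Longrightarrow> u \<in> P \<Longrightarrow> \<bar>t - u\<bar> \<le> K * dist (g t) (g u) powr s"
    and gE: "g ` P \<subseteq> E" and s: "0 < s" "0 \<le> s'" "s' \<le> s" and K: "K > 0"
    and H: "hausdorff_measure s' E = 0"
  shows "negligible P"
proof (rule negligible_outer_le[THEN iffD2], intro allI impI)
  fix \<epsilon> :: real assume "\<epsilon> > 0"
  obtain U where U: "E \<subseteq> (\<Union>i. U i)" "\<And>i. bounded (U i)" "\<And>i. diameter (U i) \<le> 1"
    "(\<Sum>i. hausdorff_gauge s' (U i)) < ennreal (\<epsilon> / (2 * K))"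
    using hausdorff_measure_zeroD[OF H, of 1 "\<epsilon> / (2 * K)"] \<open>\<epsilon> > 0\<close> K by auto
  define r where "r i = K * diameter (U i) powr s" for i
  \<comment> \<open>The preimage of \<open>U i\<close> may fail to be measurable; an interval of
    radius \<open>r i\<close> about one of its points contains it.\<close>
  define V where "V i = (if P \<inter> g -` U i = {} then {} else
      let t = (SOME t. t \<in> P \<inter> g -` U i) in {t - r i .. t + r i})" for i
  have r0: "r i \<ge> 0" for i using K by (simp add: r_def)
  have cov: "P \<subseteq> (\<Union>i. V i)"
  proof
    fix t assume t: "t \<in> P"
    then obtain i where i: "g t \<in> U i" using gE U(1) by blast
    define u where "u = (SOME t. t \<in> P \<inter> g -` U i)"
    have ne: "P \<inter> g -` U i \<noteq> {}" using t i by auto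
    then have u: "u \<in> P" "g u \<in> U i"
      using someI_ex[of "\<lambda>t. t \<in> P \<inter> g -` U i"] unfolding u_def by blast+
    have "\<bar>t - u\<bar> \<le> K * dist (g t) (g u) powr s" using ex t u by simp
    also have "\<dots> \<le> r i"
      unfolding r_def using K s diameter_bounded_bound[OF U(2) i u(2)]
      by (intro mult_left_mono powr_mono2) auto
    finally have "t \<in> V i"
      using ne unfolding V_def Let_def u_def[symmetric] by (auto simp: abs_le_iff)
    then show "t \<in> (\<Union>i. V i)" by blast
  qed
  have V: "V i \<in> sets lborel" "emeasure lborel (V i) \<le> ennreal (2 * K) * hausdorff_gauge s' (U i)" for i
  proof -
    show "V i \<in> sets lborel" by (simp add: V_def Let_def)
    show "emeasure lborel (V i) \<le> ennreal (2 * K) * hausdorff_gauge s' (U i)"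
    proof (cases "P \<inter> g -` U i = {}")
      case False
      then have ne: "U i \<noteq> {}" by auto
      have "emeasure lborel (V i) = ennreal (2 * r i)"
        using False r0[of i] by (simp add: V_def Let_def)
      also have "\<dots> = ennreal (2 * K) * ennreal (diameter (U i) powr s)"
        using K by (subst ennreal_mult[symmetric]) (auto simp: r_def)
      also have "ennreal (diameter (U i) powr s) \<le> hausdorff_gauge s' (U i)"
      \<comment> \<open>For \<open>s' = 0\<close> the gauge is the constant 1 rather than a power of
        the diameter.\<close>
      proof (cases "s' = 0")
        case True
        have "diameter (U i) powr s \<le> 1 powr s"
          using U(2,3) s by (intro powr_mono2) (auto simp: diameter_ge_0)
        then show ?thesis using True ne by (simp add: hausdorff_gauge_def)
      next
        case False
        then show ?thesis using ne U(2)[of i] U(3)[of i] s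
          by (auto simp: hausdorff_gauge_def diameter_ge_0 intro!: ennreal_leI powr_mono')
      qed
      finally show ?thesis by (simp add: mult_left_mono)
    qed (simp add: V_def)
  qed
  have meas: "(\<Union>i. V i) \<in> sets lborel" using V by blast
  have "emeasure lborel (\<Union>i. V i) \<le> (\<Sum>i. emeasure lborel (V i))"
    using V by (intro emeasure_subadditive_countably) auto
  also have "\<dots> \<le> (\<Sum>i. ennreal (2 * K) * hausdorff_gauge s' (U i))"
    by (intro suminf_le V) auto
  also have "\<dots> = ennreal (2 * K) * (\<Sum>i. hausdorff_gauge s' (U i))"
    by simp
  also have "\<dots> \<le> ennreal (2 * K) * ennreal (\<epsilon> / (2 * K))"
    using U(4) by (intro mult_left_mono) auto
  also have "\<dots> = ennreal \<epsilon>"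
    using K \<open>\<epsilon> > 0\<close> by (subst ennreal_mult[symmetric]) auto
  finally have le: "emeasure lebesgue (\<Union>i. V i) \<le> ennreal \<epsilon>"
    using meas by (simp add: emeasure_completion)
  moreover from this have "(\<Union>i. V i) \<in> lmeasurable"
    using meas by (intro fmeasurableI) (auto simp: sets_completionI_sets intro: le_less_trans)
  ultimately show "\<exists>T. P \<subseteq> T \<and> T \<in> lmeasurable \<and> Sigma_Algebra.measure lebesgue T \<le> \<epsilon>"
    using cov \<open>\<epsilon> > 0\<close>
    by (intro exI[of _ "\<Union>i. V i"]) (auto simp: emeasure_eq_measure2)
qed

lemma negligible_of_hausdorff_measure_zero:
  fixes A :: "real set"
  assumes "hausdorff_measure s A = 0" "0 \<le> s" "s \<le> 1"
  shows "negligible A"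
  by (rule negligible_of_expanding_map[where g = id and K = 1 and s = 1 and s' = s and E = A])
     (use assms in \<open>auto simp: dist_real_def\<close>)

lemma hausdorff_measure_unit_interval:
  assumes "s > 1"
  shows "hausdorff_measure s {0..1::real} = 0"
proof (rule hausdorff_measure_zeroI)
  fix \<delta> \<epsilon> :: real assume de: "\<delta> > 0" "\<epsilon> > 0"
  have "((\<lambda>N. real N powr (1 - s)) \<longlongrightarrow> 0) sequentially"
    using assms by (intro tendsto_neg_powr filterlim_real_sequentially) auto
  then have "eventually (\<lambda>N. real N powr (1 - s) < \<epsilon>) sequentially"
    by (rule order_tendstoD) (use de in simp)
  moreover have "eventually (\<lambda>N. 1 / real N < \<delta>) sequentially"
    by (rule order_tendstoD[OF lim_1_over_n]) (use de in simp)
  ultimately have "eventually (\<lambda>N. real N powr (1 - s) < \<epsilon> \<and> 1 / real N < \<delta> \<and> N > 0) sequentially"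
    using eventually_gt_at_top[of 0] by eventually_elim auto
  then obtain N where N: "real N powr (1 - s) < \<epsilon>" "1 / real N < \<delta>" "N > 0"
    by (auto simp: eventually_sequentially)
  define U where "U i = (if i < N then {real i / N .. (real i + 1) / N} else {})" for i
  have le: "real i / N \<le> (real i + 1) / N" for i by (simp add: divide_right_mono)
  have diam: "diameter (U i) = 1 / N" if "i < N" for i
    using that le[of i] by (simp add: U_def diff_divide_distrib[symmetric])
  have "hausdorff_premeasure s \<delta> {0..1::real} \<le> (\<Sum>i. hausdorff_gauge s (U i))"
  proof (rule hausdorff_premeasure_le)
    show "{0..1} \<subseteq> (\<Union>i. U i)"
    proof
      fix x :: real assume x: "x \<in> {0..1}"
      show "x \<in> (\<Union>i. U i)"
      proof (cases "x = 1")
        case True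
        then show ?thesis using N by (intro UN_I[of "N - 1"]) (auto simp: U_def of_nat_diff)
      next
        case False
        define i where "i = nat \<lfloor>x * N\<rfloor>"
        have "real i \<le> x * N" "x * N < real i + 1"
          using x by (auto simp: i_def)
        moreover have "x * N < N" using x False N by simp
        ultimately have "i < N" "real i \<le> x * N" "x * N < real i + 1" by linarith+
        then have "x \<in> U i"
          using N by (auto simp: U_def field_simps)
        with \<open>i < N\<close> have "i < N" "x \<in> U i" by blast+
        then show ?thesis by blast
      qed
    qed
    show "diameter (U i) \<le> \<delta>" for i
      using diam[of i] N de by (cases "i < N") (auto simp: U_def)
  qed (auto simp: U_def)
  also have "\<dots> = (\<Sum>i<N. hausdorff_gauge s (U i))"
    by (rule suminf_finite) (auto simp: U_def hausdorff_gauge_def)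
  also have "\<dots> = (\<Sum>i<N. ennreal ((1 / N) powr s))"
    using diam le assms by (intro sum.cong) (auto simp: hausdorff_gauge_def U_def not_le)
  also have "\<dots> = ennreal (real N powr (1 - s))"
    using N by (simp add: ennreal_of_nat_eq_real_of_nat ennreal_mult[symmetric] powr_diff powr_divide)
  also have "\<dots> \<le> ennreal \<epsilon>" using N by (intro ennreal_leI) simp
  finally show "hausdorff_premeasure s \<delta> {0..1::real} \<le> ennreal \<epsilon>" .
qed

lemma hausdorff_dim_eq_1:
  assumes "A \<subseteq> {0..1::real}" "\<not> negligible A"
  shows "hausdorff_dim A = 1"
proof (rule antisym)
  show "hausdorff_dim A \<le> 1"
  proof (rule hausdorff_dim_le)
    fix s assume "1 < ereal s"
    then show "hausdorff_measure s A = 0"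
      using hausdorff_measure_zero_subset[OF assms(1) hausdorff_measure_unit_interval] by simp
  qed simp
  show "1 \<le> hausdorff_dim A"
  proof (rule hausdorff_dim_ge)
    fix s assume "0 \<le> s" "ereal s < 1"
    then show "hausdorff_measure s A \<noteq> 0"
      using negligible_of_hausdorff_measure_zero[of s A] assms by auto
  qed
qed

section \<open>Branch systems and itineraries\<close>

definition itinerary :: "(nat \<Rightarrow> real set) \<Rightarrow> (real \<Rightarrow> real) \<Rightarrow> real \<Rightarrow> (nat \<Rightarrow> nat) \<Rightarrow> bool" where
  "itinerary I T x a \<longleftrightarrow> (\<forall>j. 1 \<le> a j \<and> (total_map I T ^^ j) x \<in> I (a j))"

text \<open>Disjoint intervals with consecutive ones adjacent march in one direction;
  \<open>\<sigma>\<close> is that direction, and after multiplication by it the endpoints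
  \<open>e\<close> increase. \<open>G n\<close> extends \<open>T\<close> continuously from
  \<open>I n\<close> to its closure, since at a common endpoint \<open>T\<close> has a single value
  for two branches. The instance is built in \<open>markov_renyi_branch_system\<close>.\<close>

locale branch_system =
  fixes I :: "nat \<Rightarrow> real set" and T :: "real \<Rightarrow> real" and \<gamma> C \<sigma> :: real
    and e :: "nat \<Rightarrow> real" and G :: "nat \<Rightarrow> real \<Rightarrow> real"
  assumes gamma: "1 < \<gamma>" and C: "1 < C" and sigma: "\<sigma> = 1 \<or> \<sigma> = -1"
    and e_mono: "strict_mono e"
    and I_Suc: "I (Suc n) = {x. e n < \<sigma> * x \<and> \<sigma> * x < e (Suc n)}"
    and I_unit: "n \<ge> 1 \<Longrightarrow> I n \<subseteq> {0..1}"
    and T_unit: "x \<in> branch_domain I \<Longrightarrow> T x \<in> {0..1}"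
    and T_deriv: "n \<ge> 1 \<Longrightarrow> x \<in> I n \<Longrightarrow> \<exists>D. (T has_real_derivative D) (at x) \<and>
        real n powr \<gamma> / C \<le> \<bar>D\<bar> \<and> \<bar>D\<bar> \<le> C * real n powr \<gamma>"
    and T_dense: "n \<ge> 1 \<Longrightarrow> closure (T ` I n) = {0..1}"
    and G_cont: "n \<ge> 1 \<Longrightarrow> continuous_on (closure (I n)) (G n)"
    and G_onto: "n \<ge> 1 \<Longrightarrow> G n ` closure (I n) = {0..1}"
    and G_eq: "n \<ge> 1 \<Longrightarrow> x \<in> I n \<Longrightarrow> G n x = T x"
    and G_end: "n \<ge> 1 \<Longrightarrow> x \<in> closure (I n) - I n \<Longrightarrow> G n x \<in> {0, 1}"
begin

abbreviation F :: "real \<Rightarrow> real" where "F \<equiv> total_map I T"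

lemma sigma_sq: "\<sigma> * (\<sigma> * x) = x"
  using sigma by auto

lemma abs_sigma: "\<bar>\<sigma> * x\<bar> = \<bar>x\<bar>"
  using sigma by auto

lemma e_less: "m < n \<Longrightarrow> e m < e n" and e_le: "m \<le> n \<Longrightarrow> e m \<le> e n"
  using e_mono by (auto simp: strict_mono_less strict_mono_less_eq)

lemma closure_I_Suc: "closure (I (Suc n)) = {x. e n \<le> \<sigma> * x \<and> \<sigma> * x \<le> e (Suc n)}"
proof -
  have "e n < e (Suc n)" by (simp add: e_less)
  from sigma show ?thesis
  proof
    assume s: "\<sigma> = 1"
    have "I (Suc n) = {e n<..<e (Suc n)}" by (auto simp: I_Suc s)
    with \<open>e n < e (Suc n)\<close> show ?thesis by (auto simp: s)
  next
    assume s: "\<sigma> = -1"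
    have "I (Suc n) = {- e (Suc n)<..<- e n}" by (auto simp: I_Suc s)
    with \<open>e n < e (Suc n)\<close> show ?thesis by (auto simp: s)
  qed
qed

lemma open_I: "n \<ge> 1 \<Longrightarrow> open (I n)"
  by (cases n) (auto simp: I_Suc intro!: open_Collect_conj open_Collect_less continuous_intros)

lemma interval_I: "n \<ge> 1 \<Longrightarrow> is_interval (I n)"
proof -
  assume "n \<ge> 1"
  then obtain m where m: "n = Suc m" by (cases n) auto
  show ?thesis
    using sigma unfolding m I_Suc is_interval_1 by auto
qed

lemma frontier_I_Suc: "frontier (I (Suc n)) = {\<sigma> * e n, \<sigma> * e (Suc n)}"
proof -
  have *: "\<sigma> * x = y \<longleftrightarrow> x = \<sigma> * y" for x y using sigma by auto
  have "frontier (I (Suc n)) = closure (I (Suc n)) - I (Suc n)"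
    by (simp add: frontier_def interior_open[OF open_I])
  also have "\<dots> = {\<sigma> * e n, \<sigma> * e (Suc n)}"
    unfolding closure_I_Suc unfolding I_Suc using e_less[of n "Suc n"] *[of _ "e n"] *[of _ "e (Suc n)"]
    by (auto simp: sigma_sq order.strict_iff_order)
  finally show ?thesis .
qed

lemma closure_I: "n \<ge> 1 \<Longrightarrow> closure (I n) = I n \<union> frontier (I n)"
  using open_I[of n] closure_subset[of "I n"] by (auto simp: frontier_def interior_open)

lemma branch_domain_eq: "branch_domain I = (\<Union>n. closure (I (Suc n)))"
  unfolding branch_domain_def by (auto simp: Bex_def) (metis Suc_le_D One_nat_def)

lemma I_branch_domain: "n \<ge> 1 \<Longrightarrow> I n \<subseteq> branch_domain I"
  unfolding branch_domain_def using closure_subset by fastforce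

text \<open>The intervals abut, so their closures leave no gap: the domain is an interval that lacks
  only the end at which the intervals accumulate. \<open>not_branch_domain\<close> depends on
  this.\<close>

lemma branch_domain_iff: "x \<in> branch_domain I \<longleftrightarrow> e 0 \<le> \<sigma> * x \<and> (\<exists>n. \<sigma> * x \<le> e n)"
proof
  assume "x \<in> branch_domain I"
  then obtain n where "e n \<le> \<sigma> * x" "\<sigma> * x \<le> e (Suc n)"
    by (auto simp: branch_domain_eq closure_I_Suc)
  then show "e 0 \<le> \<sigma> * x \<and> (\<exists>n. \<sigma> * x \<le> e n)"
    using e_le[of 0 n] by auto
next
  assume x: "e 0 \<le> \<sigma> * x \<and> (\<exists>n. \<sigma> * x \<le> e n)"
  define n where "n = (LEAST n. \<sigma> * x \<le> e n)"
  have n: "\<sigma> * x \<le> e n" using x unfolding n_def by (metis LeastI)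
  show "x \<in> branch_domain I"
  proof (cases n)
    case 0
    then have "\<sigma> * x = e 0" using x n by auto
    then have "x \<in> closure (I (Suc 0))"
      using e_less[of 0 1] by (simp add: closure_I_Suc)
    then show ?thesis by (auto simp: branch_domain_eq)
  next
    case (Suc m)
    then have "\<not> \<sigma> * x \<le> e m"
      using not_less_Least[of m "\<lambda>n. \<sigma> * x \<le> e n"] unfolding n_def by auto
    then have "x \<in> closure (I (Suc m))"
      using n Suc by (simp add: closure_I_Suc)
    then show ?thesis by (auto simp: branch_domain_eq)
  qed
qed

lemma branch_domain_unit: "branch_domain I \<subseteq> {0..1}"
  unfolding branch_domain_def using closure_mono[OF I_unit] by fastforce

lemma F_unit: "x \<in> {0..1} \<Longrightarrow> F x \<in> {0..1}"
  using T_unit by (auto simp: total_map_def)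

lemma F_iter_unit: "x \<in> {0..1} \<Longrightarrow> (F ^^ n) x \<in> {0..1}"
  by (induction n) (use F_unit in \<open>auto simp del: atLeastAtMost_iff\<close>)

lemma F_eq: "n \<ge> 1 \<Longrightarrow> x \<in> I n \<Longrightarrow> F x = T x"
  using I_branch_domain by (auto simp: total_map_def)

lemma I_disjoint:
  assumes "x \<in> I m" "x \<in> I n" "m \<ge> 1" "n \<ge> 1" shows "m = n"
proof -
  have "\<not> k < l" if "x \<in> I (Suc k)" "x \<in> I (Suc l)" for k l
    using that e_le[of "Suc k" l] by (auto simp: I_Suc)
  then show ?thesis using assms by (cases m; cases n) (auto, meson linorder_neqE_nat)
qed

lemma T_contract:
  assumes "n \<ge> 1" "x \<in> I n" "y \<in> I n"
  shows "real n powr \<gamma> / C * \<bar>x - y\<bar> \<le> \<bar>T x - T y\<bar>" "\<bar>T x - T y\<bar> \<le> C * real n powr \<gamma> * \<bar>x - y\<bar>"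
proof -
  have *: "real n powr \<gamma> / C * \<bar>x - y\<bar> \<le> \<bar>T x - T y\<bar> \<and> \<bar>T x - T y\<bar> \<le> C * real n powr \<gamma> * \<bar>x - y\<bar>"
    if "x < y" "x \<in> I n" "y \<in> I n" for x y
  proof -
    from T_deriv[OF assms(1)] obtain D where D: "\<And>z. z \<in> I n \<Longrightarrow> (T has_real_derivative D z) (at z)"
      "\<And>z. z \<in> I n \<Longrightarrow> real n powr \<gamma> / C \<le> \<bar>D z\<bar>" "\<And>z. z \<in> I n \<Longrightarrow> \<bar>D z\<bar> \<le> C * real n powr \<gamma>"
      by metis
    have sub: "z \<in> I n" if "x \<le> z" "z \<le> y" for z
      using interval_I[OF assms(1)] that \<open>x \<in> I n\<close> \<open>y \<in> I n\<close> unfolding is_interval_1 by blast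
    obtain z where z: "x < z" "z < y" "T y - T x = (y - x) * D z"
      using MVT2[OF \<open>x < y\<close>, of T D] D(1) sub by auto
    have "\<bar>T x - T y\<bar> = \<bar>D z\<bar> * \<bar>x - y\<bar>"
      using z(3) by (metis abs_minus_commute abs_mult mult.commute)
    moreover have "z \<in> I n" using sub z(1,2) by simp
    ultimately show ?thesis
      using mult_right_mono[OF D(2), of z "\<bar>x - y\<bar>"] mult_right_mono[OF D(3), of z "\<bar>x - y\<bar>"] by simp
  qed
  show "real n powr \<gamma> / C * \<bar>x - y\<bar> \<le> \<bar>T x - T y\<bar>" "\<bar>T x - T y\<bar> \<le> C * real n powr \<gamma> * \<bar>x - y\<bar>"
    using *[of x y] *[of y x] assms by (cases x y rule: linorder_cases; simp add: abs_minus_commute)+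
qed

lemma F_iter_contract:
  assumes "\<And>j. j < n \<Longrightarrow> 1 \<le> a j \<and> (F ^^ j) x \<in> I (a j) \<and> (F ^^ j) y \<in> I (a j)"
  shows "(\<Prod>j<n. real (a j) powr \<gamma> / C) * \<bar>x - y\<bar> \<le> \<bar>(F ^^ n) x - (F ^^ n) y\<bar> \<and>
    \<bar>(F ^^ n) x - (F ^^ n) y\<bar> \<le> (\<Prod>j<n. C * real (a j) powr \<gamma>) * \<bar>x - y\<bar>"
  using assms
proof (induction n)
  case (Suc n)
  have n: "1 \<le> a n" "(F ^^ n) x \<in> I (a n)" "(F ^^ n) y \<in> I (a n)"
    using Suc.prems by auto
  let ?d = "\<bar>(F ^^ n) x - (F ^^ n) y\<bar>" and ?d' = "\<bar>(F ^^ Suc n) x - (F ^^ Suc n) y\<bar>"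
  have IH: "(\<Prod>j<n. real (a j) powr \<gamma> / C) * \<bar>x - y\<bar> \<le> ?d"
    "?d \<le> (\<Prod>j<n. C * real (a j) powr \<gamma>) * \<bar>x - y\<bar>"
    using Suc by auto
  have T: "real (a n) powr \<gamma> / C * ?d \<le> ?d'" "?d' \<le> C * real (a n) powr \<gamma> * ?d"
    using T_contract[OF n] n by (simp_all add: F_eq)
  have "real (a n) powr \<gamma> / C * ((\<Prod>j<n. real (a j) powr \<gamma> / C) * \<bar>x - y\<bar>) \<le> ?d'"
    using order_trans[OF mult_left_mono[OF IH(1)] T(1)] C by simp
  moreover have "?d' \<le> C * real (a n) powr \<gamma> * ((\<Prod>j<n. C * real (a j) powr \<gamma>) * \<bar>x - y\<bar>)"
    using order_trans[OF T(2) mult_left_mono[OF IH(2)]] C by simp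
  ultimately show ?case by (simp add: mult_ac)
qed simp

lemma itinerary_deriv:
  assumes "itinerary I T x a"
  shows "\<exists>D. (F ^^ n has_real_derivative D) (at x) \<and> D \<noteq> 0 \<and>
    \<bar>ln \<bar>D\<bar> - \<gamma> * (\<Sum>j<n. ln (real (a j)))\<bar> \<le> real n * ln C"
proof (induction n)
  case (Suc n)
  then obtain D where D: "(F ^^ n has_real_derivative D) (at x)" "D \<noteq> 0"
    "\<bar>ln \<bar>D\<bar> - \<gamma> * (\<Sum>j<n. ln (real (a j)))\<bar> \<le> real n * ln C" by blast
  let ?y = "(F ^^ n) x" and ?a = "real (a n)"
  have a: "1 \<le> a n" "?y \<in> I (a n)" using assms by (auto simp: itinerary_def)
  obtain E where E: "(T has_real_derivative E) (at ?y)"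
      "?a powr \<gamma> / C \<le> \<bar>E\<bar>" "\<bar>E\<bar> \<le> C * ?a powr \<gamma>"
    using T_deriv[OF a] by blast
  have "(F has_real_derivative E) (at ?y)"
    by (rule has_field_derivative_transform_within_open[OF E(1) open_I[OF a(1)] a(2)])
       (simp add: F_eq[OF a(1)])
  then have 1: "(F ^^ Suc n has_real_derivative E * D) (at x)"
    using DERIV_chain[of F E "F ^^ n" x D UNIV] D(1) by simp
  have "0 < ?a powr \<gamma> / C" using a C by simp
  then have "0 < \<bar>E\<bar>" using E(2) by linarith
  have "ln (?a powr \<gamma> / C) \<le> ln \<bar>E\<bar>"
    using E(2) \<open>0 < ?a powr \<gamma> / C\<close> \<open>0 < \<bar>E\<bar>\<close> by (subst ln_le_cancel_iff) auto
  moreover have "ln \<bar>E\<bar> \<le> ln (C * ?a powr \<gamma>)"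
    using E(3) \<open>0 < \<bar>E\<bar>\<close> a C by (subst ln_le_cancel_iff) auto
  moreover have "ln (?a powr \<gamma> / C) = \<gamma> * ln ?a - ln C" "ln (C * ?a powr \<gamma>) = \<gamma> * ln ?a + ln C"
    using a C by (simp_all add: ln_div ln_mult ln_powr)
  ultimately have "\<bar>ln \<bar>E\<bar> - \<gamma> * ln ?a\<bar> \<le> ln C" by linarith
  moreover have "ln \<bar>E * D\<bar> = ln \<bar>E\<bar> + ln \<bar>D\<bar>"
    using \<open>0 < \<bar>E\<bar>\<close> D(2) by (simp add: abs_mult ln_mult)
  ultimately have "\<bar>ln \<bar>E * D\<bar> - \<gamma> * (\<Sum>j<Suc n. ln (real (a j)))\<bar> \<le> real (Suc n) * ln C"
    using D(3) by (simp add: algebra_simps abs_le_iff)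
  moreover have "E * D \<noteq> 0" using D(2) \<open>0 < \<bar>E\<bar>\<close> by simp
  ultimately show ?case using 1 by blast
qed (auto simp: id_def intro!: exI[of _ 1])

lemma itinerary_ln_deriv:
  assumes "itinerary I T x a"
  shows "\<bar>ln \<bar>deriv (F ^^ n) x\<bar> - \<gamma> * (\<Sum>j<n. ln (real (a j)))\<bar> \<le> real n * ln C"
  using itinerary_deriv[OF assms, of n] DERIV_imp_deriv by metis

lemma itinerary_unit: "itinerary I T x a \<Longrightarrow> x \<in> {0..1}"
  unfolding itinerary_def using I_unit by (metis funpow_0 in_mono)

section \<open>The repeller: points with an itinerary and points that leave the domain\<close>

lemma itinerary_repeller:
  assumes "itinerary I T x a"
  shows "x \<in> repeller I T"
proof -
  have a: "1 \<le> a j" "(F ^^ j) x \<in> I (a j)" for j using assms by (auto simp: itinerary_def)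
  have "(F ^^ j) x \<notin> {0, 1} \<union> (\<Union>n\<in>{1..}. frontier (I n))" for j
  proof -
    obtain m where m: "a j = Suc m" using a[of j] by (cases "a j") auto
    have "I (a j) \<subseteq> interior {0..1}"
      using a(1)[of j] by (intro interior_maximal I_unit open_I)
    then have "(F ^^ j) x \<notin> {0, 1}" using a(2)[of j] by auto
    moreover have "(F ^^ j) x \<notin> frontier (I n)" if n: "n \<ge> 1" for n
    proof -
      obtain l where l: "n = Suc l" using n by (cases n) auto
      have ne: "\<sigma> * (F ^^ j) x \<noteq> e k" for k
        using a(2)[of j] e_le[of k m] e_le[of "Suc m" k] unfolding m I_Suc
        by (cases "k \<le> m") auto
      show ?thesis using ne[of l] ne[of n] unfolding l frontier_I_Suc by (auto simp: sigma_sq)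
    qed
    ultimately show ?thesis by auto
  qed
  then show ?thesis
    using a[of 0] I_branch_domain unfolding repeller_def exceptional_set_def by auto
qed

text \<open>The point \<open>\<sigma> * (SUP n. e n)\<close>, where the intervals accumulate, lies
  outside the domain but not in the interior of its complement: \<open>total_map\<close> fixes it,
  yet acts by \<open>T\<close> arbitrarily close to it. The points whose orbits end there are set
  aside as a countable set.\<close>

definition border :: "real set" where
  "border = (\<Union>k. (F ^^ k) -` {\<sigma> * (SUP n. e n)})"

lemma e_bounded: "bdd_above (range e)"
proof
  fix y assume "y \<in> range e"
  then obtain n where n: "y = e n" by auto
  have "\<sigma> * e n \<in> closure (I (Suc n))"
    by (simp add: closure_I_Suc sigma_sq e_le)
  then have "\<sigma> * e n \<in> {0..1}" using branch_domain_unit unfolding branch_domain_eq by blast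
  then show "y \<le> 1" using sigma n by auto
qed

lemma not_branch_domain:
  assumes "y \<notin> branch_domain I" "y \<noteq> \<sigma> * (SUP n. e n)"
  shows "\<exists>S. open S \<and> y \<in> S \<and> S \<inter> branch_domain I = {}"
proof (cases "\<sigma> * y < e 0")
  case True
  then show ?thesis
    by (intro exI[of _ "{x. \<sigma> * x < e 0}"])
       (auto simp: branch_domain_iff intro!: open_Collect_less continuous_intros)
next
  case False
  then have "e n \<le> \<sigma> * y" for n
    using assms(1) by (auto simp: branch_domain_iff not_le intro: less_imp_le)
  then have "(SUP n. e n) \<le> \<sigma> * y" by (intro cSUP_least) auto
  moreover have "(SUP n. e n) \<noteq> \<sigma> * y" using assms(2) sigma_sq[of y] by auto
  ultimately have "(SUP n. e n) < \<sigma> * y" by simp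
  moreover have "e n \<le> (SUP n. e n)" for n using e_bounded by (intro cSUP_upper) auto
  then have "x \<notin> branch_domain I" if "(SUP n. e n) < \<sigma> * x" for x
    using that by (auto simp: branch_domain_iff not_le intro: le_less_trans)
  ultimately show ?thesis
    by (intro exI[of _ "{x. (SUP n. e n) < \<sigma> * x}"])
       (auto intro!: open_Collect_less continuous_intros)
qed

text \<open>At its first exit the orbit enters the interior of the complement of the domain, where
  \<open>total_map\<close> is the identity. By continuity of \<open>F ^^ k\<close> at
  \<open>x\<close> nearby points are outside at time \<open>k\<close> too, so near \<open>x\<close>
  all later iterates coincide with \<open>F ^^ k\<close>.\<close>

lemma repeller_cases:
  assumes x: "x \<in> repeller I T" and b: "x \<notin> border"
  obtains (itinerary) a where "itinerary I T x a"
  | (exit) k where "\<forall>n\<ge>k. deriv (F ^^ n) x = deriv (F ^^ k) x"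
proof (cases "\<forall>j. (F ^^ j) x \<in> branch_domain I")
  case True
  have "\<exists>n. 1 \<le> n \<and> (F ^^ j) x \<in> I n" for j
  proof -
    obtain n where n: "1 \<le> n" "(F ^^ j) x \<in> closure (I n)"
      using True by (auto simp: branch_domain_def)
    then have "(F ^^ j) x \<notin> frontier (I n)"
      using x by (auto simp: repeller_def exceptional_set_def)
    with n show ?thesis using closure_I by blast
  qed
  then show ?thesis
    using itinerary unfolding itinerary_def by metis
next
  case False
  define k where "k = (LEAST j. (F ^^ j) x \<notin> branch_domain I)"
  have k: "(F ^^ k) x \<notin> branch_domain I"
    using LeastI_ex[of "\<lambda>j. (F ^^ j) x \<notin> branch_domain I"] False unfolding k_def by simp
  have before: "(F ^^ j) x \<in> branch_domain I" if "j < k" for j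
    using not_less_Least[of j] that unfolding k_def by blast
  \<comment> \<open>Before the exit the orbit runs through open intervals only, since a point of the
    repeller never meets an endpoint; there the map is differentiable, hence continuous.\<close>
  have cont: "j \<le> k \<Longrightarrow> isCont (F ^^ j) x" for j
  proof (induction j)
    case (Suc j)
    obtain n where n: "1 \<le> n" "(F ^^ j) x \<in> closure (I n)"
      using before[of j] Suc by (auto simp: branch_domain_def)
    then have "(F ^^ j) x \<notin> frontier (I n)"
      using x by (auto simp: repeller_def exceptional_set_def)
    with n have nI: "(F ^^ j) x \<in> I n" using closure_I by blast
    obtain D where "(T has_real_derivative D) (at ((F ^^ j) x))"
      using T_deriv[OF n(1) nI] by blast
    then have "(F has_real_derivative D) (at ((F ^^ j) x))"
      by (rule has_field_derivative_transform_within_open[OF _ open_I[OF n(1)] nI])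
         (simp add: F_eq[OF n(1)])
    then have "isCont F ((F ^^ j) x)" by (rule DERIV_isCont)
    then show ?case using Suc by (auto simp: comp_def intro: isCont_o2)
  qed (simp add: id_def)
  have "(F ^^ k) x \<noteq> \<sigma> * (SUP n. e n)" using b by (auto simp: border_def)
  from not_branch_domain[OF k this] obtain S where S: "open S" "(F ^^ k) x \<in> S"
    "S \<inter> branch_domain I = {}" by blast
  have "eventually (\<lambda>y. (F ^^ k) y \<in> S) (at x)"
    using cont[of k] S unfolding isCont_def by (auto intro: topological_tendstoD)
  then have ev: "eventually (\<lambda>y. (F ^^ k) y \<in> S) (nhds x)"
    using S(2) by (simp add: eventually_nhds_conv_at)
  have const: "(F ^^ (m + k)) y = (F ^^ k) y" if "(F ^^ k) y \<in> S" for m y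
  proof (induction m)
    case (Suc m)
    have "(F ^^ k) y \<notin> branch_domain I" using that S(3) by blast
    then have "F ((F ^^ k) y) = (F ^^ k) y" unfolding total_map_def by simp
    with Suc show ?case by simp
  qed simp
  have "deriv (F ^^ n) x = deriv (F ^^ k) x" if "n \<ge> k" for n
  proof (rule deriv_cong_ev)
    show "eventually (\<lambda>y. (F ^^ n) y = (F ^^ k) y) (nhds x)"
      using ev by eventually_elim (use const[of _ "n - k"] that in simp)
  qed simp
  then show ?thesis using exit by blast
qed

text \<open>\<open>T\<close> is injective on each open interval, so a point has at most one preimage
  there; the endpoints and the points fixed by \<open>total_map\<close> add only countably
  many.\<close>

lemma countable_F_vimage:
  assumes "countable S" shows "countable (F -` S)"
proof -
  have "F -` S \<subseteq> (\<Union>n. {x \<in> I (Suc n). T x \<in> S}) \<union> (\<Union>n. frontier (I (Suc n))) \<union> S"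
    using closure_I by (auto simp: total_map_def branch_domain_eq split: if_splits)
  moreover have "countable {x \<in> I (Suc n). T x \<in> S}" for n
  proof (rule countable_image_inj_on)
    show "countable (T ` {x \<in> I (Suc n). T x \<in> S})"
      by (rule countable_subset[OF _ assms]) auto
    show "inj_on T {x \<in> I (Suc n). T x \<in> S}"
    proof (rule inj_onI)
      fix x y assume "x \<in> {x \<in> I (Suc n). T x \<in> S}" "y \<in> {x \<in> I (Suc n). T x \<in> S}" "T x = T y"
      then have "real (Suc n) powr \<gamma> / C * \<bar>x - y\<bar> \<le> 0"
        using T_contract(1)[of "Suc n" x y] by simp
      then show "x = y" using C by (simp add: mult_le_0_iff divide_le_0_iff del: of_nat_Suc)
    qed
  qed
  ultimately show ?thesis
    using assms by (auto simp: frontier_I_Suc elim!: countable_subset)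
qed

lemma countable_F_iter_vimage: "countable S \<Longrightarrow> countable ((F ^^ k) -` S)"
proof (induction k arbitrary: S)
  case (Suc k)
  have "(F ^^ Suc k) -` S = (F ^^ k) -` (F -` S)" by auto
  then show ?case using Suc countable_F_vimage by metis
qed simp

lemma countable_border: "countable border"
  unfolding border_def by (intro countable_UN countable_F_iter_vimage) auto

lemma countable_exceptional: "countable (exceptional_set I T)"
proof -
  have "(\<Union>n\<in>{1..}. frontier (I n)) = (\<Union>n. frontier (I (Suc n)))"
    by auto (metis One_nat_def Suc_le_D)
  then show ?thesis
    unfolding exceptional_set_def by (intro countable_UN countable_F_iter_vimage) (auto simp: frontier_I_Suc)
qed

text \<open>On this interval \<open>T\<close> has slope of order
  \<open>real (Suc n) powr \<gamma>\<close> and its image is dense in [0,1], so the length is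
  comparable to the reciprocal slope.\<close>

lemma I_length:
  shows "e (Suc n) - e n \<le> C * real (Suc n) powr - \<gamma>"
    and "real (Suc n) powr - \<gamma> / (2 * C) \<le> e (Suc n) - e n"
proof -
  let ?g = "real (Suc n) powr \<gamma>"
  have g: "?g > 0" by simp
  show "e (Suc n) - e n \<le> C * real (Suc n) powr - \<gamma>"
  proof (rule field_le_epsilon)
    fix \<epsilon> :: real assume \<epsilon>: "\<epsilon> > 0"
    \<comment> \<open>\<open>T_contract\<close> speaks of points of the open interval, so the
      endpoints are approached up to \<open>\<delta>\<close>; dividing by 3 keeps the two points in
      order and the loss \<open>2 * \<delta>\<close> below \<open>\<epsilon>\<close>.\<close>
    define \<delta> where "\<delta> = min \<epsilon> ((e (Suc n) - e n)) / 3"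
    have \<delta>: "\<delta> > 0" "3 * \<delta> \<le> \<epsilon>" "3 * \<delta> \<le> e (Suc n) - e n"
      using \<epsilon> e_less[of n "Suc n"] by (auto simp: \<delta>_def)
    let ?x = "\<sigma> * (e n + \<delta>)" and ?y = "\<sigma> * (e (Suc n) - \<delta>)"
    have xy: "?x \<in> I (Suc n)" "?y \<in> I (Suc n)" using \<delta> by (auto simp: I_Suc sigma_sq)
    have "?g / C * \<bar>?x - ?y\<bar> \<le> \<bar>T ?x - T ?y\<bar>"
      by (rule T_contract) (use xy in auto)
    also have "\<dots> \<le> 1"
    proof -
      have "?x \<in> branch_domain I" "?y \<in> branch_domain I" using xy I_branch_domain[of "Suc n"] by auto
      then have "T ?x \<in> {0..1}" "T ?y \<in> {0..1}" using T_unit by blast+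
      then show ?thesis by (auto simp: abs_le_iff)
    qed
    finally have "\<bar>?x - ?y\<bar> \<le> C / ?g" using C g by (simp add: field_simps)
    also have "C / ?g = C * real (Suc n) powr - \<gamma>" by (simp add: powr_minus divide_inverse)
    also have "\<bar>?x - ?y\<bar> = e (Suc n) - e n - 2 * \<delta>"
      using abs_sigma[of "e n + \<delta> - (e (Suc n) - \<delta>)"] \<delta> by (simp add: algebra_simps)
    finally show "e (Suc n) - e n \<le> C * real (Suc n) powr - \<gamma> + \<epsilon>" using \<delta> by linarith
  qed
  \<comment> \<open>Images within 1/4 of 0 and of 1 are at least 1/2 apart, whence the 2 in
    \<open>2 * C\<close>.\<close>
  have "0 \<in> closure (T ` I (Suc n))" "1 \<in> closure (T ` I (Suc n))" using T_dense by auto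
  then have "\<exists>x\<in>T ` I (Suc n). dist x 0 < 1/4" "\<exists>x\<in>T ` I (Suc n). dist x 1 < 1/4"
    unfolding closure_approachable by (auto dest!: spec[of _ "1/4"])
  then obtain x y where xy: "x \<in> I (Suc n)" "dist (T x) 0 < 1/4" "y \<in> I (Suc n)" "dist (T y) 1 < 1/4"
    by blast
  then have "1/2 \<le> \<bar>T x - T y\<bar>" unfolding dist_real_def by linarith
  also have "\<dots> \<le> C * ?g * \<bar>x - y\<bar>" by (rule T_contract) (use xy in auto)
  also have "\<bar>x - y\<bar> = \<bar>\<sigma> * x - \<sigma> * y\<bar>" using abs_sigma[of "x - y"] by (simp add: algebra_simps)
  also have "\<dots> \<le> e (Suc n) - e n" using xy by (auto simp: I_Suc abs_le_iff)
  finally show "real (Suc n) powr - \<gamma> / (2 * C) \<le> e (Suc n) - e n"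
    using C g by (simp add: powr_minus field_simps mult_left_mono)
qed

end

section \<open>Covers by cylinders\<close>

text \<open>Splitting off the first letter turns the sum over words of length \<open>Suc n\<close>
  into a double sum, which Tonelli separates.\<close>

lemma nn_integral_lists_prod:
  fixes f :: "'a \<Rightarrow> ennreal"
  shows "(\<integral>\<^sup>+w. prod_list (map f w) \<partial>count_space {w. length w = n}) = (\<integral>\<^sup>+a. f a \<partial>count_space UNIV) ^ n"
proof (induction n)
  case 0
  have "{w::'a list. length w = 0} = {[]}" by auto
  then show ?case by (simp add: nn_integral_count_space_finite)
next
  case (Suc n)
  let ?L = "{w::'a list. length w = n}"
  have bij: "bij_betw (\<lambda>(a, w). a # w) (UNIV \<times> ?L) {w. length w = Suc n}"
    by (rule bij_betwI[where g = "\<lambda>w. (hd w, tl w)"]) (auto simp: length_Suc_conv)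
  have "(\<integral>\<^sup>+w. prod_list (map f w) \<partial>count_space {w. length w = Suc n}) =
        (\<integral>\<^sup>+p. (case p of (a, w) \<Rightarrow> f a * prod_list (map f w)) \<partial>count_space (UNIV \<times> ?L))"
    by (subst nn_integral_bij_count_space[OF bij, symmetric]) (auto intro!: nn_integral_cong)
  also have "\<dots> = (\<integral>\<^sup>+p. (case p of (a, w) \<Rightarrow> f a * (prod_list (map f w) * indicator ?L w)) \<partial>count_space UNIV)"
    by (subst nn_integral_count_space_indicator)
       (auto intro!: nn_integral_cong simp: indicator_def split: prod.splits)
  also have "\<dots> = (\<integral>\<^sup>+a. \<integral>\<^sup>+w. f a * (prod_list (map f w) * indicator ?L w) \<partial>count_space UNIV \<partial>count_space UNIV)"
    by (subst nn_integral_fst_count_space[symmetric]) simp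
  also have "\<dots> = (\<integral>\<^sup>+a. f a * (\<integral>\<^sup>+w. prod_list (map f w) \<partial>count_space ?L) \<partial>count_space UNIV)"
    by (subst nn_integral_cmult, simp) (simp add: nn_integral_count_space_indicator)
  also have "\<dots> = (\<integral>\<^sup>+a. f a \<partial>count_space UNIV) ^ Suc n"
    by (subst nn_integral_multc) (simp_all add: Suc)
  finally show ?case .
qed

text \<open>The words of length \<open>n\<close> contribute \<open>c n * Z ^ n\<close> in total: the
  unweighted sum is geometric in the length, and the weight \<open>c\<close> has to beat it.\<close>

lemma nn_integral_lists_weighted:
  fixes f :: "nat \<Rightarrow> real" and c :: "nat \<Rightarrow> real"
  assumes f: "\<And>a. 0 \<le> f a" and sums: "f sums Z" and c: "\<And>n. 0 \<le> c n" and sm: "summable (\<lambda>n. c n * Z ^ n)"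
  shows "(\<integral>\<^sup>+w. ennreal (c (length w) * prod_list (map f w)) \<partial>count_space UNIV) < \<infinity>"
proof -
  have Z: "0 \<le> Z" using sums f by (metis sums_unique suminf_nonneg sums_summable)
  have p: "0 \<le> prod_list (map f w)" for w by (induction w) (use f in auto)
  have pe: "ennreal (prod_list (map f w)) = prod_list (map (\<lambda>a. ennreal (f a)) w)" for w
    by (induction w) (use f p in \<open>auto simp: ennreal_mult\<close>)
  have Ze: "(\<integral>\<^sup>+a. ennreal (f a) \<partial>count_space UNIV) = ennreal Z"
    using suminf_ennreal_eq[OF f sums] by (simp add: nn_integral_count_space_nat)
  have "(\<integral>\<^sup>+w. ennreal (c (length w) * prod_list (map f w)) \<partial>count_space UNIV) =
     (\<integral>\<^sup>+w. (\<Sum>n. ennreal (c n) * (prod_list (map (\<lambda>a. ennreal (f a)) w) * indicator {w. length w = n} w)) \<partial>count_space UNIV)"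
  proof (intro nn_integral_cong)
    fix w :: "nat list"
    have "(\<Sum>n. ennreal (c n) * (prod_list (map (\<lambda>a. ennreal (f a)) w) * indicator {w. length w = n} w))
      = (\<Sum>n\<in>{length w}. ennreal (c n) * (prod_list (map (\<lambda>a. ennreal (f a)) w) * indicator {w. length w = n} w))"
      by (rule suminf_finite) auto
    then show "ennreal (c (length w) * prod_list (map f w)) =
       (\<Sum>n. ennreal (c n) * (prod_list (map (\<lambda>a. ennreal (f a)) w) * indicator {w. length w = n} w))"
      using c p by (simp add: ennreal_mult pe)
  qed
  also have "\<dots> = (\<Sum>n. \<integral>\<^sup>+w. ennreal (c n) * (prod_list (map (\<lambda>a. ennreal (f a)) w) * indicator {w. length w = n} w) \<partial>count_space UNIV)"
    by (rule nn_integral_suminf) simp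
  also have "\<dots> = (\<Sum>n. ennreal (c n) * ennreal Z ^ n)"
    by (simp add: nn_integral_cmult nn_integral_lists_prod Ze nn_integral_count_space_indicator[symmetric])
  also have "\<dots> = (\<Sum>n. ennreal (c n * Z ^ n))"
    using c Z by (simp add: ennreal_mult ennreal_power)
  also have "\<dots> = ennreal (\<Sum>n. c n * Z ^ n)"
    by (rule suminf_ennreal2) (use c Z sm in auto)
  finally show ?thesis by simp
qed

text \<open>Comparison with the integral of \<open>x powr - p\<close>, telescoped through the mean
  value theorem. The first term is bounded by \<open>real k powr (1 - p)\<close> on its own; with
  the factor \<open>1 / (p - 1)\<close> of the others this makes \<open>p / (p - 1)\<close>.\<close>

lemma powr_tail_bound:
  fixes p :: real
  assumes p: "1 < p" and X: "1 \<le> X" "X \<le> real k"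
  shows "(\<Sum>j=k..l. real j powr - p) \<le> p / (p - 1) * X powr (1 - p)"
proof -
  have step: "real (Suc j) powr - p \<le> (real j powr (1 - p) - real (Suc j) powr (1 - p)) / (p - 1)"
    if "1 \<le> j" for j
  proof -
    have "\<exists>z. real j < z \<and> z < real (Suc j) \<and>
        real (Suc j) powr (1 - p) - real j powr (1 - p) = (real (Suc j) - real j) * ((1 - p) * z powr (1 - p - 1))"
      by (rule MVT2) (use that in \<open>auto intro!: derivative_eq_intros\<close>)
    then obtain z where z: "real j < z" "z < real (Suc j)"
      "real (Suc j) powr (1 - p) - real j powr (1 - p) = (1 - p) * z powr - p" by auto
    have "real (Suc j) powr - p \<le> z powr - p"
      using z(1,2) p that by (intro powr_mono2') auto
    also have "\<dots> = (real j powr (1 - p) - real (Suc j) powr (1 - p)) / (p - 1)"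
      using z(3) p by (simp add: field_simps)
    finally show ?thesis .
  qed
  have k: "1 \<le> k" using X by simp
  show ?thesis
  proof (cases "k \<le> l")
    case True
    have "(\<Sum>j=k..l. real j powr - p) \<le> real k powr (1 - p) + (real k powr (1 - p) - real l powr (1 - p)) / (p - 1)"
      using True
    proof (induction l rule: dec_induct)
      case base
      show ?case using k p by (simp add: powr_mono)
    next
      case (step l)
      then show ?case
        using \<open>\<And>j. 1 \<le> j \<Longrightarrow> _\<close>[of l] k by (simp add: diff_divide_distrib)
    qed
    also have "\<dots> \<le> real k powr (1 - p) + real k powr (1 - p) / (p - 1)"
      using p by (simp add: divide_right_mono)
    also have "\<dots> = p / (p - 1) * real k powr (1 - p)" using p by (simp add: field_simps)
    also have "\<dots> \<le> p / (p - 1) * X powr (1 - p)"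
      using p X by (intro mult_left_mono powr_mono2') auto
    finally show ?thesis .
  qed (use p X in auto)
qed

context branch_system
begin

text \<open>The restriction to [0,1] is there for the empty word, whose cylinder has to be
  bounded.\<close>

definition cylinder :: "nat list \<Rightarrow> real set" where
  "cylinder w = {x \<in> {0..1}. \<forall>j<length w. 1 \<le> w ! j \<and> (F ^^ j) x \<in> I (w ! j)}"

lemma prod_list_eq_prod: "prod_list (map f w) = (\<Prod>j<length w. f (w ! j))"
  for f :: "nat \<Rightarrow> real"
  by (simp add: prod.list_conv_set_nth atLeast0LessThan)

lemma cylinder_pos: "x \<in> cylinder w \<Longrightarrow> \<forall>a\<in>set w. 1 \<le> a"
  by (auto simp: cylinder_def in_set_conv_nth)

text \<open>The distance of the images stays as a factor instead of being estimated by 1, because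
  \<open>jump_null\<close> confines these images to a short interval.\<close>

lemma cylinder_dist:
  assumes "x \<in> cylinder w" "y \<in> cylinder w"
  shows "\<bar>x - y\<bar> \<le> prod_list (map (\<lambda>a. C * real a powr - \<gamma>) w) * \<bar>(F ^^ length w) x - (F ^^ length w) y\<bar>"
proof -
  let ?n = "length w"
  have "(\<Prod>j<?n. real (w ! j) powr \<gamma> / C) * \<bar>x - y\<bar> \<le> \<bar>(F ^^ ?n) x - (F ^^ ?n) y\<bar>"
    using F_iter_contract[of ?n "\<lambda>j. w ! j" x y] assms by (auto simp: cylinder_def)
  moreover have inv: "(\<Prod>j<?n. real (w ! j) powr \<gamma> / C) * (\<Prod>j<?n. C * real (w ! j) powr - \<gamma>) = 1"
  proof -
    have "real (w ! j) powr \<gamma> / C * (C * real (w ! j) powr - \<gamma>) = 1" if "j < ?n" for j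
    proof -
      have "real (w ! j) > 0" using cylinder_pos[OF assms(1)] that
        by (metis nth_mem of_nat_0_less_iff zero_less_one less_le_trans)
      then show ?thesis using C by (simp add: powr_minus field_simps)
    qed
    then show ?thesis by (simp add: prod.distrib[symmetric])
  qed
  moreover have "0 \<le> (\<Prod>j<?n. C * real (w ! j) powr - \<gamma>)"
    using C by (intro prod_nonneg) auto
  ultimately have "(\<Prod>j<?n. C * real (w ! j) powr - \<gamma>) * ((\<Prod>j<?n. real (w ! j) powr \<gamma> / C) * \<bar>x - y\<bar>)
      \<le> (\<Prod>j<?n. C * real (w ! j) powr - \<gamma>) * \<bar>(F ^^ ?n) x - (F ^^ ?n) y\<bar>"
    by (intro mult_left_mono)
  moreover have "(\<Prod>j<?n. C * real (w ! j) powr - \<gamma>) * ((\<Prod>j<?n. real (w ! j) powr \<gamma> / C) * \<bar>x - y\<bar>) = \<bar>x - y\<bar>"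
    using inv by algebra
  ultimately show ?thesis by (simp only: prod_list_eq_prod)
qed

lemma itinerary_cylinder:
  "itinerary I T x a \<Longrightarrow> x \<in> cylinder (map a [0..<n])"
  using itinerary_unit[of x a] by (auto simp: cylinder_def itinerary_def)

lemma bounded_cylinder_subset: "U \<subseteq> cylinder w \<Longrightarrow> bounded U"
  by (rule bounded_subset[of "{0..1}"]) (auto simp: cylinder_def)

lemma gauge_cylinder_subset:
  assumes s: "s > 0" and U: "U \<subseteq> cylinder w"
    and D: "\<And>x y. x \<in> U \<Longrightarrow> y \<in> U \<Longrightarrow> \<bar>(F ^^ length w) x - (F ^^ length w) y\<bar> \<le> D"
  shows "hausdorff_gauge s U \<le> ennreal (D powr s * prod_list (map (\<lambda>a. C powr s * real a powr (- \<gamma> * s)) w))"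
proof (cases "U = {}")
  case False
  let ?p = "prod_list (map (\<lambda>a. C * real a powr - \<gamma>) w)"
  have D0: "0 \<le> D" using False D by force
  have p: "0 \<le> ?p" using C by (induction w) auto
  have "diameter U \<le> ?p * D"
  proof (rule diameter_le)
    show "norm (x - y) \<le> ?p * D" if "x \<in> U" "y \<in> U" for x y
      using cylinder_dist[of x w y] mult_left_mono[OF D[OF that] p] subsetD[OF U that(1)] subsetD[OF U that(2)]
      unfolding real_norm_def by linarith
  qed (use False in simp)
  then have "diameter U powr s \<le> (?p * D) powr s"
    using s bounded_cylinder_subset[OF U] by (intro powr_mono2) (auto simp: diameter_ge_0)
  also have "\<dots> = D powr s * ?p powr s" using p D0 by (simp add: powr_mult)
  also have "?p powr s = prod_list (map (\<lambda>a. C powr s * real a powr (- \<gamma> * s)) w)"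
  proof (induction w)
    case (Cons a w)
    have "0 \<le> prod_list (map (\<lambda>a. C * real a powr - \<gamma>) w)" using C by (induction w) auto
    with Cons show ?case using C by (simp add: powr_mult powr_powr)
  qed simp
  finally show ?thesis using False s by (simp add: hausdorff_gauge_def ennreal_leI)
qed (simp add: hausdorff_gauge_def)

lemma ln_prod_list: "\<forall>a\<in>set w. 1 \<le> a \<Longrightarrow> prod_list (map (\<lambda>a. real a powr p) w) = exp (p * (\<Sum>a\<leftarrow>w. ln (real a)))"
  by (induction w) (auto simp: powr_def exp_add[symmetric] algebra_simps)

lemma sum_list_itinerary: "(\<Sum>b\<leftarrow>map a [0..<n]. ln (real b)) = (\<Sum>j<n. ln (real (a j)))"
  by (simp add: interv_sum_list_conv_sum_set_nat atLeast0LessThan comp_def)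

text \<open>Weakening the exponent of the digits by \<open>\<eta>\<close> gains a factor \<open>exp (- \<eta> K n)\<close> on words of
  length \<open>n\<close>, which beats the exponentially growing sum over all words.\<close>

lemma fast_growth_null:
  assumes s: "1 < \<gamma> * s"
  shows "\<exists>K>0. hausdorff_measure s
    {x. \<exists>a. itinerary I T x a \<and> (\<exists>\<^sub>F n in sequentially. K * real n \<le> (\<Sum>j<n. ln (real (a j))))} = 0"
proof -
  have s0: "s > 0" using s gamma by (metis less_trans mult_less_cancel_left_pos mult_zero_right not_less zero_less_mult_pos zero_less_one)
  \<comment> \<open>Half of the excess of \<open>\<gamma> * s\<close> over 1: the series over the
    digits with exponent \<open>\<gamma> * s - \<eta>\<close> still converges.\<close>
  define \<eta> where "\<eta> = (\<gamma> * s - 1) / 2"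
  have \<eta>: "\<eta> > 0" "\<gamma> * s - \<eta> > 1" using s unfolding \<eta>_def by (simp_all add: field_simps)
  define g where "g a = real a powr (\<eta> - \<gamma> * s)" for a :: nat
  have g: "summable g" unfolding g_def using \<eta> by (simp add: summable_real_powr_iff)
  define Z where "Z = C powr s * suminf g"
  \<comment> \<open>Makes \<open>exp (\<eta> * K)\<close> at least \<open>2 * Z + 2\<close>, so that
    \<open>c n * Z ^ n\<close> is at most \<open>(1/2) ^ n\<close>.\<close>
  define K where "K = max 1 (ln (2 * Z + 2) / \<eta>)"
  define f where "f a = C powr s * g a" for a
  have f: "f sums Z" unfolding f_def Z_def using g by (intro sums_mult summable_sums)
  have f0: "0 \<le> f a" for a using C by (simp add: f_def g_def)
  have Z0: "0 \<le> Z" using f f0 by (metis sums_unique suminf_nonneg sums_summable)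
  define c where "c n = exp (- \<eta> * K * real n)" for n :: nat
  define U where "U w = (if K * real (length w) \<le> (\<Sum>a\<leftarrow>w. ln (real a)) then cylinder w else {})" for w
  have "exp (\<eta> * K) \<ge> exp (ln (2 * Z + 2))"
    using \<eta> unfolding exp_le_cancel_iff K_def by (simp add: max_def field_simps)
  then have eK: "exp (\<eta> * K) \<ge> 2 * Z + 2" using Z0 by simp
  have sm: "summable (\<lambda>n. c n * Z ^ n)"
  proof (rule summable_comparison_test')
    show "summable (\<lambda>n. (1/2::real) ^ n)" by (rule summable_geometric) simp
    fix n :: nat
    have "c n * Z ^ n = (Z / exp (\<eta> * K)) ^ n"
    proof -
      have "c n = inverse (exp (\<eta> * K) ^ n)"
        unfolding c_def by (simp add: exp_of_nat_mult[symmetric] exp_minus mult_ac)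
      then show ?thesis by (simp add: power_mult_distrib power_inverse divide_inverse mult.commute)
    qed
    also have "\<dots> \<le> (1/2) ^ n"
      using Z0 eK by (intro power_mono) (auto simp: divide_le_eq)
    finally show "norm (c n * Z ^ n) \<le> (1/2) ^ n" using Z0 by (simp add: c_def)
  qed
  have gauge: "hausdorff_gauge s (U w) \<le> ennreal (c (length w) * prod_list (map f w))" for w
  proof (cases "U w = {}")
    case False
    then have w: "U w = cylinder w" "K * real (length w) \<le> (\<Sum>a\<leftarrow>w. ln (real a))"
      by (auto simp: U_def split: if_splits)
    then have pos: "\<forall>a\<in>set w. 1 \<le> a" using False cylinder_pos by auto
    have "hausdorff_gauge s (U w) \<le> ennreal (1 powr s * prod_list (map (\<lambda>a. C powr s * real a powr (- \<gamma> * s)) w))"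
    proof (rule gauge_cylinder_subset[OF s0])
      fix x y assume "x \<in> U w" "y \<in> U w"
      then have "(F ^^ length w) x \<in> {0..1}" "(F ^^ length w) y \<in> {0..1}"
        unfolding w by (auto simp: cylinder_def F_iter_unit simp del: atLeastAtMost_iff)
      then show "\<bar>(F ^^ length w) x - (F ^^ length w) y\<bar> \<le> 1" by (auto simp: abs_le_iff)
    qed (simp add: w)
    also have "prod_list (map (\<lambda>a. C powr s * real a powr (- \<gamma> * s)) w)
        = prod_list (map f w) * prod_list (map (\<lambda>a. real a powr - \<eta>) w)"
      by (induction w) (auto simp: f_def g_def powr_add[symmetric] algebra_simps)
    also have "prod_list (map (\<lambda>a. real a powr - \<eta>) w) = exp (- \<eta> * (\<Sum>a\<leftarrow>w. ln (real a)))"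
      by (rule ln_prod_list[OF pos])
    also have "ennreal (1 powr s * (prod_list (map f w) * exp (- \<eta> * (\<Sum>a\<leftarrow>w. ln (real a)))))
       \<le> ennreal (c (length w) * prod_list (map f w))"
    proof (rule ennreal_leI)
      have "0 \<le> prod_list (map f w)" by (induction w) (use f0 in auto)
      moreover have "exp (- \<eta> * (\<Sum>a\<leftarrow>w. ln (real a))) \<le> c (length w)"
        using w(2) \<eta> by (simp add: c_def mult.assoc)
      ultimately show "1 powr s * (prod_list (map f w) * exp (- \<eta> * (\<Sum>a\<leftarrow>w. ln (real a)))) \<le> c (length w) * prod_list (map f w)"
        using mult_left_mono[of "exp (- \<eta> * (\<Sum>a\<leftarrow>w. ln (real a)))" "c (length w)" "prod_list (map f w)"]
        by (simp add: mult.commute)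
    qed
    finally show ?thesis .
  qed (simp add: hausdorff_gauge_def)
  have "hausdorff_measure s
    {x. \<exists>a. itinerary I T x a \<and> (\<exists>\<^sub>F n in sequentially. K * real n \<le> (\<Sum>j<n. ln (real (a j))))} = 0"
  proof (rule hausdorff_measure_limsup_zero[where U = U])
    show "bounded (U w)" for w by (rule bounded_cylinder_subset[of _ w]) (simp add: U_def)
    have "(\<integral>\<^sup>+w. hausdorff_gauge s (U w) \<partial>count_space UNIV)
        \<le> (\<integral>\<^sup>+w. ennreal (c (length w) * prod_list (map f w)) \<partial>count_space UNIV)"
      by (intro nn_integral_mono gauge)
    also have "\<dots> < \<infinity>"
      by (rule nn_integral_lists_weighted[OF f0 f _ sm]) (simp add: c_def)
    finally show "(\<integral>\<^sup>+w. hausdorff_gauge s (U w) \<partial>count_space UNIV) < \<infinity>" .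
    fix x assume "x \<in> {x. \<exists>a. itinerary I T x a \<and> (\<exists>\<^sub>F n in sequentially. K * real n \<le> (\<Sum>j<n. ln (real (a j))))}"
    then obtain a where a: "itinerary I T x a" "infinite {n. K * real n \<le> (\<Sum>j<n. ln (real (a j)))}"
      by (auto simp: frequently_cofinite[symmetric] cofinite_eq_sequentially)
    have "(\<lambda>n. map a [0..<n]) ` {n. K * real n \<le> (\<Sum>j<n. ln (real (a j)))} \<subseteq> {w. x \<in> U w}"
      using itinerary_cylinder[OF a(1)] sum_list_itinerary[of a] by (auto simp: U_def comp_def)
    \<comment> \<open>Prefixes of different lengths are different words, so infinitely many times
      yield infinitely many words.\<close>
    moreover have "inj (\<lambda>n. map a [0..<n])"
      by (rule injI) (metis length_map length_upt diff_zero)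
    ultimately show "infinite {w. x \<in> U w}"
      using a(2) by (meson finite_imageD finite_subset inj_on_subset subset_UNIV)
  qed (rule s0)
  moreover have "K > 0" by (simp add: K_def)
  ultimately show ?thesis by blast
qed

text \<open>The intervals with index at least \<open>X\<close> lie in a stretch whose length is a
  tail of the series of \<open>C * real j powr - \<gamma>\<close>, hence of order
  \<open>X powr (1 - \<gamma>)\<close>. This is the source of \<open>\<gamma> - 1\<close> in the
  dimension formula.\<close>

lemma tail_dist:
  assumes "x \<in> I m" "y \<in> I n" "1 \<le> X" "X \<le> real m" "X \<le> real n"
  shows "\<bar>x - y\<bar> \<le> C * (\<gamma> / (\<gamma> - 1)) * X powr (1 - \<gamma>)"
proof -
  have *: "\<bar>x - y\<bar> \<le> C * (\<gamma> / (\<gamma> - 1)) * X powr (1 - \<gamma>)"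
    if h: "x \<in> I m" "y \<in> I n" "X \<le> real m" "m \<le> n" for x y m n
  proof -
    obtain k where k: "m = Suc k" using h assms(3) by (cases m) auto
    obtain l where l: "n = Suc l" using h assms(3) by (cases n) auto
    have "\<bar>x - y\<bar> = \<bar>\<sigma> * x - \<sigma> * y\<bar>" using abs_sigma[of "x - y"] by (simp add: algebra_simps)
    also have "\<dots> \<le> e (Suc l) - e k"
      using that e_le[of k l] e_le[of "Suc k" "Suc l"] by (auto simp: k l I_Suc abs_le_iff)
    also have "\<dots> = (\<Sum>j=k..<Suc l. e (Suc j) - e j)"
      using that by (simp add: sum_Suc_diff' k l)
    also have "\<dots> \<le> (\<Sum>j=k..<Suc l. C * real (Suc j) powr - \<gamma>)"
      by (intro sum_mono I_length)
    also have "\<dots> = C * (\<Sum>j=k..<Suc l. real (Suc j) powr - \<gamma>)"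
      by (rule sum_distrib_left[symmetric])
    also have "(\<Sum>j=k..<Suc l. real (Suc j) powr - \<gamma>) = (\<Sum>j=m..n. real j powr - \<gamma>)"
      unfolding k l atLeastLessThanSuc_atLeastAtMost by (rule sum.shift_bounds_cl_Suc_ivl[symmetric])
    also have "C * \<dots> \<le> C * (\<gamma> / (\<gamma> - 1) * X powr (1 - \<gamma>))"
      using C that by (intro mult_left_mono powr_tail_bound gamma assms(3)) auto
    finally show ?thesis by (simp add: mult.assoc)
  qed
  show ?thesis
    using *[of x m y n] *[of y n x m] assms by (cases "m \<le> n") (auto simp: abs_minus_commute)
qed

end

text \<open>The first time at which \<open>R\<close> exceeds a bound for all its values up to
  \<open>N\<close> is a record, and the value just before it is not larger.\<close>

lemma frequently_record:
  fixes R :: "nat \<Rightarrow> real"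
  assumes "\<And>K. \<exists>n. K < R n"
  shows "\<exists>\<^sub>F n in sequentially. R n \<le> R (Suc n) \<and> 1 \<le> R (Suc n)"
proof (rule frequently_sequentially[THEN iffD2], rule allI)
  fix N
  \<comment> \<open>The values up to \<open>N\<close> push the record beyond \<open>N\<close>; the 1
    yields the second conjunct.\<close>
  define K where "K = Max (insert 1 (R ` {..N}))"
  have K: "1 \<le> K" "\<And>j. j \<le> N \<Longrightarrow> R j \<le> K"
    unfolding K_def by (rule Max_ge; simp)+
  define m where "m = (LEAST m. K < R m)"
  have m: "K < R m" unfolding m_def using assms by (rule LeastI_ex)
  have less: "R j \<le> K" if "j < m" for j
    using not_less_Least[of j] that unfolding m_def by force
  have "N < m" using m K(2)[of m] by (meson not_le)
  then obtain n where n: "m = Suc n" "N \<le> n" by (cases m) auto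
  then show "\<exists>n\<ge>N. R n \<le> R (Suc n) \<and> 1 \<le> R (Suc n)"
    using m less[of n] K(1) by (intro exI[of _ n]) auto
qed

text \<open>A double exponential beats every geometric sequence, because \<open>\<beta> ^ n\<close>
  eventually exceeds every multiple of \<open>n\<close>.\<close>

lemma summable_exp_neg_exponential:
  fixes \<kappa> \<beta> Z :: real
  assumes "0 < \<kappa>" "1 < \<beta>" "0 \<le> Z"
  shows "summable (\<lambda>n. exp (- \<kappa> * \<beta> ^ n) * Z ^ n)"
proof (rule summable_comparison_test_ev)
  show "summable (\<lambda>n. (1/2::real) ^ n)" by (rule summable_geometric) simp
  \<comment> \<open>In logarithms, \<open>L * real n \<le> \<beta> ^ n\<close> is
    \<open>(2 * Z + 1) ^ n \<le> exp (\<kappa> * \<beta> ^ n)\<close>; the added 1 keeps the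
    logarithm meaningful for \<open>Z = 0\<close>.\<close>
  define L where "L = ln (2 * Z + 1) / \<kappa>"
  have "((\<lambda>n. real n / \<beta> ^ n) \<longlongrightarrow> 0) sequentially"
    using lim_n_over_pown[of \<beta>] assms by simp
  then have "((\<lambda>n. L * (real n / \<beta> ^ n)) \<longlongrightarrow> L * 0) sequentially"
    by (intro tendsto_mult tendsto_const)
  then have "eventually (\<lambda>n. L * (real n / \<beta> ^ n) < 1) sequentially"
    by (rule order_tendstoD) simp
  then show "\<forall>\<^sub>F n in sequentially. norm (exp (- \<kappa> * \<beta> ^ n) * Z ^ n) \<le> (1/2) ^ n"
  proof eventually_elim
    case (elim n)
    have "L * real n \<le> \<beta> ^ n" using elim assms by (simp add: field_simps)
    then have "ln (2 * Z + 1) * real n \<le> \<kappa> * \<beta> ^ n"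
      using assms unfolding L_def by (simp add: field_simps)
    then have "exp (real n * ln (2 * Z + 1)) \<le> exp (\<kappa> * \<beta> ^ n)"
      by (simp add: mult.commute)
    then have le: "(2 * Z + 1) ^ n \<le> exp (\<kappa> * \<beta> ^ n)"
      using assms by (simp add: exp_of_nat_mult)
    have "(2 * Z) ^ n \<le> (2 * Z + 1) ^ n" using assms by (intro power_mono) auto
    with le have "(2 * Z) ^ n \<le> exp (\<kappa> * \<beta> ^ n)" by linarith
    then show ?case using assms by (simp add: exp_minus power_mult_distrib field_simps)
  qed
qed

section \<open>Digit sums of exponential growth\<close>

context branch_system
begin

text \<open>All continuations of a word by a digit that is large relative to it lie in one short
  interval; this is cheaper than covering them one by one.\<close>

lemma jump_null:
  assumes s: "s > 0" and \<beta>: "1 < \<beta>" and s\<beta>: "1 < s * ((\<gamma> - 1) * \<beta> + 1)"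
  shows "hausdorff_measure s {x. \<exists>a. itinerary I T x a \<and> (\<exists>\<^sub>F n in sequentially.
      (\<beta> - 1) * (\<Sum>j<n. ln (real (a j))) \<le> ln (real (a n)) \<and> (\<beta> - 1) * \<beta> ^ n \<le> ln (real (a n)))} = 0"
    (is "hausdorff_measure s ?A = 0")
proof -
  \<comment> \<open>The gain from a jump: after a word with digit sum \<open>S\<close> the tail
    estimate contributes a factor of order \<open>exp (- q S)\<close>, and
    \<open>\<gamma> + q = (\<gamma> - 1) * \<beta> + 1\<close>.\<close>
  define q where "q = (\<gamma> - 1) * (\<beta> - 1)"
  have q: "q > 0" "s * (\<gamma> + q) > 1"
  proof -
    show "q > 0" using gamma \<beta> unfolding q_def by simp
    show "s * (\<gamma> + q) > 1" using s\<beta> unfolding q_def by (simp add: algebra_simps)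
  qed
  \<comment> \<open>Giving up the fraction \<open>\<eta>\<close> of the gain leaves
    \<open>\<tau> \<ge> (s * (\<gamma> + q) + 1) / 2 > 1\<close>; what is given up is traded for the
    weight \<open>c\<close>.\<close>
  define \<eta> where "\<eta> = (s * (\<gamma> + q) - 1) / (2 * (s * (\<gamma> + q)))"
  have \<eta>: "0 < \<eta>" "\<eta> < 1" using q unfolding \<eta>_def by (auto simp: field_simps)
  define \<tau> where "\<tau> = s * (\<gamma> + q * (1 - \<eta>))"
  have "\<tau> = s * (\<gamma> + q) - s * q * \<eta>" by (simp add: \<tau>_def algebra_simps)
  moreover have "s * q * \<eta> \<le> s * (\<gamma> + q) * \<eta>" using s \<eta> gamma by (intro mult_right_mono mult_left_mono) auto
  moreover have "s * (\<gamma> + q) * \<eta> = (s * (\<gamma> + q) - 1) / 2" 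
  proof -
    have "s * (\<gamma> + q) \<noteq> 0" using q(2) by linarith
    then show ?thesis unfolding \<eta>_def by (simp add: field_simps del: mult_eq_0_iff)
  qed
  ultimately have \<tau>: "\<tau> > 1" using q(2) by (simp add: field_simps)
  define g where "g a = real a powr (- \<tau>)" for a :: nat
  have g: "summable g" unfolding g_def using \<tau> by (simp add: summable_real_powr_iff)
  define Z where "Z = C powr s * suminf g"
  define f where "f a = C powr s * g a" for a
  have f: "f sums Z" unfolding f_def Z_def using g by (intro sums_mult summable_sums)
  have f0: "0 \<le> f a" for a using C by (simp add: f_def g_def)
  have Z0: "0 \<le> Z" using f f0 by (metis sums_unique suminf_nonneg sums_summable)
  define C' where "C' = C * (\<gamma> / (\<gamma> - 1))"
  have C': "C' > 0" using C gamma by (simp add: C'_def)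
  define c where "c n = C' powr s * exp (- (s * q * \<eta>) * \<beta> ^ n)" for n :: nat
  define \<Sigma> where "\<Sigma> w = (\<Sum>a\<leftarrow>w. ln (real a))" for w
  \<comment> \<open>A convex combination of the two lower bounds for the logarithm of the next
    digit. The part with \<open>\<Sigma> w\<close> improves the exponent of every digit of the word;
    the part with \<open>\<beta> ^ length w\<close> produces the doubly exponential weight that
    beats \<open>Z ^ n\<close>.\<close>
  define L where "L w = (\<beta> - 1) * ((1 - \<eta>) * \<Sigma> w + \<eta> * \<beta> ^ length w)" for w :: "nat list"
  define U where "U w = {x \<in> cylinder w. \<exists>d\<ge>1. (F ^^ length w) x \<in> I d \<and> L w \<le> ln (real d)}" for w
  have sm: "summable (\<lambda>n. c n * Z ^ n)"
    unfolding c_def mult.assoc[of "C' powr s"]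
    by (intro summable_mult summable_exp_neg_exponential) (use s q \<eta> \<beta> Z0 in auto)
  have gauge: "hausdorff_gauge s (U w) \<le> ennreal (c (length w) * prod_list (map f w))" for w
  proof (cases "U w = {}")
    case False
    then have "cylinder w \<noteq> {}" by (auto simp: U_def)
    then have pos: "\<forall>a\<in>set w. 1 \<le> a" using cylinder_pos by auto
    have "0 \<le> \<Sigma> w" unfolding \<Sigma>_def by (rule sum_list_nonneg) (use pos in auto)
    then have L0: "0 \<le> L w" using \<beta> \<eta> by (simp add: L_def)
    have "hausdorff_gauge s (U w) \<le> ennreal ((C' * exp (L w) powr (1 - \<gamma>)) powr s
        * prod_list (map (\<lambda>a. C powr s * real a powr (- \<gamma> * s)) w))"
    proof (rule gauge_cylinder_subset[OF s])
      fix x y assume "x \<in> U w" "y \<in> U w"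
      then obtain d d' where d: "1 \<le> d" "(F ^^ length w) x \<in> I d" "L w \<le> ln (real d)"
        "1 \<le> d'" "(F ^^ length w) y \<in> I d'" "L w \<le> ln (real d')" by (auto simp: U_def)
      then have "exp (L w) \<le> real d" "exp (L w) \<le> real d'"
        by (simp_all add: ln_ge_iff)
      then show "\<bar>(F ^^ length w) x - (F ^^ length w) y\<bar> \<le> C' * exp (L w) powr (1 - \<gamma>)"
        unfolding C'_def using L0 by (intro tail_dist[OF d(2,5)]) auto
    qed (auto simp: U_def)
    also have "(C' * exp (L w) powr (1 - \<gamma>)) powr s = C' powr s * exp (L w * (1 - \<gamma>) * s)"
      using C' by (simp add: powr_mult exp_powr_real)
    also have "L w * (1 - \<gamma>) * s = - (s * q * \<eta>) * \<beta> ^ length w + - (s * q * (1 - \<eta>)) * \<Sigma> w"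
      unfolding L_def q_def by (simp add: algebra_simps)
    also have "C' powr s * exp \<dots> = c (length w) * exp (- (s * q * (1 - \<eta>)) * \<Sigma> w)"
      by (simp add: c_def mult_exp_exp)
    also have "exp (- (s * q * (1 - \<eta>)) * \<Sigma> w) = prod_list (map (\<lambda>a. real a powr (- (s * q * (1 - \<eta>)))) w)"
      unfolding \<Sigma>_def by (rule ln_prod_list[OF pos, symmetric])
    also have "c (length w) * \<dots> * prod_list (map (\<lambda>a. C powr s * real a powr (- \<gamma> * s)) w) =
       c (length w) * prod_list (map f w)"
    proof -
      have "prod_list (map (\<lambda>a. real a powr (- (s * q * (1 - \<eta>)))) w) * prod_list (map (\<lambda>a. C powr s * real a powr (- \<gamma> * s)) w)
        = prod_list (map f w)"
      proof (induction w)
        case (Cons a w)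
        have "real a powr (- (s * q * (1 - \<eta>))) * (C powr s * real a powr (- \<gamma> * s)) = f a"
          by (simp add: f_def g_def \<tau>_def powr_add[symmetric] algebra_simps)
        with Cons show ?case by (simp add: mult_ac)
      qed simp
      then show ?thesis by simp
    qed
    finally show ?thesis .
  qed (simp add: hausdorff_gauge_def)
  show ?thesis
  proof (rule hausdorff_measure_limsup_zero[where U = U])
    show "bounded (U w)" for w by (rule bounded_cylinder_subset[of _ w]) (auto simp: U_def)
    have "(\<integral>\<^sup>+w. hausdorff_gauge s (U w) \<partial>count_space UNIV)
        \<le> (\<integral>\<^sup>+w. ennreal (c (length w) * prod_list (map f w)) \<partial>count_space UNIV)"
      by (intro nn_integral_mono gauge)
    also have "\<dots> < \<infinity>"
      by (rule nn_integral_lists_weighted[OF f0 f _ sm]) (simp add: c_def)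
    finally show "(\<integral>\<^sup>+w. hausdorff_gauge s (U w) \<partial>count_space UNIV) < \<infinity>" .
    fix x assume "x \<in> ?A"
    then obtain a where a: "itinerary I T x a"
      and inf: "infinite {n. (\<beta> - 1) * (\<Sum>j<n. ln (real (a j))) \<le> ln (real (a n)) \<and> (\<beta> - 1) * \<beta> ^ n \<le> ln (real (a n))}"
      by (auto simp: frequently_cofinite[symmetric] cofinite_eq_sequentially)
    let ?N = "{n. (\<beta> - 1) * (\<Sum>j<n. ln (real (a j))) \<le> ln (real (a n)) \<and> (\<beta> - 1) * \<beta> ^ n \<le> ln (real (a n))}"
    have "x \<in> U (map a [0..<n])" if "n \<in> ?N" for n
    proof -
      have "L (map a [0..<n]) = (1 - \<eta>) * ((\<beta> - 1) * (\<Sum>j<n. ln (real (a j)))) + \<eta> * ((\<beta> - 1) * \<beta> ^ n)"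
        using sum_list_itinerary[of a n] by (simp add: L_def \<Sigma>_def algebra_simps)
      also have "\<dots> \<le> (1 - \<eta>) * ln (real (a n)) + \<eta> * ln (real (a n))"
        using that \<eta> by (intro add_mono mult_left_mono) auto
      finally have "L (map a [0..<n]) \<le> ln (real (a n))" by (simp add: algebra_simps)
      then show ?thesis
        using itinerary_cylinder[OF a, of n] a by (auto simp: U_def itinerary_def)
    qed
    then have "(\<lambda>n. map a [0..<n]) ` ?N \<subseteq> {w. x \<in> U w}" by blast
    moreover have "inj (\<lambda>n. map a [0..<n])"
      by (rule injI) (metis length_map length_upt diff_zero)
    ultimately show "infinite {w. x \<in> U w}"
      using inf by (meson finite_imageD finite_subset inj_on_subset subset_UNIV)
  qed (rule s)
qed

text \<open>The gap between \<open>\<beta>\<close> and \<open>\<beta>'\<close> makes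
  \<open>S n / \<beta> ^ n\<close> unbounded. A record of it is a jump in the sense of
  \<open>jump_null\<close>, since \<open>S\<close> then grows by at least the factor
  \<open>\<beta>\<close> in one step.\<close>

lemma exponential_growth_null:
  assumes s: "s > 0" and \<beta>: "1 < \<beta>" "\<beta> < \<beta>'" and s\<beta>: "1 < s * ((\<gamma> - 1) * \<beta> + 1)"
  shows "hausdorff_measure s {x. \<exists>a. itinerary I T x a \<and>
      (\<exists>\<^sub>F n in sequentially. \<beta>' ^ n \<le> (\<Sum>j<n. ln (real (a j))))} = 0"
proof (rule hausdorff_measure_zero_subset[OF _ jump_null[OF s \<beta>(1) s\<beta>]], clarify)
  fix x a assume a: "itinerary I T x a"
    and fr: "\<exists>\<^sub>F n in sequentially. \<beta>' ^ n \<le> (\<Sum>j<n. ln (real (a j)))"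
  define S where "S n = (\<Sum>j<n. ln (real (a j)))" for n
  have "\<exists>n. K < S n / \<beta> ^ n" for K
  proof -
    have q: "1 < \<beta>' / \<beta>" using \<beta> by simp
    then obtain m where "K < (\<beta>' / \<beta>) ^ m" using real_arch_pow by blast
    then have "eventually (\<lambda>n. K < (\<beta>' / \<beta>) ^ n) sequentially"
      using q by (intro eventually_sequentiallyI[of m]) (meson less_imp_le less_le_trans power_increasing)
    with fr have "\<exists>\<^sub>F n in sequentially. \<beta>' ^ n \<le> S n \<and> K < (\<beta>' / \<beta>) ^ n"
      unfolding S_def by (rule frequently_eventually_frequently)
    then obtain n where "\<beta>' ^ n \<le> S n" "K < (\<beta>' / \<beta>) ^ n"
      by (auto dest: frequently_ex)
    moreover from this(1) have "(\<beta>' / \<beta>) ^ n \<le> S n / \<beta> ^ n"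
      using \<beta> by (simp add: power_divide divide_right_mono)
    ultimately show ?thesis by (intro exI[of _ n]) linarith
  qed
  then have "\<exists>\<^sub>F n in sequentially. S n / \<beta> ^ n \<le> S (Suc n) / \<beta> ^ Suc n \<and> 1 \<le> S (Suc n) / \<beta> ^ Suc n"
    by (rule frequently_record)
  then have "\<exists>\<^sub>F n in sequentially. (\<beta> - 1) * S n \<le> ln (real (a n)) \<and> (\<beta> - 1) * \<beta> ^ n \<le> ln (real (a n))"
  proof (rule frequently_mono[rotated], intro allI impI)
    fix n assume n: "S n / \<beta> ^ n \<le> S (Suc n) / \<beta> ^ Suc n \<and> 1 \<le> S (Suc n) / \<beta> ^ Suc n"
    have le: "\<beta> * S n \<le> S (Suc n)" "\<beta> * \<beta> ^ n \<le> S (Suc n)"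
      using n \<beta> by (auto simp: field_simps)
    have eq: "S (Suc n) = S n + ln (real (a n))" by (simp add: S_def)
    have "(\<beta> - 1) * S n \<le> ln (real (a n))" using le(1) eq by (simp add: algebra_simps)
    moreover have "(\<beta> - 1) * \<beta> ^ n \<le> ln (real (a n))"
    \<comment> \<open>The record value is at least 1, that is,
      \<open>S (Suc n) \<ge> \<beta> ^ Suc n\<close>. Subtracting \<open>S n\<close> suffices if
      \<open>S n\<close> is at most \<open>\<beta> ^ n\<close>; otherwise the bound in terms of
      \<open>S n\<close> is the stronger one.\<close>
    proof (cases "S n \<le> \<beta> ^ n")
      case True
      then show ?thesis using le(2) eq by (simp add: algebra_simps)
    next
      case False
      then have "(\<beta> - 1) * \<beta> ^ n \<le> (\<beta> - 1) * S n" using \<beta> by simp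
      also note \<open>(\<beta> - 1) * S n \<le> ln (real (a n))\<close>
      finally show ?thesis .
    qed
    ultimately show "(\<beta> - 1) * S n \<le> ln (real (a n)) \<and> (\<beta> - 1) * \<beta> ^ n \<le> ln (real (a n))" by blast
  qed
  with a show "\<exists>a. itinerary I T x a \<and> (\<exists>\<^sub>F n in sequentially.
      (\<beta> - 1) * (\<Sum>j<n. ln (real (a j))) \<le> ln (real (a n)) \<and> (\<beta> - 1) * \<beta> ^ n \<le> ln (real (a n)))"
    unfolding S_def by blast
qed

text \<open>Superlinear growth alone gives \<open>1 / \<gamma>\<close>, and for
  \<open>b = 1\<close>, where no \<open>\<beta>\<close> lies between 1 and \<open>b\<close>, that is
  the whole bound. For larger \<open>b\<close> and \<open>s \<le> 1 / \<gamma>\<close> exponential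
  growth takes over.\<close>

lemma hausdorff_dim_upper_bound:
  assumes A: "\<And>x. x \<in> A \<Longrightarrow> x \<notin> border \<Longrightarrow> \<exists>a. itinerary I T x a \<and>
      (\<forall>K. \<exists>\<^sub>F n in sequentially. K * real n \<le> (\<Sum>j<n. ln (real (a j)))) \<and>
      (\<forall>\<beta>. 1 < \<beta> \<longrightarrow> ereal \<beta> < b \<longrightarrow> (\<exists>\<^sub>F n in sequentially. \<beta> ^ n \<le> (\<Sum>j<n. ln (real (a j)))))"
    and b: "1 \<le> b"
  shows "hausdorff_dim A \<le> 1 / (ereal (\<gamma> - 1) * b + 1)"
proof (rule hausdorff_dim_le)
  have "0 \<le> ereal (\<gamma> - 1) * b"
    using gamma b order_trans[OF _ b, of 0] by (intro ereal_0_le_mult) auto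
  then show "0 \<le> 1 / (ereal (\<gamma> - 1) * b + 1)"
    by (cases "ereal (\<gamma> - 1) * b") auto
next
  fix s :: real assume s: "s > 0" "1 / (ereal (\<gamma> - 1) * b + 1) < ereal s"
  have "hausdorff_measure s (A - border) = 0"
  proof (cases "1 < \<gamma> * s")
    case True
    from fast_growth_null[OF this] show ?thesis
      using A by (elim exE conjE) (erule hausdorff_measure_zero_subset[rotated], blast)
  next
    case False
    \<comment> \<open>Solves \<open>s * ((\<gamma> - 1) * \<beta>0 + 1) = 1\<close>. The assumption
      on \<open>s\<close> amounts to \<open>\<beta>0 < b\<close>, and failure of the first case to
      \<open>1 \<le> \<beta>0\<close>.\<close>
    define \<beta>0 where "\<beta>0 = (1 / s - 1) / (\<gamma> - 1)"
    have "1 \<le> \<beta>0"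
      using False s gamma by (simp add: \<beta>0_def field_simps)
    have "ereal \<beta>0 < b"
    proof (cases b)
      case (real r)
      then have "1 \<le> r" using b by simp
      then have "0 < (\<gamma> - 1) * r + 1" using gamma by (simp add: add_nonneg_pos)
      then have "1 / ((\<gamma> - 1) * r + 1) < s" using s(2) by (simp add: real one_ereal_def)
      then have "1 / s < (\<gamma> - 1) * r + 1" using \<open>0 < (\<gamma> - 1) * r + 1\<close> s(1) by (simp add: field_simps)
      then show ?thesis using gamma by (simp add: real \<beta>0_def field_simps)
    qed (use b in auto)
    then obtain \<beta>' where \<beta>': "\<beta>0 < \<beta>'" "ereal \<beta>' < b" using ereal_dense2[of "ereal \<beta>0" b] by auto
    obtain \<beta> where \<beta>: "\<beta>0 < \<beta>" "\<beta> < \<beta>'" using dense \<beta>'(1) by blast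
    have "1 / s < (\<gamma> - 1) * \<beta> + 1" using \<beta>(1) gamma by (simp add: \<beta>0_def field_simps)
    then have "1 < s * ((\<gamma> - 1) * \<beta> + 1)" using s(1) by (simp add: field_simps)
    with exponential_growth_null[OF s(1) _ \<beta>(2) this] \<beta>(1) \<open>1 \<le> \<beta>0\<close>
    have "hausdorff_measure s {x. \<exists>a. itinerary I T x a \<and>
      (\<exists>\<^sub>F n in sequentially. \<beta>' ^ n \<le> (\<Sum>j<n. ln (real (a j))))} = 0" by simp
    then show ?thesis
      by (rule hausdorff_measure_zero_subset[rotated])
         (use A \<beta>' \<open>1 \<le> \<beta>0\<close> in \<open>force\<close>)
  qed
  moreover have "hausdorff_measure s border = 0"
    by (rule hausdorff_measure_countable[OF countable_border s(1)])
  ultimately have "hausdorff_measure s ((A - border) \<union> border) = 0"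
    by (rule hausdorff_measure_Un_zero)
  then show "hausdorff_measure s A = 0"
    by (rule hausdorff_measure_zero_subset[rotated]) blast
qed

end

section \<open>A Cantor set of prescribed growth\<close>

lemma at_top_of_ratio:
  fixes f :: "nat \<Rightarrow> real"
  assumes "filterlim (\<lambda>n. f n / real n) at_top sequentially"
  shows "filterlim f at_top sequentially"
proof (rule filterlim_at_top_mono[OF filterlim_at_top_mult_at_top[OF assms filterlim_real_sequentially]])
  show "\<forall>\<^sub>F n in sequentially. f n / real n * real n \<le> f n"
    using eventually_gt_at_top[of 0] by eventually_elim simp
qed

lemma eventually_bounded_imp_bounded:
  fixes X :: "nat \<Rightarrow> real"
  assumes "eventually (\<lambda>n. X n \<le> c) sequentially"
  shows "\<exists>B. \<forall>n. X n \<le> B"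
proof -
  obtain N where N: "\<And>n. n \<ge> N \<Longrightarrow> X n \<le> c" using assms by (auto simp: eventually_sequentially)
  have "X n \<le> Max (insert c (X ` {..N}))" for n
  proof (cases "n \<le> N")
    case True
    then show ?thesis by (intro Max_ge) auto
  next
    case False
    then have "X n \<le> c" using N by simp
    also have "c \<le> Max (insert c (X ` {..N}))" by (intro Max_ge) auto
    finally show ?thesis .
  qed
  then show ?thesis by blast
qed

section \<open>Mixed radix expansion of a point of [0,1), with base \<open>m j\<close> at place
  \<open>j\<close>\<close>

primrec radix_rest :: "(nat \<Rightarrow> nat) \<Rightarrow> real \<Rightarrow> nat \<Rightarrow> real" where
  "radix_rest m t 0 = t"
| "radix_rest m t (Suc j) = frac (real (m j) * radix_rest m t j)"

definition radix_digit :: "(nat \<Rightarrow> nat) \<Rightarrow> real \<Rightarrow> nat \<Rightarrow> nat" where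
  "radix_digit m t j = nat \<lfloor>real (m j) * radix_rest m t j\<rfloor>"

context
  fixes m :: "nat \<Rightarrow> nat"
  assumes m: "\<And>j. 1 \<le> m j"
begin

lemma radix_rest_range: "t \<in> {0..<1} \<Longrightarrow> radix_rest m t j \<in> {0..<1}"
  by (cases j) (auto simp: frac_lt_1)

lemma radix_step:
  assumes "t \<in> {0..<1}"
  shows "real (m j) * radix_rest m t j = real (radix_digit m t j) + radix_rest m t (Suc j)"
    and "radix_digit m t j < m j"
proof -
  have r: "0 \<le> radix_rest m t j" "radix_rest m t j < 1" using radix_rest_range[OF assms, of j] by auto
  have *: "real (radix_digit m t j) = \<lfloor>real (m j) * radix_rest m t j\<rfloor>"
    using r by (simp add: radix_digit_def)
  then show 1: "real (m j) * radix_rest m t j = real (radix_digit m t j) + radix_rest m t (Suc j)"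
    by (simp add: frac_def)
  have "real (m j) * radix_rest m t j < real (m j)" using r m[of j] by simp
  then show "radix_digit m t j < m j"
    using 1 radix_rest_range[OF assms, of "Suc j"] by (auto simp del: radix_rest.simps)
qed

lemma radix_common_prefix:
  assumes "t \<in> {0..<1}" "u \<in> {0..<1}" "\<And>j. j < n \<Longrightarrow> radix_digit m t j = radix_digit m u j"
  shows "radix_rest m t n - radix_rest m u n = (\<Prod>j<n. real (m j)) * (t - u)"
  using assms(3)
proof (induction n)
  case (Suc n)
  have "radix_rest m t (Suc n) - radix_rest m u (Suc n) = real (m n) * (radix_rest m t n - radix_rest m u n)"
    using radix_step(1)[OF assms(1), of n] radix_step(1)[OF assms(2), of n] Suc.prems[of n]
    by (simp add: algebra_simps)
  with Suc show ?case by simp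
qed simp

text \<open>While the digits agree, the rests of \<open>t\<close> and \<open>u\<close> separate by
  the product of the bases. At the first disagreement the scaled distance is the digit difference up
  to an error of 1, which a nonzero integer absorbs into the factor 2. Unbounded products exclude
  that all digits agree.\<close>

lemma radix_first_difference:
  assumes t: "t \<in> {0..<1}" "u \<in> {0..<1}" "t \<noteq> u"
    and unb: "\<And>B. \<exists>n. B < (\<Prod>j<n. real (m j))"
  obtains n where "\<And>j. j < n \<Longrightarrow> radix_digit m t j = radix_digit m u j"
    "radix_digit m t n \<noteq> radix_digit m u n"
    "(\<Prod>j<Suc n. real (m j)) * \<bar>t - u\<bar> \<le> 2 * \<bar>real (radix_digit m t n) - real (radix_digit m u n)\<bar>"
proof -
  have "\<exists>n. radix_digit m t n \<noteq> radix_digit m u n"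
  proof (rule ccontr)
    assume "\<not> ?thesis"
    then have eq: "radix_rest m t n - radix_rest m u n = (\<Prod>j<n. real (m j)) * (t - u)" for n
      using radix_common_prefix[OF t(1,2)] by simp
    obtain n where n: "1 / \<bar>t - u\<bar> < (\<Prod>j<n. real (m j))" using unb by blast
    have "1 < (\<Prod>j<n. real (m j)) * \<bar>t - u\<bar>" using n t(3) by (simp add: field_simps)
    also have "\<dots> = \<bar>radix_rest m t n - radix_rest m u n\<bar>"
      by (simp add: eq abs_mult prod_nonneg)
    finally show False
      using radix_rest_range[OF t(1), of n] radix_rest_range[OF t(2), of n] by auto
  qed
  then obtain n where n: "radix_digit m t n \<noteq> radix_digit m u n"
    "\<And>j. j < n \<Longrightarrow> radix_digit m t j = radix_digit m u j"
    using exists_least_iff[of "\<lambda>n. radix_digit m t n \<noteq> radix_digit m u n"] by blast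
  let ?d = "real (radix_digit m t n) - real (radix_digit m u n)"
  have "\<bar>?d\<bar> \<ge> 1" using n(1) by linarith
  have "(\<Prod>j<Suc n. real (m j)) * (t - u) = real (m n) * (radix_rest m t n - radix_rest m u n)"
    using radix_common_prefix[OF t(1,2) n(2), of n] by simp
  also have "\<dots> = ?d + (radix_rest m t (Suc n) - radix_rest m u (Suc n))"
    using radix_step(1)[OF t(1), of n] radix_step(1)[OF t(2), of n] by (simp add: algebra_simps)
  finally have "\<bar>(\<Prod>j<Suc n. real (m j)) * (t - u)\<bar> \<le> \<bar>?d\<bar> + 1"
    using radix_rest_range[OF t(1), of "Suc n"] radix_rest_range[OF t(2), of "Suc n"]
    by (auto simp del: radix_rest.simps)
  then have "(\<Prod>j<Suc n. real (m j)) * \<bar>t - u\<bar> \<le> 2 * \<bar>?d\<bar>"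
    using \<open>\<bar>?d\<bar> \<ge> 1\<close> by (simp add: abs_mult abs_prod)
  with n that show ?thesis by blast
qed

end

section \<open>Points with a prescribed itinerary and the Cantor set\<close>

context branch_system
begin

text \<open>Compact counterpart of \<open>cylinder\<close>: closures and the extensions
  \<open>G\<close> replace the open intervals and \<open>T\<close>. As \<open>G\<close> depends on
  the digit, the recursion shifts the digit sequence instead of iterating one map.\<close>

primrec closed_cylinder :: "nat \<Rightarrow> (nat \<Rightarrow> nat) \<Rightarrow> real set" where
  "closed_cylinder 0 a = {0..1}"
| "closed_cylinder (Suc n) a = {x \<in> closure (I (a 0)). G (a 0) x \<in> closed_cylinder n (\<lambda>j. a (Suc j))}"

lemma closure_I_unit: "n \<ge> 1 \<Longrightarrow> closure (I n) \<subseteq> {0..1}"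
  using branch_domain_unit by (auto simp: branch_domain_def)

text \<open>Nonemptiness comes from \<open>G_onto\<close>: a point of the inner set lies in [0,1]
  and therefore has a preimage in the closed interval. This is why the inclusion in [0,1] is carried
  through the induction.\<close>

lemma closed_cylinder_compact:
  "\<forall>j. 1 \<le> a j \<Longrightarrow> compact (closed_cylinder n a) \<and> closed_cylinder n a \<noteq> {} \<and>
     closed_cylinder (Suc n) a \<subseteq> closed_cylinder n a \<and> closed_cylinder n a \<subseteq> {0..1}"
proof (induction n arbitrary: a)
  case 0
  then show ?case using closure_I_unit[of "a 0"] by auto
next
  case (Suc n)
  let ?b = "\<lambda>j. a (Suc j)"
  have IH: "compact (closed_cylinder n ?b)" "closed_cylinder n ?b \<noteq> {}"
     "closed_cylinder (Suc n) ?b \<subseteq> closed_cylinder n ?b" "closed_cylinder n ?b \<subseteq> {0..1}"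
    using Suc.IH[of ?b] Suc.prems by blast+
  have a: "1 \<le> a 0" using Suc.prems by simp
  have eq: "closed_cylinder (Suc n) a = closure (I (a 0)) \<inter> G (a 0) -` closed_cylinder n ?b" by auto
  have "closed (closed_cylinder (Suc n) a)"
    unfolding eq by (rule continuous_closed_preimage[OF G_cont[OF a] closed_closure compact_imp_closed[OF IH(1)]])
  moreover have sub: "closed_cylinder (Suc n) a \<subseteq> {0..1}"
    unfolding eq using closure_I_unit[OF a] by blast
  ultimately have "compact (closed_cylinder (Suc n) a)"
    by (meson bounded_closed_interval bounded_subset compact_eq_bounded_closed)
  moreover obtain y where y: "y \<in> closed_cylinder n ?b" using IH(2) by blast
  then have "y \<in> G (a 0) ` closure (I (a 0))" using IH(4) G_onto[OF a] by blast
  then have "closed_cylinder (Suc n) a \<noteq> {}" using y by auto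
  moreover have "closed_cylinder (Suc (Suc n)) a \<subseteq> closed_cylinder (Suc n) a"
    using IH(3) by (auto simp del: closed_cylinder.simps(2) simp: closed_cylinder.simps(2)[of _ a])
  ultimately show ?case using sub by blast
qed

text \<open>From index 2 on an interval has a neighbour on either side inside [0,1], which keeps its
  closure away from 0 and 1.\<close>

lemma closure_I_avoids_endpoints:
  assumes "2 \<le> n" shows "0 \<notin> closure (I n)" "1 \<notin> closure (I n)"
proof -
  obtain k where k: "n = Suc (Suc k)" using assms by (metis One_nat_def Suc_1 Suc_le_D Suc_le_mono)
  have "\<sigma> * e l \<in> {0..1}" for l
  proof -
    have "\<sigma> * e l \<in> closure (I (Suc l))" by (simp add: closure_I_Suc sigma_sq e_le)
    then show ?thesis by (rule subsetD[OF closure_I_unit, rotated]) simp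
  qed
  from this[of k] this[of "Suc n"] show "0 \<notin> closure (I n)" "1 \<notin> closure (I n)"
    using sigma e_less[of k "Suc k"] e_less[of n "Suc n"] unfolding k closure_I_Suc by auto
qed

text \<open>Compactness yields a point in all closed cylinders. It never sits on an endpoint of its
  interval: endpoints go to 0 or 1 by \<open>G_end\<close>, while the image has to lie in the
  closure of an interval of index at least 2. So the orbit stays in the open intervals, where
  \<open>G\<close> agrees with \<open>T\<close>.\<close>

lemma itinerary_exists:
  assumes a: "\<And>j. 2 \<le> a j"
  shows "\<exists>x. itinerary I T x a"
proof -
  define P where "P a = (\<Inter>n. closed_cylinder n a)" for a
  have P: "x \<in> I (a 0) \<and> F x \<in> P (\<lambda>j. a (Suc j))" if x: "x \<in> P a" and a: "\<And>j. 2 \<le> a j" for x a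
  proof -
    have n: "x \<in> closed_cylinder (Suc n) a" for n using x unfolding P_def by blast
    have G: "x \<in> closure (I (a 0))" "G (a 0) x \<in> P (\<lambda>j. a (Suc j))"
      using n unfolding P_def by auto
    then have "G (a 0) x \<in> closed_cylinder (Suc 0) (\<lambda>j. a (Suc j))" unfolding P_def by blast
    then have "G (a 0) x \<in> closure (I (a (Suc 0)))" by simp
    then have "G (a 0) x \<notin> {0, 1}" using closure_I_avoids_endpoints[OF a[of "Suc 0"]] by auto
    moreover have a0: "1 \<le> a 0" using a[of 0] by simp
    ultimately have "x \<in> I (a 0)" using G_end[OF a0, of x] G(1) by blast
    with G(2) show ?thesis using G_eq[OF a0] F_eq[OF a0] by simp
  qed
  have a1: "\<forall>j. 1 \<le> a j" using a by (metis Suc_1 Suc_leD)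
  have "(\<Inter>n. closed_cylinder n a) \<noteq> {}"
  proof (rule compact_nest)
    show "compact (closed_cylinder n a)" "closed_cylinder n a \<noteq> {}" for n
      using closed_cylinder_compact[OF a1] by blast+
    show "closed_cylinder n a \<subseteq> closed_cylinder k a" if "k \<le> n" for k n
      using closed_cylinder_compact[OF a1] by (intro lift_Suc_antimono_le[OF _ that]) blast
  qed
  then obtain x where x: "x \<in> P a" unfolding P_def by blast
  have "(F ^^ j) x \<in> P (\<lambda>i. a (i + j))" for j
  proof (induction j)
    case (Suc j)
    then show ?case using P[of "(F ^^ j) x" "\<lambda>i. a (i + j)"] a by simp
  qed (use x in simp)
  then have "(F ^^ j) x \<in> I (a j)" for j
    using P[of "(F ^^ j) x" "\<lambda>i. a (i + j)"] a by simp
  then show ?thesis using a1 unfolding itinerary_def by blast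
qed

text \<open>The digits differ by \<open>2 * k\<close>, so \<open>2 * k - 1 \<ge> k\<close> whole
  intervals lie strictly between, each at least as long as the lower bound for index
  \<open>c\<close>. Even spacing thus separates even neighbouring choices.\<close>

lemma separation:
  assumes "x \<in> I b" "y \<in> I c" "1 \<le> b" "b + 2 * k = c" "1 \<le> k"
  shows "real k * (real c powr - \<gamma> / (2 * C)) \<le> \<bar>x - y\<bar>"
proof -
  obtain b' where b': "b = Suc b'" using assms(3) by (cases b) auto
  obtain c' where c': "c = Suc c'" using assms(3-) by (cases c) auto
  have bc: "b \<le> c'" using assms(4,5) c' by simp
  have "real k * (real c powr - \<gamma> / (2 * C)) \<le> real (card {b..<c'}) * (real c powr - \<gamma> / (2 * C))"
    using assms(4,5) c' C by (intro mult_right_mono) auto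
  also have "\<dots> = (\<Sum>j=b..<c'. real c powr - \<gamma> / (2 * C))" by simp
  also have "\<dots> \<le> (\<Sum>j=b..<c'. e (Suc j) - e j)"
  proof (rule sum_mono)
    fix j assume j: "j \<in> {b..<c'}"
    have "real c powr - \<gamma> \<le> real (Suc j) powr - \<gamma>"
      using gamma j c' by (intro powr_mono2') auto
    then have "real c powr - \<gamma> / (2 * C) \<le> real (Suc j) powr - \<gamma> / (2 * C)"
      using C by (intro divide_right_mono) auto
    also have "\<dots> \<le> e (Suc j) - e j" by (rule I_length)
    finally show "real c powr - \<gamma> / (2 * C) \<le> e (Suc j) - e j" .
  qed
  also have "\<dots> = e c' - e b" using bc by (simp add: sum_Suc_diff')
  also have "\<dots> \<le> \<sigma> * y - \<sigma> * x"
    using assms(1,2) unfolding b' c' I_Suc by auto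
  also have "\<dots> \<le> \<bar>x - y\<bar>"
    using abs_sigma[of "x - y"] by (simp add: algebra_simps)
  finally show ?thesis .
qed

text \<open>Each \<open>t\<close> is sent to a point whose digits encode the mixed radix digits of
  \<open>t\<close>. If \<open>t\<close> and \<open>u\<close> first differ at place \<open>n\<close>,
  by \<open>k\<close>, then \<open>\<bar>t - u\<bar>\<close> is at most \<open>2 * k\<close> over
  the product of the bases, while \<open>k\<close> is at most a product of expansion factors times
  the distance of the images; \<open>bound\<close> turns this into a Hoelder estimate of exponent
  \<open>s\<close> for the inverse.\<close>

lemma cantor_set_positive:
  fixes m :: "nat \<Rightarrow> nat"
  assumes m: "\<And>j. 1 \<le> m j" and s: "0 < s" "s < 1"
    and unb: "\<And>B. \<exists>n. B < (\<Prod>j<n. real (m j))"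
    and bound: "\<And>n. 2 * real (m n) powr (1 - s) * (\<Prod>j<Suc n. 2 * C * 4 powr \<gamma> * real (m j) powr \<gamma>) powr s
       \<le> K * (\<Prod>j<Suc n. real (m j))"
    and s': "0 \<le> s'" "s' \<le> s"
    and A: "\<And>x a. itinerary I T x a \<Longrightarrow> (\<And>j. m j \<le> a j \<and> a j \<le> 4 * m j) \<Longrightarrow> x \<in> A"
  shows "hausdorff_measure s' A \<noteq> 0"
proof
  assume H: "hausdorff_measure s' A = 0"
  \<comment> \<open>Doubling the radix digit gives the even spacing wanted by
    \<open>separation\<close>; the offset \<open>2 * m j\<close> keeps all digits at least 2 and
    within a factor 4 of \<open>m j\<close>.\<close>
  define a where "a t j = 2 * m j + 2 * radix_digit m t j" for t j
  have a2: "2 \<le> a t j" for t j using m[of j] by (simp add: a_def)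
  define x where "x t = (SOME x. itinerary I T x (a t))" for t
  have x: "itinerary I T (x t) (a t)" for t
    unfolding x_def by (rule someI_ex) (use itinerary_exists a2 in blast)
  have a4: "m j \<le> a t j \<and> a t j \<le> 4 * m j" if "t \<in> {0..<1}" for t j
    using radix_step(2)[of m, OF m that, of j] by (simp add: a_def)
  have P: "(\<Prod>j<n. real (m j)) > 0" for n using m by (intro prod_pos) (metis less_le_trans of_nat_0_less_iff zero_less_one)
  have K: "K > 0"
  proof -
    have "0 < 2 * real (m 0) powr (1 - s) * (\<Prod>j<Suc 0. 2 * C * 4 powr \<gamma> * real (m j) powr \<gamma>) powr s"
      using m[of 0] C by simp
    also note bound[of 0]
    finally show ?thesis using P[of "Suc 0"] by (simp add: zero_less_mult_iff)
  qed
  have holder: "\<bar>t - u\<bar> \<le> K * \<bar>x t - x u\<bar> powr s" if t: "t \<in> {0..<1}" "u \<in> {0..<1}" "t \<noteq> u" for t u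
  proof -
    obtain n where pre: "\<And>j. j < n \<Longrightarrow> radix_digit m t j = radix_digit m u j"
      and ne: "radix_digit m t n \<noteq> radix_digit m u n"
      and le: "(\<Prod>j<Suc n. real (m j)) * \<bar>t - u\<bar> \<le> 2 * \<bar>real (radix_digit m t n) - real (radix_digit m u n)\<bar>"
      using radix_first_difference[of m, OF m t unb] by blast
    define k where "k = \<bar>real (radix_digit m t n) - real (radix_digit m u n)\<bar>"
    have k: "1 \<le> k" "k \<le> real (m n)"
      using ne radix_step(2)[of m, OF m t(1), of n] radix_step(2)[of m, OF m t(2), of n] unfolding k_def by linarith+
    let ?y = "(F ^^ n) (x t)" and ?z = "(F ^^ n) (x u)"
    let ?M = "real (4 * m n) powr - \<gamma> / (2 * C)"
    have sep: "real l * ?M \<le> \<bar>y - z\<bar>"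
      if "y \<in> I b" "z \<in> I c" "1 \<le> b" "b + 2 * l = c" "1 \<le> l" "c \<le> 4 * m n" for y z b c l
    proof -
      have "real (4 * m n) powr - \<gamma> \<le> real c powr - \<gamma>"
        using gamma that by (intro powr_mono2') auto
      then have "real l * ?M \<le> real l * (real c powr - \<gamma> / (2 * C))"
        using C by (intro mult_left_mono divide_right_mono) auto
      also have "\<dots> \<le> \<bar>y - z\<bar>" using that by (intro separation)
      finally show ?thesis .
    qed
    have yz: "?y \<in> I (a t n)" "?z \<in> I (a u n)" "1 \<le> a t n" "1 \<le> a u n"
      using x[of t] x[of u] by (auto simp: itinerary_def)
    have "k * ?M \<le> \<bar>?y - ?z\<bar>"
    proof (cases "radix_digit m t n < radix_digit m u n")
      case True
      then show ?thesis
        using sep[of ?y "a t n" ?z "a u n" "radix_digit m u n - radix_digit m t n"] yz a4[OF t(2), of n]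
        by (simp add: a_def k_def of_nat_diff)
    next
      case False
      then show ?thesis
        using sep[of ?z "a u n" ?y "a t n" "radix_digit m t n - radix_digit m u n"] yz a4[OF t(1), of n] ne
        by (simp add: a_def k_def of_nat_diff abs_minus_commute)
    qed
    also have "\<dots> \<le> (\<Prod>j<n. C * real (a t j) powr \<gamma>) * \<bar>x t - x u\<bar>"
    proof -
      have "1 \<le> a t j \<and> (F ^^ j) (x t) \<in> I (a t j) \<and> (F ^^ j) (x u) \<in> I (a t j)" if "j < n" for j
      proof -
        have "a t j = a u j" by (simp add: a_def pre[OF that])
        then show ?thesis using x[of t] x[of u] unfolding itinerary_def by metis
      qed
      then show ?thesis using F_iter_contract[of n "a t"] by blast
    qed
    also have "\<dots> \<le> (\<Prod>j<n. 2 * C * 4 powr \<gamma> * real (m j) powr \<gamma>) * \<bar>x t - x u\<bar>"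
    proof (intro mult_right_mono prod_mono conjI)
      fix j
      have "real (a t j) \<le> 4 * real (m j)" using a4[OF t(1), of j] by linarith
      then have "real (a t j) powr \<gamma> \<le> (4 * real (m j)) powr \<gamma>"
        using gamma by (intro powr_mono2) auto
      also have "\<dots> = 4 powr \<gamma> * real (m j) powr \<gamma>" by (simp add: powr_mult)
      also have "\<dots> \<le> 2 * (4 powr \<gamma> * real (m j) powr \<gamma>)" by simp
      finally show "C * real (a t j) powr \<gamma> \<le> 2 * C * 4 powr \<gamma> * real (m j) powr \<gamma>"
        using C by (simp add: mult.assoc mult.left_commute)
    qed (use C in auto)
    \<comment> \<open>The added factor is the inverse of \<open>?M\<close>; it completes the product
      to all \<open>j < Suc n\<close>.\<close>
    finally have "k * ?M * (2 * C * 4 powr \<gamma> * real (m n) powr \<gamma>) \<le>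
       (\<Prod>j<n. 2 * C * 4 powr \<gamma> * real (m j) powr \<gamma>) * \<bar>x t - x u\<bar> * (2 * C * 4 powr \<gamma> * real (m n) powr \<gamma>)"
      using C by (intro mult_right_mono) auto
    moreover have "?M * (2 * C * 4 powr \<gamma> * real (m n) powr \<gamma>) = 1"
      using C m[of n] by (simp add: powr_minus powr_mult field_simps)
    then have "k * ?M * (2 * C * 4 powr \<gamma> * real (m n) powr \<gamma>) = k"
      by (simp only: mult.assoc[of k] mult_1_right)
    ultimately have kle: "k \<le> (\<Prod>j<Suc n. 2 * C * 4 powr \<gamma> * real (m j) powr \<gamma>) * \<bar>x t - x u\<bar>"
      by (simp only: prod.lessThan_Suc mult_ac)
    define Q where "Q = (\<Prod>j<Suc n. 2 * C * 4 powr \<gamma> * real (m j) powr \<gamma>)"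
    have Q: "0 \<le> Q" unfolding Q_def using C by (intro prod_nonneg) auto
    have "(\<Prod>j<Suc n. real (m j)) * \<bar>t - u\<bar> \<le> 2 * k" using le by (simp add: k_def)
    \<comment> \<open>Interpolation: the power \<open>1 - s\<close> of \<open>k\<close> is bounded
      through the number \<open>m n\<close> of digits available, the power \<open>s\<close> through
      \<open>kle\<close>.\<close>
    also have "k = k powr (1 - s) * k powr s" using k by (simp flip: powr_add)
    also have "2 * (k powr (1 - s) * k powr s) \<le> 2 * (real (m n) powr (1 - s) * (Q * \<bar>x t - x u\<bar>) powr s)"
      using k s kle Q unfolding Q_def[symmetric] by (intro mult_left_mono mult_mono powr_mono2) auto
    also have "\<dots> = 2 * real (m n) powr (1 - s) * Q powr s * \<bar>x t - x u\<bar> powr s"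
      using Q by (simp add: powr_mult)
    also have "\<dots> \<le> K * (\<Prod>j<Suc n. real (m j)) * \<bar>x t - x u\<bar> powr s"
      using bound[of n] unfolding Q_def by (intro mult_right_mono) auto
    also have "\<dots> = (\<Prod>j<Suc n. real (m j)) * (K * \<bar>x t - x u\<bar> powr s)" by simp
    finally show ?thesis using P[of "Suc n"] by (simp only: mult_le_cancel_left_pos)
  qed
  have "negligible {0..<1::real}"
  proof (rule negligible_of_expanding_map[where g = x and K = K and s = s and s' = s' and E = A])
    show "\<bar>t - u\<bar> \<le> K * dist (x t) (x u) powr s" if "t \<in> {0..<1}" "u \<in> {0..<1}" for t u
      using holder[OF that] by (cases "t = u") (auto simp: dist_real_def)
    show "x ` {0..<1} \<subseteq> A" using A x a4 by blast
  qed (use s s' K H in auto)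
  then have "emeasure lebesgue {0..<1::real} = 0" by (simp add: negligible_iff_emeasure0)
  then show False by simp
qed

text \<open>The digits are chosen so that \<open>\<gamma>\<close> times the digit sum is
  \<open>R n\<close> up to an error linear in \<open>n\<close>. The critical places are those with
  \<open>R (Suc n)\<close> close to \<open>\<theta> * R n\<close>, where the new digit is largest
  compared with its prefix. The strict inequality for \<open>s\<close> leaves a multiple of
  \<open>R n\<close> that absorbs all linear terms.\<close>

lemma hausdorff_measure_growth_set:
  fixes R :: "nat \<Rightarrow> real"
  assumes R: "\<And>n. 0 < R n" "\<And>n. R n \<le> R (Suc n)" "\<And>n. R (Suc n) \<le> \<theta> * R n"
    and lim: "filterlim (\<lambda>n. R n / real n) at_top sequentially"
    and s: "0 < s" "s * ((\<gamma> - 1) * \<theta> + 1) < 1" and s': "0 \<le> s'" "s' \<le> s"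
  shows "hausdorff_measure s' {x. \<exists>a. itinerary I T x a \<and>
     (\<lambda>n. \<gamma> * (\<Sum>j<n. ln (real (a j))) / R n) \<longlonglongrightarrow> 1} \<noteq> 0"
proof -
  have \<theta>: "1 \<le> \<theta>" using R(1)[of 0] order_trans[OF R(2)[of 0] R(3)[of 0]] by simp
  have "s * \<gamma> \<le> s * ((\<gamma> - 1) * \<theta> + 1)"
  proof (intro mult_left_mono)
    have "(\<gamma> - 1) * 1 \<le> (\<gamma> - 1) * \<theta>" using \<theta> gamma by (intro mult_left_mono) auto
    then show "\<gamma> \<le> (\<gamma> - 1) * \<theta> + 1" by (simp add: algebra_simps)
  qed (use s in simp)
  with s(2) have s\<gamma>: "s * \<gamma> < 1" by linarith
  have "s * 1 < s * \<gamma>" using s(1) gamma by (intro mult_strict_left_mono)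
  with s\<gamma> have s1: "s < 1" by linarith
  define \<rho> where "\<rho> j = (R (Suc j) - R j) / \<gamma>" for j
  have \<rho>0: "0 \<le> \<rho> j" for j using R(2)[of j] gamma by (simp add: \<rho>_def)
  have \<rho>sum: "(\<Sum>j<n. \<rho> j) = (R n - R 0) / \<gamma>" for n
    unfolding \<rho>_def sum_divide_distrib[symmetric] sum_lessThan_telescope ..
  \<comment> \<open>As \<open>\<rho> j \<ge> 0\<close>, rounding up at most doubles
    \<open>exp (\<rho> j)\<close>.\<close>
  define m where "m j = nat \<lceil>exp (\<rho> j)\<rceil>" for j
  have m: "exp (\<rho> j) \<le> real (m j)" "real (m j) \<le> 2 * exp (\<rho> j)" for j
  proof -
    have "real (m j) = of_int \<lceil>exp (\<rho> j)\<rceil>" unfolding m_def by (simp add: less_imp_le)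
    moreover have "1 \<le> exp (\<rho> j)" using \<rho>0 by simp
    ultimately show "exp (\<rho> j) \<le> real (m j)" "real (m j) \<le> 2 * exp (\<rho> j)" by linarith+
  qed
  have m1: "1 \<le> m j" for j
  proof -
    have "1 \<le> exp (\<rho> j)" using \<rho>0 by simp
    with m(1)[of j] show ?thesis by linarith
  qed
  have lnm: "\<rho> j \<le> ln (real (m j))" "ln (real (m j)) \<le> \<rho> j + ln 2" for j
  proof -
    show "\<rho> j \<le> ln (real (m j))" using m(1)[of j] m1[of j] by (simp add: ln_ge_iff)
    have "ln (real (m j)) \<le> ln (2 * exp (\<rho> j))" using m(2)[of j] m1[of j] by (subst ln_le_cancel_iff) auto
    then show "ln (real (m j)) \<le> \<rho> j + ln 2" by (simp add: ln_mult)
  qed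
  define L where "L n = (\<Sum>j<n. ln (real (m j)))" for n
  have L: "(R n - R 0) / \<gamma> \<le> L n" for n
    unfolding L_def \<rho>sum[symmetric] by (intro sum_mono lnm)
  have eL: "(\<Prod>j<n. real (m j)) = exp (L n)" for n
  proof -
    have "real (m j) = exp (ln (real (m j)))" for j using m1[of j] by simp
    then show ?thesis unfolding L_def by (simp add: exp_sum)
  qed
  have Rtop: "filterlim R at_top sequentially" by (rule at_top_of_ratio[OF lim])
  define q where "q = ln (2 * C * 4 powr \<gamma>)"
  define \<delta> where "\<delta> = 1 - s * ((\<gamma> - 1) * \<theta> + 1)"
  have \<delta>: "\<delta> > 0" using s by (simp add: \<delta>_def)
  \<comment> \<open>Logarithm of the quotient of the two sides of \<open>bound\<close> in
    \<open>cantor_set_positive\<close>, apart from \<open>K\<close>; an upper bound uniform in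
    \<open>n\<close> is wanted.\<close>
  define X where "X n = ln 2 + (1 - s) * ln (real (m n)) + s * (real (Suc n) * q + \<gamma> * L (Suc n)) - L (Suc n)" for n
  define c where "c = ln 2 + s * q + s * (\<gamma> - 1) * ln 2 + (1 - s * \<gamma>) * R 0 / \<gamma>"
  have Xle: "X n \<le> c + s * q * real n - \<delta> * R n / \<gamma>" for n
  proof -
    have "X n = ln 2 + s * q + s * q * real n + s * (\<gamma> - 1) * ln (real (m n)) - (1 - s * \<gamma>) * L n"
      by (simp add: X_def L_def algebra_simps)
    also have "\<dots> \<le> ln 2 + s * q + s * q * real n + s * (\<gamma> - 1) * ((\<theta> - 1) * R n / \<gamma> + ln 2)
        - (1 - s * \<gamma>) * ((R n - R 0) / \<gamma>)"
    proof -
      have "\<rho> n \<le> (\<theta> - 1) * R n / \<gamma>"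
        unfolding \<rho>_def using R(3)[of n] gamma by (intro divide_right_mono) (auto simp: algebra_simps)
      then have "ln (real (m n)) \<le> (\<theta> - 1) * R n / \<gamma> + ln 2" using lnm(2)[of n] by linarith
      then have "s * (\<gamma> - 1) * ln (real (m n)) \<le> s * (\<gamma> - 1) * ((\<theta> - 1) * R n / \<gamma> + ln 2)"
        using s gamma by (intro mult_left_mono) auto
      moreover have "(1 - s * \<gamma>) * ((R n - R 0) / \<gamma>) \<le> (1 - s * \<gamma>) * L n"
        using s\<gamma> L[of n] by (intro mult_left_mono) auto
      ultimately show ?thesis by linarith
    qed
    also have "\<dots> = c + s * q * real n - \<delta> * R n / \<gamma>"
      using gamma by (simp add: c_def \<delta>_def field_simps)
    finally show ?thesis .
  qed
  have "eventually (\<lambda>n. X n \<le> c) sequentially"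
  proof -
    have "eventually (\<lambda>n. s * q * \<gamma> / \<delta> \<le> R n / real n) sequentially"
      using lim by (simp add: filterlim_at_top)
    then show ?thesis
      using eventually_gt_at_top[of 0]
    proof eventually_elim
      case (elim n)
      then have "s * q * real n \<le> \<delta> * R n / \<gamma>" using \<delta> gamma by (simp add: field_simps)
      with Xle[of n] show ?case by linarith
    qed
  qed
  then obtain B where B: "\<And>n. X n \<le> B" using eventually_bounded_imp_bounded by blast
  show ?thesis
  proof (rule cantor_set_positive[OF m1 s(1) s1 _ _ s'])
    fix b
    have "eventually (\<lambda>n. \<gamma> * \<bar>b\<bar> + R 0 \<le> R n) sequentially"
      using Rtop by (simp add: filterlim_at_top)
    then obtain n where "\<gamma> * \<bar>b\<bar> + R 0 \<le> R n" by (auto simp: eventually_sequentially)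
    then have "\<bar>b\<bar> \<le> (R n - R 0) / \<gamma>" using gamma by (simp add: field_simps)
    then have "\<bar>b\<bar> \<le> L n" using L[of n] by linarith
    then have "b < exp (L n)" using exp_ge_add_one_self[of "L n"] by linarith
    then show "\<exists>n. b < (\<Prod>j<n. real (m j))" unfolding eL by blast
  next
    fix n
    have pos: "0 < 2 * C * 4 powr \<gamma>" using C by simp
    have "2 * C * 4 powr \<gamma> * real (m j) powr \<gamma> = exp (q + \<gamma> * ln (real (m j)))" for j
      using m1[of j] pos by (simp add: exp_add q_def powr_def)
    then have "(\<Prod>j<Suc n. 2 * C * 4 powr \<gamma> * real (m j) powr \<gamma>) = exp (\<Sum>j<Suc n. q + \<gamma> * ln (real (m j)))"
      by (simp only: exp_sum finite_lessThan)
    also have "(\<Sum>j<Suc n. q + \<gamma> * ln (real (m j))) = real (Suc n) * q + \<gamma> * L (Suc n)"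
      unfolding L_def sum.distrib sum_distrib_left[symmetric] by simp
    finally have prod: "(\<Prod>j<Suc n. 2 * C * 4 powr \<gamma> * real (m j) powr \<gamma>) = exp (real (Suc n) * q + \<gamma> * L (Suc n))" .
    have "2 * real (m n) powr (1 - s) * (\<Prod>j<Suc n. 2 * C * 4 powr \<gamma> * real (m j) powr \<gamma>) powr s
      = exp (ln 2 + (1 - s) * ln (real (m n)) + s * (real (Suc n) * q + \<gamma> * L (Suc n)))"
      unfolding prod exp_powr_real using m1[of n] by (simp add: exp_add powr_def mult.commute[of s])
    also have "\<dots> = exp (X n) * exp (L (Suc n))" by (simp add: X_def mult_exp_exp)
    also have "\<dots> \<le> exp B * exp (L (Suc n))" using B by simp
    finally show "2 * real (m n) powr (1 - s) * (\<Prod>j<Suc n. 2 * C * 4 powr \<gamma> * real (m j) powr \<gamma>) powr s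
       \<le> exp B * (\<Prod>j<Suc n. real (m j))" unfolding eL .
  next
    fix x a assume x: "itinerary I T x a" and a: "\<And>j. m j \<le> a j \<and> a j \<le> 4 * m j"
    \<comment> \<open>The 8 is 4 times 2: digits are at most \<open>4 * m j\<close>, and
      \<open>m j\<close> is at most \<open>2 * exp (\<rho> j)\<close>.\<close>
    have lna: "\<rho> j \<le> ln (real (a j))" "ln (real (a j)) \<le> \<rho> j + ln 8" for j
    proof -
      have "1 \<le> real (m j)" "real (m j) \<le> real (a j)" "real (a j) \<le> 4 * real (m j)"
        using a[of j] m1[of j] by linarith+
      then have "ln (real (m j)) \<le> ln (real (a j))" "ln (real (a j)) \<le> ln (4 * real (m j))"
        by (subst ln_le_cancel_iff; simp)+
      moreover have "ln (4 * real (m j)) = ln 4 + ln (real (m j))" using m1[of j] by (simp add: ln_mult)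
      moreover have "ln (8::real) = ln 4 + ln 2" using ln_mult[of 4 "2::real"] by simp
      ultimately show "\<rho> j \<le> ln (real (a j))" "ln (real (a j)) \<le> \<rho> j + ln 8"
        using lnm[of j] by linarith+
    qed
    have lower: "R n - R 0 \<le> \<gamma> * (\<Sum>j<n. ln (real (a j)))" for n
    proof -
      have "(R n - R 0) / \<gamma> \<le> (\<Sum>j<n. ln (real (a j)))"
        unfolding \<rho>sum[symmetric] by (intro sum_mono lna)
      then show ?thesis using gamma by (simp add: field_simps)
    qed
    have upper: "\<gamma> * (\<Sum>j<n. ln (real (a j))) \<le> R n + \<gamma> * ln 8 * real n" for n
    proof -
      have "(\<Sum>j<n. ln (real (a j))) \<le> (\<Sum>j<n. \<rho> j + ln 8)" by (intro sum_mono lna)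
      also have "\<dots> = (R n - R 0) / \<gamma> + real n * ln 8" by (simp add: sum.distrib \<rho>sum)
      also have "\<dots> \<le> R n / \<gamma> + real n * ln 8"
        using R(1)[of 0] gamma by (intro add_mono divide_right_mono) auto
      finally show ?thesis using gamma by (simp add: field_simps)
    qed
    have inv: "(\<lambda>n. real n / R n) \<longlonglongrightarrow> 0"
      using tendsto_inverse_0_at_top[OF lim] by (simp add: inverse_eq_divide)
    have invR: "(\<lambda>n. R 0 / R n) \<longlonglongrightarrow> 0"
      by (rule real_tendsto_divide_at_top[OF tendsto_const Rtop])
    have "(\<lambda>n. \<gamma> * (\<Sum>j<n. ln (real (a j))) / R n) \<longlonglongrightarrow> 1"
    proof (rule tendsto_sandwich)
      show "(\<lambda>n. 1 - R 0 / R n) \<longlonglongrightarrow> 1" using tendsto_diff[OF tendsto_const invR, of 1] by simp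
      show "(\<lambda>n. 1 + \<gamma> * ln 8 * (real n / R n)) \<longlonglongrightarrow> 1"
        using tendsto_add[OF tendsto_const tendsto_mult[OF tendsto_const inv], of 1 "\<gamma> * ln 8"] by simp
      show "\<forall>\<^sub>F n in sequentially. 1 - R 0 / R n \<le> \<gamma> * (\<Sum>j<n. ln (real (a j))) / R n"
      proof (intro always_eventually allI)
        fix n
        have "1 - R 0 / R n = (R n - R 0) / R n" using R(1)[of n] by (simp add: diff_divide_distrib)
        also have "\<dots> \<le> \<gamma> * (\<Sum>j<n. ln (real (a j))) / R n"
          using lower R(1)[of n] by (intro divide_right_mono) auto
        finally show "1 - R 0 / R n \<le> \<gamma> * (\<Sum>j<n. ln (real (a j))) / R n" .
      qed
      show "\<forall>\<^sub>F n in sequentially. \<gamma> * (\<Sum>j<n. ln (real (a j))) / R n \<le> 1 + \<gamma> * ln 8 * (real n / R n)"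
      proof (intro always_eventually allI)
        fix n
        have "\<gamma> * (\<Sum>j<n. ln (real (a j))) / R n \<le> (R n + \<gamma> * ln 8 * real n) / R n"
          using upper R(1)[of n] by (intro divide_right_mono) auto
        also have "\<dots> = 1 + \<gamma> * ln 8 * (real n / R n)" using R(1)[of n] by (simp add: add_divide_distrib)
        finally show "\<gamma> * (\<Sum>j<n. ln (real (a j))) / R n \<le> 1 + \<gamma> * ln 8 * (real n / R n)" .
      qed
    qed
    with x show "x \<in> {x. \<exists>a. itinerary I T x a \<and> (\<lambda>n. \<gamma> * (\<Sum>j<n. ln (real (a j))) / R n) \<longlonglongrightarrow> 1}" by blast
  qed
qed

end

section \<open>Markov--Renyi maps are branch systems\<close>

lemma open_interval_eq:
  fixes S :: "real set"
  assumes "open S" "is_interval S" "S \<noteq> {}" "bounded S"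
  shows "S = {Inf S<..<Sup S}" "Inf S < Sup S"
proof -
  have bdd: "bdd_below S" "bdd_above S" using assms(4) by (simp_all add: bounded_imp_bdd_below bounded_imp_bdd_above)
  have strict: "Inf S < x \<and> x < Sup S" if x: "x \<in> S" for x
  proof -
    obtain \<epsilon> where \<epsilon>: "\<epsilon> > 0" "ball x \<epsilon> \<subseteq> S" using assms(1) x by (meson open_contains_ball)
    have "x - \<epsilon>/2 \<in> ball x \<epsilon>" "x + \<epsilon>/2 \<in> ball x \<epsilon>" using \<epsilon>(1) by (simp_all add: dist_real_def)
    then have "x - \<epsilon>/2 \<in> S" "x + \<epsilon>/2 \<in> S" using \<epsilon>(2) by blast+
    then have "Inf S \<le> x - \<epsilon>/2" "x + \<epsilon>/2 \<le> Sup S" using bdd by (auto intro: cInf_lower cSup_upper)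
    with \<epsilon>(1) show ?thesis by linarith
  qed
  moreover have "z \<in> S" if z: "Inf S < z" "z < Sup S" for z
  proof -
    obtain y where "y \<in> S" "y < z" using cInf_lessD[OF assms(3) z(1)] by blast
    moreover obtain y' where "y' \<in> S" "z < y'" using less_cSupD[OF assms(3) z(2)] by blast
    ultimately show ?thesis using assms(2) unfolding is_interval_1 by (meson less_imp_le)
  qed
  ultimately show "S = {Inf S<..<Sup S}" by auto
  show "Inf S < Sup S" using strict assms(3) by (meson ex_in_conv less_trans)
qed

text \<open>Each interval touches the next on one side. The sequence cannot turn back: if
  \<open>I (n + 1)\<close> lies to the right of \<open>I n\<close>, then an interval attached to the
  left of \<open>I (n + 1)\<close> would overlap \<open>I n\<close>. So the first pair decides the
  direction.\<close>

lemma consecutive_intervals: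
  fixes I :: "nat \<Rightarrow> real set"
  assumes I: "\<And>n. n \<ge> 1 \<Longrightarrow> open (I n) \<and> is_interval (I n) \<and> I n \<noteq> {} \<and> I n \<subseteq> {0..1}"
    and disj: "disjoint_family_on I {1..}"
    and adj: "\<And>n. n \<ge> 1 \<Longrightarrow> \<exists>e. frontier (I n) \<inter> frontier (I (Suc n)) = {e}"
  shows "\<exists>\<sigma>::real. \<exists>e. (\<sigma> = 1 \<or> \<sigma> = -1) \<and> strict_mono e \<and>
    (\<forall>n. I (Suc n) = {x. e n < \<sigma> * x \<and> \<sigma> * x < e (Suc n)})"
proof -
  define l where "l n = Inf (I (Suc n))" for n
  define r where "r n = Sup (I (Suc n))" for n
  have lr: "I (Suc n) = {l n<..<r n}" "l n < r n" for n
  proof -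
    have "bounded (I (Suc n))" using I[of "Suc n"] bounded_subset[of "{0..1}" "I (Suc n)"] by auto
    then show "I (Suc n) = {l n<..<r n}" "l n < r n"
      unfolding l_def r_def using open_interval_eq[of "I (Suc n)"] I[of "Suc n"] by simp_all
  qed
  have fr: "frontier (I (Suc n)) = {l n, r n}" for n
    unfolding lr(1) using lr(2)[of n] by (auto simp: frontier_def interior_open)
  have dis: "r i \<le> l j \<or> r j \<le> l i" if "i \<noteq> j" for i j
  proof (rule ccontr)
    assume "\<not> ?thesis"
    then have "max (l i) (l j) < min (r i) (r j)" using lr(2)[of i] lr(2)[of j] by auto
    then obtain z where "max (l i) (l j) < z" "z < min (r i) (r j)" using dense by blast
    then have "z \<in> I (Suc i) \<inter> I (Suc j)" unfolding lr(1) by auto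
    moreover have "I (Suc i) \<inter> I (Suc j) = {}"
      using disj that by (auto simp: disjoint_family_on_def)
    ultimately show False by blast
  qed
  have cons: "r n = l (Suc n) \<or> r (Suc n) = l n" for n
  proof -
    obtain e where "{l n, r n} \<inter> {l (Suc n), r (Suc n)} = {e}"
      using adj[of "Suc n"] unfolding fr by auto
    then have "e \<in> {l n, r n}" "e \<in> {l (Suc n), r (Suc n)}" by blast+
    then show ?thesis using dis[of n "Suc n"] lr(2)[of n] lr(2)[of "Suc n"] by auto
  qed
  have dir: "(r n = l (Suc n)) = (r 0 = l 1)" for n
  proof (induction n)
    case (Suc n)
    have d: "r n \<le> l (Suc (Suc n)) \<or> r (Suc (Suc n)) \<le> l n" by (rule dis) simp
    have "(r (Suc n) = l (Suc (Suc n))) = (r n = l (Suc n))"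
      using cons[of n] cons[of "Suc n"] d lr(2)[of n] lr(2)[of "Suc n"] lr(2)[of "Suc (Suc n)"]
      by linarith
    with Suc show ?case by simp
  qed simp
  show ?thesis
  proof (cases "r 0 = l 1")
    case True
    then have r: "r n = l (Suc n)" for n using dir by blast
    show ?thesis
      by (intro exI[of _ 1] exI[of _ l]) (use lr r in \<open>auto simp: strict_mono_Suc_iff\<close>)
  next
    case False
    then have l: "l n = r (Suc n)" for n using dir[of n] cons[of n] by metis
    \<comment> \<open>Reflection turns right endpoints into left ones, so the increasing sequence is
      \<open>- r n\<close>.\<close>
    show ?thesis
      by (intro exI[of _ "-1"] exI[of _ "\<lambda>n. - r n"]) (use lr l in \<open>auto simp: strict_mono_Suc_iff\<close>)
  qed
qed

text \<open>The image is an interval with points arbitrarily near 0 and 1. This serves to locate the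
  images of endpoints.\<close>

lemma dense_image_covers_interior:
  fixes f :: "real \<Rightarrow> real"
  assumes "continuous_on S f" "is_interval S" "closure (f ` S) = {0..1}" "0 < y" "y < 1"
  shows "y \<in> f ` S"
proof -
  have near: "\<exists>u\<in>f ` S. dist u z < \<epsilon>" if "z \<in> {0..1}" "\<epsilon> > 0" for z \<epsilon>
    using that assms(3) closure_approachable[of z "f ` S"] by blast
  obtain u where "u \<in> f ` S" "dist u 0 < y" using near[of 0 y] assms by auto
  moreover obtain v where "v \<in> f ` S" "dist v 1 < 1 - y" using near[of 1 "1 - y"] assms by auto
  moreover have "is_interval (f ` S)"
    using assms(1,2) by (simp add: is_interval_connected_1 connected_continuous_image)
  moreover have "u \<le> y" "y \<le> v" using \<open>dist u 0 < y\<close> \<open>dist v 1 < 1 - y\<close> unfolding dist_real_def by linarith+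
  ultimately show ?thesis unfolding is_interval_1 by blast
qed

lemma markov_renyi_branch_system:
  assumes "markov_renyi I T \<gamma>"
  obtains C \<sigma> e G where "branch_system I T \<gamma> C \<sigma> e G"
proof -
  note M = assms[unfolded markov_renyi_def]
  have I: "open (I n) \<and> is_interval (I n) \<and> I n \<noteq> {} \<and> I n \<subseteq> {0..1}" if "n \<ge> 1" for n
    using M that by blast
  have disj: "disjoint_family_on I {1..}" using M by blast
  have adj: "\<exists>e. frontier (I n) \<inter> frontier (I (Suc n)) = {e}" if "n \<ge> 1" for n using M that by blast
  have dense: "closure (T ` I n) = {0..1}" if "n \<ge> 1" for n using M that by blast
  have "\<exists>\<sigma>::real. \<exists>e. (\<sigma> = 1 \<or> \<sigma> = -1) \<and> strict_mono e \<and>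
    (\<forall>n. I (Suc n) = {x. e n < \<sigma> * x \<and> \<sigma> * x < e (Suc n)})"
    by (rule consecutive_intervals) (use I disj adj in blast)+
  then obtain \<sigma> e where \<sigma>: "\<sigma> = 1 \<or> \<sigma> = (-1::real)" "strict_mono e"
    "\<And>n. I (Suc n) = {x. e n < \<sigma> * x \<and> \<sigma> * x < e (Suc n)}"
    by (elim exE conjE) simp
  have "\<exists>Tn :: nat \<Rightarrow> real \<Rightarrow> real.
        (\<forall>n\<ge>1. \<exists>U. closure (I n) \<subseteq> U \<and> C1_diffeomorphism_on (Tn n) U \<and> (\<forall>x\<in>I n. Tn n x = T x)) \<and>
        (\<exists>C>1. \<forall>n\<ge>1. \<forall>x\<in>closure (I n).
           inverse C * real n powr \<gamma> \<le> \<bar>deriv (Tn n) x\<bar> \<and> \<bar>deriv (Tn n) x\<bar> \<le> C * real n powr \<gamma>)"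
    using M by (elim conjE)
  then obtain G C where G: "\<forall>n\<ge>1. \<exists>U. closure (I n) \<subseteq> U \<and> C1_diffeomorphism_on (G n) U \<and> (\<forall>x\<in>I n. G n x = T x)"
    and C: "C > 1" "\<forall>n\<ge>1. \<forall>x\<in>closure (I n). inverse C * real n powr \<gamma> \<le> \<bar>deriv (G n) x\<bar> \<and>
           \<bar>deriv (G n) x\<bar> \<le> C * real n powr \<gamma>"
    by (elim exE conjE) simp
  have "branch_system I T \<gamma> C \<sigma> e G"
  proof
    show "1 < \<gamma>" using M by blast
    show "x \<in> branch_domain I \<Longrightarrow> T x \<in> {0..1}" for x using M by blast
    fix n :: nat assume n: "n \<ge> 1"
    obtain U where U: "closure (I n) \<subseteq> U" "C1_diffeomorphism_on (G n) U" "\<And>x. x \<in> I n \<Longrightarrow> G n x = T x"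
      using G[rule_format, OF n] by blast
    have c1: "G n C1_differentiable_on U" "inj_on (G n) U" using U(2) by (auto simp: C1_diffeomorphism_on_def)
    have IU: "I n \<subseteq> U" using U(1) closure_subset by blast
    show cont: "continuous_on (closure (I n)) (G n)"
      using C1_differentiable_imp_continuous_on[OF c1(1)] U(1) continuous_on_subset by blast
    have im: "G n ` I n = T ` I n" using U(3) by auto
    show onto: "G n ` closure (I n) = {0..1}"
    proof
      show "G n ` closure (I n) \<subseteq> {0..1}"
        by (rule image_closure_subset[OF cont]) (use dense[OF n] im closure_subset[of "T ` I n"] in auto)
      have "compact (closure (I n))"
        using I[OF n] by (meson bounded_closed_interval bounded_subset compact_closure)
      then have "closed (G n ` closure (I n))"
        by (intro compact_imp_closed compact_continuous_image cont)
      moreover have "T ` I n \<subseteq> G n ` closure (I n)" unfolding im[symmetric] using closure_subset by blast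
      ultimately show "{0..1} \<subseteq> G n ` closure (I n)"
        using closure_minimal[of "T ` I n"] dense[OF n] by blast
    qed
    show "x \<in> I n \<Longrightarrow> G n x = T x" for x by (rule U(3))
    show "\<exists>D. (T has_real_derivative D) (at x) \<and> real n powr \<gamma> / C \<le> \<bar>D\<bar> \<and> \<bar>D\<bar> \<le> C * real n powr \<gamma>"
      if x: "x \<in> I n" for x
    proof -
      obtain D where "(G n has_vector_derivative D) (at x)"
        using c1(1) x IU unfolding C1_differentiable_on_def by blast
      then have D: "(G n has_real_derivative D) (at x)"
        by (simp add: has_real_derivative_iff_has_vector_derivative)
      then have "(T has_real_derivative D) (at x)"
        by (rule has_field_derivative_transform_within_open[of _ _ _ "I n"]) (use I[OF n] x U(3) in auto)
      moreover have "x \<in> closure (I n)" using x closure_subset by blast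
      ultimately show ?thesis
        using C(2)[rule_format, OF n] DERIV_imp_deriv[OF D] by (auto simp: divide_inverse mult.commute)
    qed
    \<comment> \<open>A value strictly between 0 and 1 is already taken inside the open interval, so
      injectivity of \<open>G n\<close> leaves only 0 and 1 for an endpoint.\<close>
    show "G n x \<in> {0, 1}" if x: "x \<in> closure (I n) - I n" for x
    proof (rule ccontr)
      assume no: "G n x \<notin> {0, 1}"
      have "G n x \<in> {0..1}" using onto x by blast
      with no have y: "0 < G n x" "G n x < 1" by auto
      have "G n x \<in> G n ` I n"
      proof (rule dense_image_covers_interior[OF _ _ _ y])
        show "continuous_on (I n) (G n)" using cont closure_subset continuous_on_subset by blast
        show "is_interval (I n)" using I[OF n] by blast
        show "closure (G n ` I n) = {0..1}" unfolding im by (rule dense[OF n])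
      qed
      then obtain z where "z \<in> I n" "G n x = G n z" by blast
      then show False using c1(2) x U(1) IU by (metis DiffD1 DiffD2 inj_onD subsetD)
    qed
  qed (use \<sigma> C(1) I dense in auto)
  then show ?thesis by (rule that)
qed

section \<open>Envelopes with bounded growth ratio\<close>

lemma at_top_imp_argmin:
  fixes f :: "nat \<Rightarrow> real"
  assumes "filterlim f at_top sequentially"
  shows "\<exists>m\<ge>n. \<forall>k\<ge>n. f m \<le> f k"
proof -
  obtain N where N: "\<And>k. k \<ge> N \<Longrightarrow> f n \<le> f k"
    using assms by (force simp: filterlim_at_top eventually_sequentially)
  define M where "M = max n N"
  have "\<exists>m\<in>{n..M}. \<forall>k\<in>{n..M}. f m \<le> f k"
    using ex_min_if_finite[of "f ` {n..M}"] by (fastforce simp: M_def not_less)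
  then obtain m where m: "m \<in> {n..M}" "\<And>k. k \<in> {n..M} \<Longrightarrow> f m \<le> f k" by blast
  have "f m \<le> f k" if "k \<ge> n" for k
  proof (cases "k \<le> M")
    case True
    then show ?thesis using m(2) that by simp
  next
    case False
    then have "f n \<le> f k" using N[of k] by (simp add: M_def)
    moreover have "f m \<le> f n" using m(2)[of n] by (simp add: M_def)
    ultimately show ?thesis by linarith
  qed
  then show ?thesis using m(1) by auto
qed

lemma lower_root_growth_ge_1:
  assumes "filterlim \<psi> at_top sequentially"
  shows "1 \<le> lower_root_growth \<psi>"
  unfolding lower_root_growth_def
proof (rule Liminf_bounded)
  have "eventually (\<lambda>n. 1 \<le> \<psi> n) sequentially" using assms by (simp add: filterlim_at_top)
  then show "\<forall>\<^sub>F n in sequentially. 1 \<le> ereal (root n (\<psi> n))"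
    using eventually_gt_at_top[of 0]
    by eventually_elim (simp add: one_ereal_def real_root_ge_1_iff)
qed

lemma upper_root_growth_ge_lower: "lower_root_growth \<psi> \<le> upper_root_growth \<psi>"
  unfolding lower_root_growth_def upper_root_growth_def by (rule Liminf_le_Limsup) simp

lemma less_root_imp: "\<lbrakk>\<beta> < root n x; 0 \<le> \<beta>; 0 < n\<rbrakk> \<Longrightarrow> \<beta> ^ n \<le> x" for x :: real
  by (metis less_imp_le power_mono real_root_ge_0_iff real_root_pow_pos2 order_trans)

lemma root_less_imp: "\<lbrakk>root n x < \<beta>; 0 \<le> x; 0 < n\<rbrakk> \<Longrightarrow> x \<le> \<beta> ^ n" for x :: real
  by (metis less_imp_le power_mono real_root_ge_0_iff real_root_pow_pos2)

text \<open>The envelope \<open>R\<close> below is the largest function below \<open>\<psi>\<close> that is nondecreasing and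
  grows at most by the factor \<open>\<theta>\<close> in each step.\<close>

lemma lower_envelope:
  assumes pos: "\<forall>n\<ge>1. \<psi> n > 0"
    and lim: "filterlim (\<lambda>n. \<psi> n / real n) at_top sequentially"
    and \<theta>: "lower_root_growth \<psi> < ereal \<theta>"
  obtains R :: "nat \<Rightarrow> real" where "\<And>n. 0 < R n" "\<And>n. R n \<le> R (Suc n)" "\<And>n. R (Suc n) \<le> \<theta> * R n"
    "filterlim (\<lambda>n. R n / real n) at_top sequentially"
    "\<forall>\<^sub>F n in sequentially. R n \<le> \<psi> n" "\<exists>\<^sub>F n in sequentially. \<psi> n \<le> R n"
proof -
  have top: "filterlim \<psi> at_top sequentially" by (rule at_top_of_ratio[OF lim])
  have "1 \<le> lower_root_growth \<psi>" by (rule lower_root_growth_ge_1[OF top])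
  also note \<theta>
  finally have \<theta>1: "1 < \<theta>" by simp
  \<comment> \<open>The value \<open>\<psi> 0\<close> may have any sign, so it is replaced by
    1.\<close>
  define f where "f n = (if n = 0 then 1 else \<psi> n)" for n
  have fpos: "f n > 0" for n using pos by (simp add: f_def)
  have f\<psi>: "\<forall>\<^sub>F n in sequentially. f n = \<psi> n"
    using eventually_gt_at_top[of 0] by eventually_elim (simp add: f_def)
  have ftop: "filterlim f at_top sequentially"
    using filterlim_cong[OF refl refl f\<psi>] top by blast
  obtain M where M: "\<And>n. M n \<ge> n" "\<And>n k. k \<ge> n \<Longrightarrow> f (M n) \<le> f k"
    using at_top_imp_argmin[OF ftop] by metis
  \<comment> \<open>The largest nondecreasing minorant of \<open>f\<close>: the infimum over all
    \<open>k \<ge> n\<close>, attained at \<open>M n\<close>.\<close>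
  define \<phi> where "\<phi> n = f (M n)" for n
  have \<phi>: "\<phi> n > 0" "\<phi> n \<le> \<phi> (Suc n)" "\<phi> n \<le> f n" for n
    using fpos M(2)[of n "M (Suc n)"] M(1)[of "Suc n"] M(2)[of n n] by (auto simp: \<phi>_def)
  define R where "R = rec_nat (\<phi> 0) (\<lambda>n r. min (\<phi> (Suc n)) (\<theta> * r))"
  have R0: "R 0 = \<phi> 0" and RS: "R (Suc n) = min (\<phi> (Suc n)) (\<theta> * R n)" for n by (simp_all add: R_def)
  have Rpos: "0 < R n" for n by (induction n) (use R0 RS \<phi> \<theta>1 in auto)
  have R\<phi>: "R n \<le> \<phi> n" for n by (cases n) (auto simp: R0 RS)
  have Rmono: "R n \<le> R (Suc n)" for n
  proof -
    have "R n \<le> \<theta> * R n" using Rpos[of n] \<theta>1 by simp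
    moreover have "R n \<le> \<phi> (Suc n)" using R\<phi>[of n] \<phi>(2)[of n] by linarith
    ultimately show ?thesis by (simp add: RS)
  qed
  have Rgrow: "R (Suc n) \<le> \<theta> * R n" for n by (simp add: RS)
  \<comment> \<open>Otherwise the growth limit is active in every step from \<open>N\<close> on, and
    \<open>R\<close>, hence \<open>\<psi>\<close>, is at least a constant times
    \<open>\<theta> ^ n\<close>, against the choice of \<open>\<theta>\<close>.\<close>
  have touch: "\<exists>n\<ge>N. R n = \<phi> n" for N
  proof (rule ccontr)
    assume "\<not> ?thesis"
    then have ne: "R n \<noteq> \<phi> n" if "n \<ge> N" for n using that by blast
    have step: "R (N + k) = \<theta> ^ k * R N" for k
    proof (induction k)
      case (Suc k)
      have "R (Suc (N + k)) = \<theta> * R (N + k)"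
        using ne[of "Suc (N + k)"] unfolding RS by (auto simp: min_def split: if_splits)
      with Suc show ?case by simp
    qed simp
    define c where "c = R N / \<theta> ^ N"
    have c: "c > 0" using Rpos \<theta>1 by (simp add: c_def)
    have le: "\<theta> ^ n * c \<le> \<psi> n" if "n \<ge> max N 1" for n
    proof -
      have "\<theta> ^ n * c = \<theta> ^ (n - N) * R N"
        using that \<theta>1 by (simp add: c_def power_diff)
      also have "\<dots> = R n" using step[of "n - N"] that by simp
      also have "\<dots> \<le> f n" using R\<phi>[of n] \<phi>(3)[of n] by linarith
      finally show ?thesis using that by (simp add: f_def split: if_splits)
    qed
    have "\<forall>\<^sub>F n in sequentially. ereal (\<theta> * root n c) \<le> ereal (root n (\<psi> n))"
    proof (rule eventually_sequentiallyI[of "max N 1"])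
      fix n assume n: "max N 1 \<le> n"
      then have "\<theta> * root n c = root n (\<theta> ^ n * c)" using \<theta>1 by (simp add: real_root_mult real_root_power_cancel)
      also have "\<dots> \<le> root n (\<psi> n)" using le[OF n] n by simp
      finally show "ereal (\<theta> * root n c) \<le> ereal (root n (\<psi> n))" by simp
    qed
    then have "liminf (\<lambda>n. ereal (\<theta> * root n c)) \<le> lower_root_growth \<psi>"
      unfolding lower_root_growth_def by (rule Liminf_mono)
    moreover have "(\<lambda>n. ereal (\<theta> * root n c)) \<longlonglongrightarrow> ereal (\<theta> * 1)"
      using c by (intro tendsto_intros LIMSEQ_root_const) auto
    then have "liminf (\<lambda>n. ereal (\<theta> * root n c)) = ereal (\<theta> * 1)"
      by (rule lim_imp_Liminf[OF trivial_limit_sequentially])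
    ultimately show False using \<theta> by simp
  qed
  have "filterlim (\<lambda>n. R n / real n) at_top sequentially"
    unfolding filterlim_at_top
  proof
    fix K :: real
    define K' where "K' = max K 1"
    have "eventually (\<lambda>n. K' \<le> \<psi> n / real n) sequentially"
      using lim by (simp add: filterlim_at_top)
    then obtain N0 where N0: "\<And>n. n \<ge> N0 \<Longrightarrow> K' \<le> \<psi> n / real n" by (auto simp: eventually_sequentially)
    \<comment> \<open>From \<open>N1\<close> on the quotient of \<open>n + 1\<close> and
      \<open>n\<close> is at most \<open>\<theta>\<close>, so a linear lower bound survives a step
      in which \<open>R\<close> is multiplied by \<open>\<theta>\<close>.\<close>
    obtain N1 where N1: "1 / (\<theta> - 1) \<le> real N1" using real_arch_simple by blast
    define N where "N = max 1 (max N0 N1)"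
    have f: "K' * real n \<le> f n" if "n \<ge> N" for n
      using N0[of n] that by (auto simp: N_def f_def field_simps)
    have \<phi>K: "K' * real n \<le> \<phi> n" if "n \<ge> N" for n
    proof -
      have "K' * real n \<le> K' * real (M n)" using M(1)[of n] by (intro mult_left_mono) (auto simp: K'_def)
      also have "\<dots> \<le> \<phi> n" unfolding \<phi>_def using f[of "M n"] M(1)[of n] that by linarith
      finally show ?thesis .
    qed
    obtain n1 where n1: "n1 \<ge> N" "R n1 = \<phi> n1" using touch by blast
    have "K' * real n \<le> R n" if "n \<ge> n1" for n
      using that
    proof (induction n rule: dec_induct)
      case base
      show ?case using \<phi>K[OF n1(1)] n1(2) by simp
    next
      case (step n)
      have "1 / (\<theta> - 1) \<le> real n" using N1 step(1) n1(1) by (simp add: N_def)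
      then have "real n + 1 \<le> \<theta> * real n" using \<theta>1 by (simp add: field_simps)
      then have "K' * (real n + 1) \<le> K' * (\<theta> * real n)" by (intro mult_left_mono) (auto simp: K'_def)
      also have "\<dots> \<le> \<theta> * R n" using step \<theta>1 by (simp add: mult.left_commute)
      finally have "K' * real (Suc n) \<le> \<theta> * R n" by (simp add: add.commute)
      moreover have "K' * real (Suc n) \<le> \<phi> (Suc n)" using step n1(1) by (intro \<phi>K) simp
      ultimately show ?case by (simp add: RS)
    qed
    then have "\<forall>\<^sub>F n in sequentially. K' * real n \<le> R n" by (rule eventually_sequentiallyI)
    then show "\<forall>\<^sub>F n in sequentially. K \<le> R n / real n"
      using eventually_gt_at_top[of 0]
    proof eventually_elim
      case (elim n)
      then have "K' \<le> R n / real n" by (simp add: field_simps)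
      then show ?case by (simp add: K'_def)
    qed
  qed
  moreover have "\<forall>\<^sub>F n in sequentially. R n \<le> \<psi> n"
    using f\<psi> by eventually_elim (metis R\<phi> \<phi>(3) order_trans)
  moreover have "\<exists>\<^sub>F n in sequentially. \<psi> n \<le> R n"
    unfolding frequently_sequentially
  proof
    fix N
    obtain n where n: "n \<ge> Suc N" "R n = \<phi> n" using touch by blast
    have "M n \<ge> n" by (rule M(1))
    \<comment> \<open>Since \<open>R\<close> is nondecreasing, contact with \<open>\<phi>\<close> at
      \<open>n\<close> becomes contact with \<open>\<psi>\<close> at \<open>M n\<close>.\<close>
    then have "f (M n) \<le> R (M n)" using n(2) lift_Suc_mono_le[of R, OF Rmono \<open>M n \<ge> n\<close>] by (simp add: \<phi>_def)
    then show "\<exists>n\<ge>N. \<psi> n \<le> R n" using n(1) \<open>M n \<ge> n\<close> by (intro exI[of _ "M n"]) (auto simp: f_def split: if_splits)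
  qed
  ultimately show ?thesis using that Rpos Rmono Rgrow by blast
qed

text \<open>Dually, this \<open>R\<close> is the smallest such function above \<open>\<psi>\<close>.\<close>

lemma upper_envelope:
  assumes pos: "\<forall>n\<ge>1. \<psi> n > 0"
    and lim: "filterlim (\<lambda>n. \<psi> n / real n) at_top sequentially"
    and \<theta>: "upper_root_growth \<psi> < ereal \<theta>"
  obtains R :: "nat \<Rightarrow> real" where "\<And>n. 0 < R n" "\<And>n. R n \<le> R (Suc n)" "\<And>n. R (Suc n) \<le> \<theta> * R n"
    "filterlim (\<lambda>n. R n / real n) at_top sequentially"
    "\<forall>\<^sub>F n in sequentially. \<psi> n \<le> R n" "\<exists>\<^sub>F n in sequentially. R n \<le> \<psi> n"
proof -
  have top: "filterlim \<psi> at_top sequentially" by (rule at_top_of_ratio[OF lim])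
  have "1 \<le> upper_root_growth \<psi>"
    using lower_root_growth_ge_1[OF top] upper_root_growth_ge_lower order_trans by blast
  also note \<theta>
  finally have \<theta>1: "1 < \<theta>" by simp
  define f where "f n = (if n = 0 then 1 else \<psi> n)" for n
  have fpos: "f n > 0" for n using pos by (simp add: f_def)
  have f\<psi>: "\<forall>\<^sub>F n in sequentially. f n = \<psi> n"
    using eventually_gt_at_top[of 0] by eventually_elim (simp add: f_def)
  have ftop: "filterlim f at_top sequentially"
    using filterlim_cong[OF refl refl f\<psi>] top by blast
  \<comment> \<open>The room between \<open>\<theta>'\<close> and \<open>\<theta>\<close> makes
    \<open>\<theta> ^ n / f n\<close> tend to infinity, so that the supremum of
    \<open>f k / \<theta> ^ k\<close> over \<open>k \<ge> n\<close> is attained.\<close>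
  obtain \<theta>' where \<theta>': "upper_root_growth \<psi> < ereal \<theta>'" "\<theta>' < \<theta>"
    using ereal_dense2[OF \<theta>] by auto
  have "1 < \<theta>'" using \<open>1 \<le> upper_root_growth \<psi>\<close> \<theta>'(1) by (metis ereal_less_eq(3) le_less_trans less_ereal.simps(1) one_ereal_def)
  have "\<forall>\<^sub>F n in sequentially. ereal (root n (\<psi> n)) < ereal \<theta>'"
    using \<theta>'(1) unfolding upper_root_growth_def by (rule Limsup_lessD)
  then have small: "\<forall>\<^sub>F n in sequentially. (\<theta> / \<theta>') ^ n \<le> \<theta> ^ n / f n"
    using f\<psi> eventually_gt_at_top[of 0]
  proof eventually_elim
    case (elim n)
    then have "f n \<le> \<theta>' ^ n" using root_less_imp[of n "\<psi> n" \<theta>'] pos by (simp add: less_imp_le)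
    then show ?case using fpos[of n] \<theta>1 by (simp add: power_divide divide_left_mono)
  qed
  have gtop: "filterlim (\<lambda>n. \<theta> ^ n / f n) at_top sequentially"
    unfolding filterlim_at_top
  proof
    fix K :: real
    have q: "1 < \<theta> / \<theta>'" using \<theta>' \<open>1 < \<theta>'\<close> by simp
    then obtain m where m: "K < (\<theta> / \<theta>') ^ m" using real_arch_pow by blast
    have "\<forall>\<^sub>F n in sequentially. K < (\<theta> / \<theta>') ^ n"
      using q m by (intro eventually_sequentiallyI[of m]) (meson less_imp_le less_le_trans power_increasing)
    with small show "\<forall>\<^sub>F n in sequentially. K \<le> \<theta> ^ n / f n"
      by eventually_elim linarith
  qed
  obtain M where M: "\<And>n. M n \<ge> n" "\<And>n k. k \<ge> n \<Longrightarrow> \<theta> ^ M n / f (M n) \<le> \<theta> ^ k / f k"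
    using at_top_imp_argmin[OF gtop] by metis
  define u where "u n = f (M n) / \<theta> ^ M n" for n
  have u: "u n > 0" "f k / \<theta> ^ k \<le> u n" if "k \<ge> n" for n k
  proof -
    show "u n > 0" using fpos \<theta>1 by (simp add: u_def)
    have "inverse (\<theta> ^ k / f k) \<le> inverse (\<theta> ^ M n / f (M n))"
      using M(2)[OF that] fpos \<theta>1 by (intro le_imp_inverse_le) auto
    then show "f k / \<theta> ^ k \<le> u n" by (simp add: u_def)
  qed
  \<comment> \<open>The least majorant of \<open>f\<close> that grows at most by the factor
    \<open>\<theta>\<close> per step; its running maximum \<open>R\<close> is monotone and still
    respects the growth limit.\<close>
  define V where "V n = \<theta> ^ n * u n" for n
  have V: "V n > 0" "f n \<le> V n" "V (Suc n) \<le> \<theta> * V n" for n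
  proof -
    show "V n > 0" using u(1)[of n n] \<theta>1 by (simp add: V_def)
    show "f n \<le> V n" using u(2)[of n n] \<theta>1 by (simp add: V_def field_simps)
    have "u (Suc n) \<le> u n" using u(2)[of n "M (Suc n)"] M(1)[of "Suc n"] by (simp add: u_def)
    then show "V (Suc n) \<le> \<theta> * V n" using \<theta>1 by (simp add: V_def)
  qed
  define R where "R = rec_nat (V 0) (\<lambda>n r. max r (V (Suc n)))"
  have R0: "R 0 = V 0" and RS: "R (Suc n) = max (R n) (V (Suc n))" for n by (simp_all add: R_def)
  have RV: "V n \<le> R n" for n by (cases n) (auto simp: R0 RS)
  have Rpos: "0 < R n" for n using RV[of n] V(1)[of n] by linarith
  have Rmono: "R n \<le> R (Suc n)" for n by (simp add: RS)
  have Rgrow: "R (Suc n) \<le> \<theta> * R n" for n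
  proof -
    have "R n \<le> \<theta> * R n" using Rpos[of n] \<theta>1 by simp
    moreover have "\<theta> * V n \<le> \<theta> * R n" using RV[of n] \<theta>1 by simp
    ultimately show ?thesis using V(3)[of n] by (simp add: RS)
  qed
  have Rgrow': "R (n + k) \<le> \<theta> ^ k * R n" for n k
  proof (induction k)
    case (Suc k)
    have "R (Suc (n + k)) \<le> \<theta> * R (n + k)" by (rule Rgrow)
    also have "\<dots> \<le> \<theta> * (\<theta> ^ k * R n)" using Suc \<theta>1 by simp
    finally show ?case by (simp add: mult.assoc)
  qed simp
  have fR: "f n \<le> R n" for n using V(2)[of n] RV[of n] by linarith
  have Rtop: "filterlim R at_top sequentially"
    by (rule filterlim_at_top_mono[OF ftop]) (use fR in auto)
  \<comment> \<open>Otherwise the running maximum is constant from \<open>N\<close> on, whereas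
    \<open>R\<close> tends to infinity.\<close>
  have touch: "\<exists>n\<ge>N. R n = V n" for N
  proof (rule ccontr)
    assume "\<not> ?thesis"
    then have ne: "R n \<noteq> V n" if "n \<ge> N" for n using that by blast
    have "R (N + k) = R N" for k
    proof (induction k)
      case (Suc k)
      then show ?case using ne[of "Suc (N + k)"] RS[of "N + k"] by (auto simp: max_def split: if_splits)
    qed simp
    moreover obtain N' where "\<And>n. n \<ge> N' \<Longrightarrow> R N + 1 \<le> R n"
      using Rtop by (force simp: filterlim_at_top eventually_sequentially)
    ultimately show False by (metis add.commute le_add1 linorder_not_less less_add_one)
  qed
  have ev: "\<forall>\<^sub>F n in sequentially. \<psi> n \<le> R n"
    using f\<psi> by eventually_elim (metis fR)
  moreover have "filterlim (\<lambda>n. R n / real n) at_top sequentially"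
    by (rule filterlim_at_top_mono[OF lim]) (use ev in \<open>eventually_elim, auto intro: divide_right_mono\<close>)
  moreover have "\<exists>\<^sub>F n in sequentially. R n \<le> \<psi> n"
    unfolding frequently_sequentially
  proof
    fix N
    obtain n where n: "n \<ge> Suc N" "R n = V n" using touch by blast
    have Mn: "M n \<ge> n" by (rule M(1))
    \<comment> \<open>Growing by the full factor \<open>\<theta>\<close> from \<open>n\<close> to
      \<open>M n\<close>, where the supremum behind \<open>V n\<close> is attained, arrives exactly
      at \<open>f (M n)\<close>.\<close>
    have "R (M n) \<le> \<theta> ^ (M n - n) * V n" using Rgrow'[of n "M n - n"] Mn n(2) by simp
    also have "\<dots> = \<theta> ^ (M n - n) * \<theta> ^ n * u n" by (simp add: V_def)
    also have "\<theta> ^ (M n - n) * \<theta> ^ n = \<theta> ^ M n" using Mn by (simp flip: power_add)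
    also have "\<theta> ^ M n * u n = f (M n)" using \<theta>1 by (simp add: u_def)
    finally show "\<exists>n\<ge>N. R n \<le> \<psi> n" using n(1) Mn by (intro exI[of _ "M n"]) (auto simp: f_def split: if_splits)
  qed
  ultimately show ?thesis using that Rpos Rmono Rgrow by blast
qed

section \<open>Level sets of the fast exponent\<close>

context branch_system
begin

lemma countable_border_exceptional: "countable (border \<union> exceptional_set I T)"
  using countable_border countable_exceptional by simp

lemma exit_fast_exponent:
  assumes "\<forall>n\<ge>k. deriv (F ^^ n) x = deriv (F ^^ k) x" and "filterlim \<psi> at_top sequentially"
  shows "fast_exponent I T \<psi> x \<longlonglongrightarrow> 0"
proof -
  have "(\<lambda>n. ln \<bar>deriv (F ^^ k) x\<bar> / \<psi> n) \<longlonglongrightarrow> 0"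
    by (rule real_tendsto_divide_at_top[OF tendsto_const assms(2)])
  then have "(\<lambda>n. ereal (ln \<bar>deriv (F ^^ k) x\<bar> / \<psi> n)) \<longlonglongrightarrow> 0"
    by (simp add: zero_ereal_def)
  then show ?thesis
  proof (rule Lim_transform_eventually)
    show "\<forall>\<^sub>F n in sequentially. ereal (ln \<bar>deriv (F ^^ k) x\<bar> / \<psi> n) = fast_exponent I T \<psi> x n"
    proof (rule eventually_sequentiallyI)
      fix n assume "k \<le> n"
      then have "deriv (F ^^ n) x = deriv (F ^^ k) x" using assms(1) by blast
      then show "ereal (ln \<bar>deriv (F ^^ k) x\<bar> / \<psi> n) = fast_exponent I T \<psi> x n"
        unfolding fast_exponent_def by (simp only: times_divide_eq_left mult_1)
    qed
  qed
qed

lemma sum_ln_digits_nonneg: "itinerary I T x a \<Longrightarrow> 0 \<le> (\<Sum>j<n. ln (real (a j)))"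
  by (rule sum_nonneg) (simp add: itinerary_def)

section \<open>Level zero: full measure\<close>

lemma slow_growth_fast_exponent:
  assumes a: "itinerary I T x a" and K: "\<forall>\<^sub>F n in sequentially. (\<Sum>j<n. ln (real (a j))) \<le> K * real n"
    and \<psi>: "\<And>n. n \<ge> 1 \<Longrightarrow> \<psi> n > 0" and lim: "filterlim (\<lambda>n. \<psi> n / real n) at_top sequentially"
  shows "fast_exponent I T \<psi> x \<longlonglongrightarrow> 0"
proof -
  let ?d = "\<lambda>n. ln \<bar>deriv (F ^^ n) x\<bar>"
  define M where "M = \<gamma> * K + ln C"
  have "((\<lambda>n. M * inverse (\<psi> n / real n)) \<longlongrightarrow> M * 0) sequentially"
    by (intro tendsto_mult tendsto_const tendsto_inverse_0_at_top lim)
  then have lim0: "(\<lambda>n. M * (real n / \<psi> n)) \<longlonglongrightarrow> 0" by (simp add: inverse_eq_divide)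
  have "(\<lambda>n. ?d n / \<psi> n) \<longlonglongrightarrow> 0"
  proof (rule Lim_null_comparison[OF _ lim0])
    show "\<forall>\<^sub>F n in sequentially. norm (?d n / \<psi> n) \<le> M * (real n / \<psi> n)"
      using K eventually_gt_at_top[of 0]
    proof eventually_elim
      case (elim n)
      let ?S = "\<Sum>j<n. ln (real (a j))"
      have "\<gamma> * ?S \<le> \<gamma> * (K * real n)" "0 \<le> \<gamma> * ?S"
        using elim gamma sum_ln_digits_nonneg[OF a, of n] by auto
      moreover have "\<bar>?d n - \<gamma> * ?S\<bar> \<le> real n * ln C" by (rule itinerary_ln_deriv[OF a])
      ultimately have "\<bar>?d n\<bar> \<le> \<gamma> * (K * real n) + real n * ln C" by linarith
      also have "\<dots> = M * real n" by (simp add: M_def algebra_simps)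
      finally have "\<bar>?d n\<bar> / \<psi> n \<le> M * real n / \<psi> n"
        using \<psi>[of n] elim by (intro divide_right_mono) auto
      then show ?case using \<psi>[of n] elim by simp
    qed
  qed
  then have "(\<lambda>n. ereal (?d n / \<psi> n)) \<longlonglongrightarrow> 0" by (simp add: zero_ereal_def)
  then show ?thesis by (simp add: fast_exponent_def[abs_def])
qed

lemma branch_domain_measure:
  "branch_domain I \<in> sets lebesgue"
  "emeasure lebesgue (branch_domain I) = (\<Sum>n. ennreal (diameter (I (Suc n))))"
proof -
  have meas: "I (Suc n) \<in> sets lborel" for n using open_I[of "Suc n"] by simp
  have em: "emeasure lborel (I (Suc n)) = ennreal (diameter (I (Suc n)))" for n
  proof -
    have "e n < e (Suc n)" by (simp add: e_less)
    from sigma show ?thesis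
    proof
      assume s: "\<sigma> = 1"
      have "I (Suc n) = {e n<..<e (Suc n)}" by (auto simp: I_Suc s)
      with \<open>e n < e (Suc n)\<close> show ?thesis by simp
    next
      assume s: "\<sigma> = -1"
      have "I (Suc n) = {- e (Suc n)<..<- e n}" by (auto simp: I_Suc s)
      with \<open>e n < e (Suc n)\<close> show ?thesis by simp
    qed
  qed
  let ?F = "\<Union>n. frontier (I (Suc n))"
  have "countable ?F" by (auto simp: frontier_I_Suc)
  then have F: "?F \<in> null_sets lebesgue"
    by (simp add: countable_imp_null_set_lborel null_sets_completionI)
  have eq: "branch_domain I = (\<Union>n. I (Suc n)) \<union> ?F"
    unfolding branch_domain_eq using closure_I by auto
  have U: "(\<Union>n. I (Suc n)) \<in> sets lborel" using meas by blast
  then have U': "(\<Union>n. I (Suc n)) \<in> sets lebesgue" by (simp add: sets_completionI_sets)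
  show "branch_domain I \<in> sets lebesgue"
    unfolding eq using U' F by (intro sets.Un) auto
  have "emeasure lebesgue (branch_domain I) = emeasure lebesgue (\<Union>n. I (Suc n))"
    unfolding eq by (rule emeasure_Un_null_set[OF U' F])
  also have "\<dots> = emeasure lborel (\<Union>n. I (Suc n))" using U by (simp add: emeasure_completion)
  also have "\<dots> = (\<Sum>n. emeasure lborel (I (Suc n)))"
    by (rule suminf_emeasure[symmetric])
       (use meas I_disjoint in \<open>force simp: disjoint_family_on_def\<close>)+
  finally show "emeasure lebesgue (branch_domain I) = (\<Sum>n. ennreal (diameter (I (Suc n))))"
    by (simp only: em)
qed

text \<open>Stated for any set between the points with exponent tending to 0 and the domain, which
  treats limsup and liminf at once. As \<open>\<gamma> > 1\<close>, \<open>fast_growth_null\<close>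
  applies with \<open>s = 1\<close>: almost every itinerary has digit sums of at most linear
  growth.\<close>

lemma zero_level_full_measure:
  assumes \<psi>: "\<And>n. n \<ge> 1 \<Longrightarrow> \<psi> n > 0" and lim: "filterlim (\<lambda>n. \<psi> n / real n) at_top sequentially"
    and A: "A \<subseteq> branch_domain I" "\<And>x. x \<in> repeller I T \<Longrightarrow> fast_exponent I T \<psi> x \<longlonglongrightarrow> 0 \<Longrightarrow> x \<in> A"
  shows "A \<in> sets lebesgue \<and> emeasure lebesgue A = (\<Sum>n. ennreal (diameter (I (Suc n)))) \<and> hausdorff_dim A = 1"
proof -
  obtain K where K: "hausdorff_measure 1 {x. \<exists>a. itinerary I T x a \<and>
      (\<exists>\<^sub>F n in sequentially. K * real n \<le> (\<Sum>j<n. ln (real (a j))))} = 0"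
    using fast_growth_null[of 1] gamma by auto
  let ?N = "{x. \<exists>a. itinerary I T x a \<and> (\<exists>\<^sub>F n in sequentially. K * real n \<le> (\<Sum>j<n. ln (real (a j))))}"
  have "negligible (?N \<union> (border \<union> exceptional_set I T))"
    by (intro negligible_Un negligible_of_hausdorff_measure_zero[OF K]
        negligible_of_hausdorff_measure_zero[OF hausdorff_measure_countable[OF countable_border_exceptional, of 1]]) auto
  moreover have "branch_domain I - A \<subseteq> ?N \<union> (border \<union> exceptional_set I T)"
  proof (rule subsetI, rule ccontr)
    fix x assume x: "x \<in> branch_domain I - A" "x \<notin> ?N \<union> (border \<union> exceptional_set I T)"
    then have r: "x \<in> repeller I T" "x \<notin> border" by (auto simp: repeller_def)
    then have "fast_exponent I T \<psi> x \<longlonglongrightarrow> 0"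
    proof (cases rule: repeller_cases)
      case (itinerary a)
      then have "\<not> (\<exists>\<^sub>F n in sequentially. K * real n \<le> (\<Sum>j<n. ln (real (a j))))" using x(2) by blast
      then have "\<forall>\<^sub>F n in sequentially. (\<Sum>j<n. ln (real (a j))) \<le> K * real n"
        by (simp add: not_frequently not_le eventually_mono less_imp_le)
      then show ?thesis by (rule slow_growth_fast_exponent[OF itinerary _ \<psi> lim])
    next
      case (exit k)
      then show ?thesis by (rule exit_fast_exponent[OF _ at_top_of_ratio[OF lim]])
    qed
    then show False using A(2)[OF r(1)] x(1) by blast
  qed
  ultimately have null: "branch_domain I - A \<in> null_sets lebesgue"
    using negligible_subset negligible_iff_null_sets by blast
  have A_eq: "A = branch_domain I - (branch_domain I - A)" using A(1) by blast
  have sets: "A \<in> sets lebesgue"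
    by (subst A_eq) (use branch_domain_measure(1) null in \<open>blast intro: sets.Diff\<close>)
  have em: "emeasure lebesgue A = (\<Sum>n. ennreal (diameter (I (Suc n))))"
    by (subst A_eq) (simp add: emeasure_Diff_null_set[OF null branch_domain_measure(1)] branch_domain_measure(2))
  have "\<not> negligible A"
  proof
    assume "negligible A"
    then have "(\<Sum>n. ennreal (diameter (I (Suc n)))) = 0"
      using em by (simp add: negligible_iff_emeasure0[OF sets])
    then have "ennreal (diameter (I (Suc 0))) = 0" by (simp add: suminf_eq_zero_iff)
    moreover have "e 0 < e 1" by (simp add: e_less)
    \<comment> \<open>Two inner points of the first interval show that its diameter, hence the total
      length, is positive.\<close>
    then have "\<sigma> * ((2 * e 0 + e 1) / 3) \<in> I (Suc 0)" "\<sigma> * ((e 0 + 2 * e 1) / 3) \<in> I (Suc 0)"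
      by (auto simp: I_Suc sigma_sq)
    then have "dist (\<sigma> * ((2 * e 0 + e 1) / 3)) (\<sigma> * ((e 0 + 2 * e 1) / 3)) \<le> diameter (I (Suc 0))"
      using I_unit[of "Suc 0"] bounded_subset[of "{0..1}" "I (Suc 0)"] by (intro diameter_bounded_bound) auto
    moreover have "dist (\<sigma> * ((2 * e 0 + e 1) / 3)) (\<sigma> * ((e 0 + 2 * e 1) / 3)) > 0"
      using \<open>e 0 < e 1\<close> sigma by (auto simp: dist_real_def)
    ultimately show False by (simp add: ennreal_eq_0_iff)
  qed
  then have "hausdorff_dim A = 1"
    using A(1) branch_domain_unit by (intro hausdorff_dim_eq_1) auto
  with sets em show ?thesis by blast
qed

section \<open>Positive levels: upper bounds for the dimension\<close>

lemma digit_sum_growth: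
  assumes a: "itinerary I T x a" and c: "0 < c"
    and \<psi>: "\<And>n. n \<ge> 1 \<Longrightarrow> \<psi> n > 0" and lim: "filterlim (\<lambda>n. \<psi> n / real n) at_top sequentially"
  shows "\<forall>\<^sub>F n in sequentially. ereal c < fast_exponent I T \<psi> x n \<longrightarrow>
     c / (2 * \<gamma>) * \<psi> n \<le> (\<Sum>j<n. ln (real (a j)))"
proof -
  have "\<forall>\<^sub>F n in sequentially. 2 * ln C / c \<le> \<psi> n / real n"
    using lim by (simp add: filterlim_at_top)
  then show ?thesis using eventually_gt_at_top[of 0]
  proof eventually_elim
    case (elim n)
    show ?case
    proof
      assume "ereal c < fast_exponent I T \<psi> x n"
      then have "c * \<psi> n < ln \<bar>deriv (F ^^ n) x\<bar>"
        using \<psi>[of n] elim(2) by (simp add: fast_exponent_def field_simps)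
      moreover have "\<bar>ln \<bar>deriv (F ^^ n) x\<bar> - \<gamma> * (\<Sum>j<n. ln (real (a j)))\<bar> \<le> real n * ln C"
        by (rule itinerary_ln_deriv[OF a])
      \<comment> \<open>For large \<open>n\<close> the error takes at most half of
        \<open>c * \<psi> n\<close>, whence the 2 in \<open>c / (2 * \<gamma>)\<close>.\<close>
      moreover have "real n * ln C \<le> c / 2 * \<psi> n" using elim c by (simp add: field_simps)
      ultimately have "c / 2 * \<psi> n \<le> \<gamma> * (\<Sum>j<n. ln (real (a j)))" by linarith
      then show "c / (2 * \<gamma>) * \<psi> n \<le> (\<Sum>j<n. ln (real (a j)))" using gamma by (simp add: field_simps)
    qed
  qed
qed

lemma level_set_itinerary:
  assumes "x \<in> repeller I T" "x \<notin> border" "\<not> fast_exponent I T \<psi> x \<longlonglongrightarrow> 0"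
    and "filterlim \<psi> at_top sequentially"
  obtains a where "itinerary I T x a"
  using assms(1,2) exit_fast_exponent[OF _ assms(4)] assms(3) by (cases rule: repeller_cases) blast+

text \<open>The gap between \<open>\<beta>\<close> and \<open>\<beta>'\<close> absorbs the constant
  \<open>c\<close>. The condition on the root stays inside the eventually, so that the lemma serves
  whether it holds for all large \<open>n\<close> or only infinitely often.\<close>

lemma root_growth_exponential:
  assumes c: "0 < c" and \<beta>: "1 < \<beta>" "\<beta> < \<beta>'"
  shows "\<forall>\<^sub>F n in sequentially. \<beta>' < root n (\<psi> n) \<longrightarrow> \<beta> ^ n \<le> c * \<psi> n"
proof -
  have q: "1 < \<beta>' / \<beta>" using \<beta> by simp
  then obtain m where m: "1 / c < (\<beta>' / \<beta>) ^ m" using real_arch_pow by blast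
  have "\<forall>\<^sub>F n in sequentially. 1 / c < (\<beta>' / \<beta>) ^ n"
    using q m by (intro eventually_sequentiallyI[of m]) (meson less_imp_le less_le_trans power_increasing)
  then show ?thesis using eventually_gt_at_top[of 0]
  proof eventually_elim
    case (elim n)
    show ?case
    proof
      assume "\<beta>' < root n (\<psi> n)"
      then have "\<beta>' ^ n \<le> \<psi> n" using elim(2) \<beta> by (intro less_root_imp) auto
      then have "c * \<beta>' ^ n \<le> c * \<psi> n" using c by simp
      moreover have "\<beta> ^ n \<le> c * \<beta>' ^ n" using elim(1) c \<beta> by (simp add: power_divide field_simps)
      ultimately show "\<beta> ^ n \<le> c * \<psi> n" by linarith
    qed
  qed
qed

text \<open>A positive limsup makes the digit sum exceed a multiple of \<open>\<psi> n\<close> only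
  infinitely often, so the growth of \<open>\<psi>\<close> has to be available at all large
  \<open>n\<close>; hence the liminf of the roots.\<close>

lemma upper_level_set_dim_le:
  assumes \<psi>: "\<And>n. n \<ge> 1 \<Longrightarrow> \<psi> n > 0" and lim: "filterlim (\<lambda>n. \<psi> n / real n) at_top sequentially"
    and \<alpha>: "0 < \<alpha>"
  shows "hausdorff_dim (upper_level_set I T \<psi> \<alpha>) \<le> 1 / (ereal (\<gamma> - 1) * lower_root_growth \<psi> + 1)"
proof (rule hausdorff_dim_upper_bound)
  have top: "filterlim \<psi> at_top sequentially" by (rule at_top_of_ratio[OF lim])
  show "1 \<le> lower_root_growth \<psi>" by (rule lower_root_growth_ge_1[OF top])
  fix x assume x: "x \<in> upper_level_set I T \<psi> \<alpha>" "x \<notin> border"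
  then have ls: "x \<in> repeller I T" "limsup (fast_exponent I T \<psi> x) = \<alpha>" by (auto simp: upper_level_set_def)
  have "\<not> fast_exponent I T \<psi> x \<longlonglongrightarrow> 0"
    using ls(2) \<alpha> lim_imp_Limsup[OF trivial_limit_sequentially] by fastforce
  from level_set_itinerary[OF ls(1) x(2) this top] obtain a where a: "itinerary I T x a" .
  obtain c where c: "0 < c" "ereal c < \<alpha>"
    using ereal_dense2[OF \<alpha>] by auto
  have fr: "\<exists>\<^sub>F n in sequentially. ereal c < fast_exponent I T \<psi> x n"
  proof (rule ccontr)
    assume "\<not> ?thesis"
    then have "\<forall>\<^sub>F n in sequentially. fast_exponent I T \<psi> x n \<le> ereal c"
      by (simp add: not_frequently not_less)
    then have "limsup (fast_exponent I T \<psi> x) \<le> ereal c" by (rule Limsup_bounded)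
    with ls(2) c(2) show False by simp
  qed
  define c' where "c' = c / (2 * \<gamma>)"
  have c': "c' > 0" using c gamma by (simp add: c'_def)
  have fr': "\<exists>\<^sub>F n in sequentially. c' * \<psi> n \<le> (\<Sum>j<n. ln (real (a j)))"
    unfolding c'_def by (rule frequently_rev_mp[OF fr]) (rule digit_sum_growth[OF a c(1) \<psi> lim])
  have "\<exists>\<^sub>F n in sequentially. K * real n \<le> (\<Sum>j<n. ln (real (a j)))" for K
  proof (rule frequently_rev_mp[OF fr'])
    have "\<forall>\<^sub>F n in sequentially. K / c' \<le> \<psi> n / real n" using lim by (simp add: filterlim_at_top)
    then show "\<forall>\<^sub>F n in sequentially. c' * \<psi> n \<le> (\<Sum>j<n. ln (real (a j))) \<longrightarrow> K * real n \<le> (\<Sum>j<n. ln (real (a j)))"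
      using eventually_gt_at_top[of 0]
    proof eventually_elim
      case (elim n)
      then have "K * real n \<le> c' * \<psi> n" using c' by (simp add: field_simps)
      then show ?case by linarith
    qed
  qed
  moreover have "\<exists>\<^sub>F n in sequentially. \<beta> ^ n \<le> (\<Sum>j<n. ln (real (a j)))"
    if \<beta>: "1 < \<beta>" "ereal \<beta> < lower_root_growth \<psi>" for \<beta>
  proof (rule frequently_rev_mp[OF fr'])
    obtain \<beta>' where \<beta>': "\<beta> < \<beta>'" "ereal \<beta>' < lower_root_growth \<psi>" using ereal_dense2[OF \<beta>(2)] by auto
    have "\<forall>\<^sub>F n in sequentially. ereal \<beta>' < ereal (root n (\<psi> n))"
      using \<beta>'(2) unfolding lower_root_growth_def by (rule less_LiminfD)
    then show "\<forall>\<^sub>F n in sequentially. c' * \<psi> n \<le> (\<Sum>j<n. ln (real (a j))) \<longrightarrow> \<beta> ^ n \<le> (\<Sum>j<n. ln (real (a j)))"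
      using root_growth_exponential[OF c' \<beta>(1) \<beta>'(1), of \<psi>] by eventually_elim auto
  qed
  ultimately show "\<exists>a. itinerary I T x a \<and>
      (\<forall>K. \<exists>\<^sub>F n in sequentially. K * real n \<le> (\<Sum>j<n. ln (real (a j)))) \<and>
      (\<forall>\<beta>. 1 < \<beta> \<longrightarrow> ereal \<beta> < lower_root_growth \<psi> \<longrightarrow> (\<exists>\<^sub>F n in sequentially. \<beta> ^ n \<le> (\<Sum>j<n. ln (real (a j)))))"
    using a by blast
qed

text \<open>A positive liminf makes the digit sum exceed a multiple of \<open>\<psi> n\<close> at
  all large \<open>n\<close>, so it is enough that \<open>\<psi> n\<close> is large infinitely
  often; hence the limsup of the roots.\<close>

lemma lower_level_set_dim_le:
  assumes \<psi>: "\<And>n. n \<ge> 1 \<Longrightarrow> \<psi> n > 0" and lim: "filterlim (\<lambda>n. \<psi> n / real n) at_top sequentially"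
    and \<alpha>: "0 < \<alpha>"
  shows "hausdorff_dim (lower_level_set I T \<psi> \<alpha>) \<le> 1 / (ereal (\<gamma> - 1) * upper_root_growth \<psi> + 1)"
proof (rule hausdorff_dim_upper_bound)
  have top: "filterlim \<psi> at_top sequentially" by (rule at_top_of_ratio[OF lim])
  show "1 \<le> upper_root_growth \<psi>"
    by (rule order_trans[OF lower_root_growth_ge_1[OF top] upper_root_growth_ge_lower])
  fix x assume x: "x \<in> lower_level_set I T \<psi> \<alpha>" "x \<notin> border"
  then have ls: "x \<in> repeller I T" "liminf (fast_exponent I T \<psi> x) = \<alpha>" by (auto simp: lower_level_set_def)
  have "\<not> fast_exponent I T \<psi> x \<longlonglongrightarrow> 0"
    using ls(2) \<alpha> lim_imp_Liminf[OF trivial_limit_sequentially] by fastforce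
  from level_set_itinerary[OF ls(1) x(2) this top] obtain a where a: "itinerary I T x a" .
  obtain c where c: "0 < c" "ereal c < \<alpha>"
    using ereal_dense2[OF \<alpha>] by auto
  have ev: "\<forall>\<^sub>F n in sequentially. ereal c < fast_exponent I T \<psi> x n"
    by (rule less_LiminfD) (use ls(2) c(2) in simp)
  define c' where "c' = c / (2 * \<gamma>)"
  have c': "c' > 0" using c gamma by (simp add: c'_def)
  have ev': "\<forall>\<^sub>F n in sequentially. c' * \<psi> n \<le> (\<Sum>j<n. ln (real (a j)))"
  proof -
    have "\<forall>\<^sub>F n in sequentially. ereal c < fast_exponent I T \<psi> x n \<longrightarrow>
        c / (2 * \<gamma>) * \<psi> n \<le> (\<Sum>j<n. ln (real (a j)))"
      by (rule digit_sum_growth[OF a c(1) \<psi> lim])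
    with ev show ?thesis unfolding c'_def by eventually_elim simp
  qed
  have "\<exists>\<^sub>F n in sequentially. K * real n \<le> (\<Sum>j<n. ln (real (a j)))" for K
  proof (rule eventually_frequently[OF trivial_limit_sequentially])
    have "\<forall>\<^sub>F n in sequentially. K / c' \<le> \<psi> n / real n" using lim by (simp add: filterlim_at_top)
    with ev' show "\<forall>\<^sub>F n in sequentially. K * real n \<le> (\<Sum>j<n. ln (real (a j)))"
      using eventually_gt_at_top[of 0]
    proof eventually_elim
      case (elim n)
      then have "K * real n \<le> c' * \<psi> n" using c' by (simp add: field_simps)
      then show ?case using elim by linarith
    qed
  qed
  moreover have "\<exists>\<^sub>F n in sequentially. \<beta> ^ n \<le> (\<Sum>j<n. ln (real (a j)))"
    if \<beta>: "1 < \<beta>" "ereal \<beta> < upper_root_growth \<psi>" for \<beta>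
  proof -
    obtain \<beta>' where \<beta>': "\<beta> < \<beta>'" "ereal \<beta>' < upper_root_growth \<psi>" using ereal_dense2[OF \<beta>(2)] by auto
    have "\<exists>\<^sub>F n in sequentially. ereal \<beta>' < ereal (root n (\<psi> n))"
    proof (rule ccontr)
      assume "\<not> ?thesis"
      then have "\<forall>\<^sub>F n in sequentially. ereal (root n (\<psi> n)) \<le> ereal \<beta>'"
        by (simp add: not_frequently not_less)
      then have "upper_root_growth \<psi> \<le> ereal \<beta>'" unfolding upper_root_growth_def by (rule Limsup_bounded)
      with \<beta>'(2) show False by simp
    qed
    then show ?thesis
    proof (rule frequently_rev_mp)
      show "\<forall>\<^sub>F n in sequentially. ereal \<beta>' < ereal (root n (\<psi> n)) \<longrightarrow> \<beta> ^ n \<le> (\<Sum>j<n. ln (real (a j)))"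
        using root_growth_exponential[OF c' \<beta>(1) \<beta>'(1), of \<psi>] ev' by eventually_elim auto
    qed
  qed
  ultimately show "\<exists>a. itinerary I T x a \<and>
      (\<forall>K. \<exists>\<^sub>F n in sequentially. K * real n \<le> (\<Sum>j<n. ln (real (a j)))) \<and>
      (\<forall>\<beta>. 1 < \<beta> \<longrightarrow> ereal \<beta> < upper_root_growth \<psi> \<longrightarrow> (\<exists>\<^sub>F n in sequentially. \<beta> ^ n \<le> (\<Sum>j<n. ln (real (a j)))))"
    using a by blast
qed

end

section \<open>Positive levels: lower bounds for the dimension\<close>

lemma level_scaling:
  fixes \<alpha> :: ereal
  assumes "0 < \<alpha>"
  obtains c :: "nat \<Rightarrow> real" where "\<And>n. n \<ge> 1 \<Longrightarrow> 0 < c n" "(\<lambda>n. ereal (c n)) \<longlonglongrightarrow> \<alpha>"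
    "(\<lambda>n. root n (c n)) \<longlonglongrightarrow> 1" "\<exists>d>0. \<forall>n\<ge>1. d \<le> c n"
proof (cases \<alpha>)
  case (real r)
  then have "0 < r" using assms by simp
  then show ?thesis
    using that[of "\<lambda>_. r"] real LIMSEQ_root_const[of r] by auto
next
  \<comment> \<open>For the infinite level \<open>\<psi> n\<close> gets multiplied by
    \<open>n\<close>, which tends to infinity while its \<open>n\<close>-th root tends to 1.\<close>
  case PInf
  have "(\<lambda>n. ereal (real n)) \<longlonglongrightarrow> \<infinity>"
    by (simp add: tendsto_PInfty_eq_at_top filterlim_real_sequentially)
  then show ?thesis
    using that[of real] PInf LIMSEQ_root by (metis of_nat_0_less_iff of_nat_1 of_nat_le_iff zero_less_one less_le_trans)
qed (use assms in auto)

lemma root_growth_scaling: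
  assumes "(\<lambda>n. root n (c n)) \<longlonglongrightarrow> 1"
  shows "lower_root_growth (\<lambda>n. c n * \<psi> n) = lower_root_growth \<psi>"
    "upper_root_growth (\<lambda>n. c n * \<psi> n) = upper_root_growth \<psi>"
proof -
  have lim: "(\<lambda>n. ereal (root n (c n))) \<longlonglongrightarrow> 1" using assms by (simp add: one_ereal_def)
  have eq: "ereal (root n (c n * \<psi> n)) = ereal (root n (c n)) * ereal (root n (\<psi> n))" for n
    by (simp add: real_root_mult)
  show "lower_root_growth (\<lambda>n. c n * \<psi> n) = lower_root_growth \<psi>"
    unfolding lower_root_growth_def eq by (subst ereal_liminf_lim_mult[OF lim]) simp_all
  show "upper_root_growth (\<lambda>n. c n * \<psi> n) = upper_root_growth \<psi>"
    unfolding upper_root_growth_def eq by (subst ereal_limsup_lim_mult[OF lim]) simp_all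
qed

lemma scaled_ratio_at_top:
  assumes "\<exists>d>0. \<forall>n\<ge>1. d \<le> c n" "\<And>n. n \<ge> 1 \<Longrightarrow> \<psi> n > 0"
    and lim: "filterlim (\<lambda>n. \<psi> n / real n) at_top sequentially"
  shows "filterlim (\<lambda>n. c n * \<psi> n / real n) at_top sequentially"
proof -
  obtain d :: real where d: "d > 0" "\<forall>n\<ge>1. d \<le> c n" using assms(1) by blast
  have "filterlim (\<lambda>n. d * (\<psi> n / real n)) at_top sequentially"
    by (rule filterlim_tendsto_pos_mult_at_top[OF tendsto_const d(1) lim])
  then show ?thesis
  proof (rule filterlim_at_top_mono)
    show "\<forall>\<^sub>F n in sequentially. d * (\<psi> n / real n) \<le> c n * \<psi> n / real n"
      using eventually_gt_at_top[of 0]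
    proof eventually_elim
      case (elim n)
      then have "d * \<psi> n \<le> c n * \<psi> n" using d(2) assms(2)[of n] by (intro mult_right_mono) auto
      then show ?case by (simp add: divide_right_mono)
    qed
  qed
qed

context branch_system
begin

text \<open>The logarithm of the derivative is asymptotic to \<open>R n\<close>, and a factor
  tending to 1 changes neither limsup nor liminf.\<close>

lemma growth_set_exponent:
  assumes a: "itinerary I T x a" and S: "(\<lambda>n. \<gamma> * (\<Sum>j<n. ln (real (a j))) / R n) \<longlonglongrightarrow> 1"
    and R: "\<And>n. 0 < R n" "filterlim (\<lambda>n. R n / real n) at_top sequentially"
  shows "limsup (fast_exponent I T \<psi> x) = limsup (\<lambda>n. ereal (R n / \<psi> n))"
    "liminf (fast_exponent I T \<psi> x) = liminf (\<lambda>n. ereal (R n / \<psi> n))"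
proof -
  let ?d = "\<lambda>n. ln \<bar>deriv (F ^^ n) x\<bar>" and ?S = "\<lambda>n. \<Sum>j<n. ln (real (a j))"
  have "((\<lambda>n. ln C * inverse (R n / real n)) \<longlongrightarrow> ln C * 0) sequentially"
    by (intro tendsto_mult tendsto_const tendsto_inverse_0_at_top R)
  then have lim0: "(\<lambda>n. ln C * (real n / R n)) \<longlonglongrightarrow> 0" by (simp add: inverse_eq_divide)
  have "(\<lambda>n. ?d n / R n - \<gamma> * ?S n / R n) \<longlonglongrightarrow> 0"
  proof (rule Lim_null_comparison[OF _ lim0], intro always_eventually allI)
    fix n
    have "norm (?d n / R n - \<gamma> * ?S n / R n) = \<bar>?d n - \<gamma> * ?S n\<bar> / R n"
      using R(1)[of n] by (simp add: diff_divide_distrib[symmetric])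
    also have "\<dots> \<le> real n * ln C / R n"
      using itinerary_ln_deriv[OF a, of n] R(1)[of n] by (intro divide_right_mono) auto
    finally show "norm (?d n / R n - \<gamma> * ?S n / R n) \<le> ln C * (real n / R n)" by (simp add: mult.commute)
  qed
  from tendsto_add[OF this S] have "(\<lambda>n. ?d n / R n) \<longlonglongrightarrow> 1" by simp
  then have lim: "(\<lambda>n. ereal (?d n / R n)) \<longlonglongrightarrow> 1" by (simp add: one_ereal_def)
  have "fast_exponent I T \<psi> x n = ereal (?d n / R n) * ereal (R n / \<psi> n)" for n
    using R(1)[of n] by (simp add: fast_exponent_def)
  then have eq: "fast_exponent I T \<psi> x = (\<lambda>n. ereal (?d n / R n) * ereal (R n / \<psi> n))" by blast
  show "limsup (fast_exponent I T \<psi> x) = limsup (\<lambda>n. ereal (R n / \<psi> n))"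
    unfolding eq by (subst ereal_limsup_lim_mult[OF lim]) simp_all
  show "liminf (fast_exponent I T \<psi> x) = liminf (\<lambda>n. ereal (R n / \<psi> n))"
    unfolding eq by (subst ereal_liminf_lim_mult[OF lim]) simp_all
qed

lemma dim_lower_bound_from_envelopes:
  assumes b: "1 \<le> b"
    and env: "\<And>\<theta>. b < ereal \<theta> \<Longrightarrow> \<exists>R. (\<forall>n. 0 < R n \<and> R n \<le> R (Suc n) \<and> R (Suc n) \<le> \<theta> * R n) \<and>
      filterlim (\<lambda>n. R n / real n) at_top sequentially \<and>
      (\<forall>x a. itinerary I T x a \<longrightarrow> (\<lambda>n. \<gamma> * (\<Sum>j<n. ln (real (a j))) / R n) \<longlonglongrightarrow> 1 \<longrightarrow> x \<in> A)"
  shows "1 / (ereal (\<gamma> - 1) * b + 1) \<le> hausdorff_dim A"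
proof (cases b)
  case PInf
  have "1 / (ereal (\<gamma> - 1) * b + 1) = 0" unfolding PInf using gamma by simp
  then show ?thesis using hausdorff_dim_nonneg[of A] by simp
next
  case (real r)
  then have r: "1 \<le> r" using b by simp
  then have pos: "0 < (\<gamma> - 1) * r + 1" using gamma by (simp add: add_nonneg_pos)
  show ?thesis
  proof (rule hausdorff_dim_ge)
    fix s assume s: "0 \<le> s" "ereal s < 1 / (ereal (\<gamma> - 1) * b + 1)"
    then have "s < 1 / ((\<gamma> - 1) * r + 1)" using pos by (simp add: real one_ereal_def)
    \<comment> \<open>The construction wants a positive exponent, whereas \<open>s\<close> may be
      0.\<close>
    then obtain t where t: "s < t" "t < 1 / ((\<gamma> - 1) * r + 1)" using dense by blast
    then have t0: "0 < t" using s by linarith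
    \<comment> \<open>Solves \<open>t * ((\<gamma> - 1) * \<theta>' + 1) = 1\<close>; the choice of
      \<open>t\<close> amounts to \<open>r < \<theta>'\<close>.\<close>
    define \<theta>' where "\<theta>' = (1 / t - 1) / (\<gamma> - 1)"
    have "(\<gamma> - 1) * r + 1 < 1 / t" using t(2) t0 pos by (simp add: field_simps)
    then have "r < \<theta>'" using gamma by (simp add: \<theta>'_def field_simps)
    then obtain \<theta> where \<theta>: "r < \<theta>" "\<theta> < \<theta>'" using dense by blast
    have "(\<gamma> - 1) * \<theta> + 1 < 1 / t" using \<theta>(2) gamma by (simp add: \<theta>'_def field_simps)
    then have t1: "t * ((\<gamma> - 1) * \<theta> + 1) < 1" using t0 by (simp add: field_simps)
    obtain R where R: "\<And>n. 0 < R n" "\<And>n. R n \<le> R (Suc n)" "\<And>n. R (Suc n) \<le> \<theta> * R n"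
      "filterlim (\<lambda>n. R n / real n) at_top sequentially"
      "\<And>x a. itinerary I T x a \<Longrightarrow> (\<lambda>n. \<gamma> * (\<Sum>j<n. ln (real (a j))) / R n) \<longlonglongrightarrow> 1 \<Longrightarrow> x \<in> A"
      using env[of \<theta>] \<theta>(1) real by auto
    have sub: "{x. \<exists>a. itinerary I T x a \<and> (\<lambda>n. \<gamma> * (\<Sum>j<n. ln (real (a j))) / R n) \<longlonglongrightarrow> 1} \<subseteq> A"
      using R(5) by blast
    have "hausdorff_measure s {x. \<exists>a. itinerary I T x a \<and> (\<lambda>n. \<gamma> * (\<Sum>j<n. ln (real (a j))) / R n) \<longlonglongrightarrow> 1} \<noteq> 0"
      by (rule hausdorff_measure_growth_set[OF R(1-4) t0 t1 s(1)]) (use t in simp)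
    then show "hausdorff_measure s A \<noteq> 0"
      using hausdorff_measure_zero_subset[OF sub] by blast
  qed
qed (use b in auto)

text \<open>An envelope below \<open>c n * \<psi> n\<close> bounds the limsup by
  \<open>\<alpha>\<close>, and its infinitely many contacts keep the limsup from being
  smaller.\<close>

lemma upper_level_set_dim_ge:
  assumes \<psi>: "\<And>n. n \<ge> 1 \<Longrightarrow> \<psi> n > 0" and lim: "filterlim (\<lambda>n. \<psi> n / real n) at_top sequentially"
    and \<alpha>: "0 < \<alpha>"
  shows "1 / (ereal (\<gamma> - 1) * lower_root_growth \<psi> + 1) \<le> hausdorff_dim (upper_level_set I T \<psi> \<alpha>)"
proof (rule dim_lower_bound_from_envelopes)
  show "1 \<le> lower_root_growth \<psi>" by (rule lower_root_growth_ge_1[OF at_top_of_ratio[OF lim]])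
  fix \<theta> assume \<theta>: "lower_root_growth \<psi> < ereal \<theta>"
  obtain c where c: "\<And>n. n \<ge> 1 \<Longrightarrow> 0 < c n" "(\<lambda>n. ereal (c n)) \<longlonglongrightarrow> \<alpha>"
    "(\<lambda>n. root n (c n)) \<longlonglongrightarrow> 1" "\<exists>d>0. \<forall>n\<ge>1. d \<le> c n"
    using level_scaling[OF \<alpha>] by blast
  have pos: "\<forall>n\<ge>1. 0 < c n * \<psi> n" using c(1) \<psi> by simp
  have top: "filterlim (\<lambda>n. c n * \<psi> n / real n) at_top sequentially"
    by (rule scaled_ratio_at_top[OF c(4) \<psi> lim])
  have lt: "lower_root_growth (\<lambda>n. c n * \<psi> n) < ereal \<theta>" using \<theta> root_growth_scaling[OF c(3)] by simp
  obtain R where R: "\<And>n. 0 < R n" "\<And>n. R n \<le> R (Suc n)" "\<And>n. R (Suc n) \<le> \<theta> * R n"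
    "filterlim (\<lambda>n. R n / real n) at_top sequentially"
    "\<forall>\<^sub>F n in sequentially. R n \<le> c n * \<psi> n" "\<exists>\<^sub>F n in sequentially. c n * \<psi> n \<le> R n"
    using lower_envelope[OF pos top lt] by blast
  have le: "limsup (\<lambda>n. ereal (R n / \<psi> n)) \<le> \<alpha>"
  proof -
    have "\<forall>\<^sub>F n in sequentially. ereal (R n / \<psi> n) \<le> ereal (c n)"
      using R(5) eventually_gt_at_top[of 0] by eventually_elim (use \<psi> in \<open>simp add: field_simps\<close>)
    then have "limsup (\<lambda>n. ereal (R n / \<psi> n)) \<le> limsup (\<lambda>n. ereal (c n))" by (rule Limsup_mono)
    also have "\<dots> = \<alpha>" by (rule lim_imp_Limsup[OF trivial_limit_sequentially c(2)])
    finally show ?thesis .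
  qed
  have ge: "\<alpha> \<le> limsup (\<lambda>n. ereal (R n / \<psi> n))"
  proof (rule ccontr)
    assume "\<not> ?thesis"
    then obtain y where y: "limsup (\<lambda>n. ereal (R n / \<psi> n)) < y" "y < \<alpha>" by (meson dense not_le)
    have "\<forall>\<^sub>F n in sequentially. ereal (R n / \<psi> n) < y" using y(1) by (rule Limsup_lessD)
    moreover have "\<forall>\<^sub>F n in sequentially. y < ereal (c n)" using c(2) y(2) by (rule order_tendstoD)
    ultimately have "\<forall>\<^sub>F n in sequentially. \<not> c n * \<psi> n \<le> R n"
      using eventually_gt_at_top[of 0]
    proof eventually_elim
      case (elim n)
      then have "ereal (R n / \<psi> n) < ereal (c n)" by (meson less_trans)
      then show ?case using \<psi>[of n] elim by (simp add: field_simps)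
    qed
    with R(6) show False by (simp add: frequently_def)
  qed
  have "x \<in> upper_level_set I T \<psi> \<alpha>"
    if "itinerary I T x a" "(\<lambda>n. \<gamma> * (\<Sum>j<n. ln (real (a j))) / R n) \<longlonglongrightarrow> 1" for x a
    using growth_set_exponent(1)[OF that R(1,4), of \<psi>] itinerary_repeller[OF that(1)] le ge
    by (simp add: upper_level_set_def)
  with R(1-4) show "\<exists>R. (\<forall>n. 0 < R n \<and> R n \<le> R (Suc n) \<and> R (Suc n) \<le> \<theta> * R n) \<and>
      filterlim (\<lambda>n. R n / real n) at_top sequentially \<and>
      (\<forall>x a. itinerary I T x a \<longrightarrow> (\<lambda>n. \<gamma> * (\<Sum>j<n. ln (real (a j))) / R n) \<longlonglongrightarrow> 1 \<longrightarrow> x \<in> upper_level_set I T \<psi> \<alpha>)"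
    by blast
qed

text \<open>An envelope above \<open>c n * \<psi> n\<close> bounds the liminf from below by
  \<open>\<alpha>\<close>, and its infinitely many contacts keep the liminf from being
  larger.\<close>

lemma lower_level_set_dim_ge:
  assumes \<psi>: "\<And>n. n \<ge> 1 \<Longrightarrow> \<psi> n > 0" and lim: "filterlim (\<lambda>n. \<psi> n / real n) at_top sequentially"
    and \<alpha>: "0 < \<alpha>"
  shows "1 / (ereal (\<gamma> - 1) * upper_root_growth \<psi> + 1) \<le> hausdorff_dim (lower_level_set I T \<psi> \<alpha>)"
proof (rule dim_lower_bound_from_envelopes)
  show "1 \<le> upper_root_growth \<psi>"
    by (rule order_trans[OF lower_root_growth_ge_1[OF at_top_of_ratio[OF lim]] upper_root_growth_ge_lower])
  fix \<theta> assume \<theta>: "upper_root_growth \<psi> < ereal \<theta>"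
  obtain c where c: "\<And>n. n \<ge> 1 \<Longrightarrow> 0 < c n" "(\<lambda>n. ereal (c n)) \<longlonglongrightarrow> \<alpha>"
    "(\<lambda>n. root n (c n)) \<longlonglongrightarrow> 1" "\<exists>d>0. \<forall>n\<ge>1. d \<le> c n"
    using level_scaling[OF \<alpha>] by blast
  have pos: "\<forall>n\<ge>1. 0 < c n * \<psi> n" using c(1) \<psi> by simp
  have top: "filterlim (\<lambda>n. c n * \<psi> n / real n) at_top sequentially"
    by (rule scaled_ratio_at_top[OF c(4) \<psi> lim])
  have lt: "upper_root_growth (\<lambda>n. c n * \<psi> n) < ereal \<theta>" using \<theta> root_growth_scaling[OF c(3)] by simp
  obtain R where R: "\<And>n. 0 < R n" "\<And>n. R n \<le> R (Suc n)" "\<And>n. R (Suc n) \<le> \<theta> * R n"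
    "filterlim (\<lambda>n. R n / real n) at_top sequentially"
    "\<forall>\<^sub>F n in sequentially. c n * \<psi> n \<le> R n" "\<exists>\<^sub>F n in sequentially. R n \<le> c n * \<psi> n"
    using upper_envelope[OF pos top lt] by blast
  have ge: "\<alpha> \<le> liminf (\<lambda>n. ereal (R n / \<psi> n))"
  proof -
    have "\<forall>\<^sub>F n in sequentially. ereal (c n) \<le> ereal (R n / \<psi> n)"
      using R(5) eventually_gt_at_top[of 0] by eventually_elim (use \<psi> in \<open>simp add: field_simps\<close>)
    then have "liminf (\<lambda>n. ereal (c n)) \<le> liminf (\<lambda>n. ereal (R n / \<psi> n))" by (rule Liminf_mono)
    moreover have "liminf (\<lambda>n. ereal (c n)) = \<alpha>" by (rule lim_imp_Liminf[OF trivial_limit_sequentially c(2)])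
    ultimately show ?thesis by simp
  qed
  have le: "liminf (\<lambda>n. ereal (R n / \<psi> n)) \<le> \<alpha>"
  proof (rule ccontr)
    assume "\<not> ?thesis"
    then obtain y where y: "\<alpha> < y" "y < liminf (\<lambda>n. ereal (R n / \<psi> n))" by (meson dense not_le)
    have "\<forall>\<^sub>F n in sequentially. y < ereal (R n / \<psi> n)" using y(2) by (rule less_LiminfD)
    moreover have "\<forall>\<^sub>F n in sequentially. ereal (c n) < y" using c(2) y(1) by (rule order_tendstoD)
    ultimately have "\<forall>\<^sub>F n in sequentially. \<not> R n \<le> c n * \<psi> n"
      using eventually_gt_at_top[of 0]
    proof eventually_elim
      case (elim n)
      then have "ereal (c n) < ereal (R n / \<psi> n)" by (meson less_trans)
      then show ?case using \<psi>[of n] elim by (simp add: field_simps)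
    qed
    with R(6) show False by (simp add: frequently_def)
  qed
  have "x \<in> lower_level_set I T \<psi> \<alpha>"
    if "itinerary I T x a" "(\<lambda>n. \<gamma> * (\<Sum>j<n. ln (real (a j))) / R n) \<longlonglongrightarrow> 1" for x a
    using growth_set_exponent(2)[OF that R(1,4), of \<psi>] itinerary_repeller[OF that(1)] le ge
    by (simp add: lower_level_set_def)
  with R(1-4) show "\<exists>R. (\<forall>n. 0 < R n \<and> R n \<le> R (Suc n) \<and> R (Suc n) \<le> \<theta> * R n) \<and>
      filterlim (\<lambda>n. R n / real n) at_top sequentially \<and>
      (\<forall>x a. itinerary I T x a \<longrightarrow> (\<lambda>n. \<gamma> * (\<Sum>j<n. ln (real (a j))) / R n) \<longlonglongrightarrow> 1 \<longrightarrow> x \<in> lower_level_set I T \<psi> \<alpha>)"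
    by blast
qed

end

theorem theorem2:
  fixes I :: "nat \<Rightarrow> real set" and T :: "real \<Rightarrow> real" and \<gamma> :: real and \<psi> :: "nat \<Rightarrow> real"
  assumes "markov_renyi I T \<gamma>"
    and "\<forall>n\<ge>1. \<psi> n > 0"
    and "filterlim (\<lambda>n. \<psi> n / real n) at_top sequentially"
  shows
    "(upper_level_set I T \<psi> 0 \<in> sets lebesgue \<and>
      emeasure lebesgue (upper_level_set I T \<psi> 0) = (\<Sum>n. ennreal (diameter (I (Suc n)))) \<and>
      lower_level_set I T \<psi> 0 \<in> sets lebesgue \<and>
      emeasure lebesgue (lower_level_set I T \<psi> 0) = (\<Sum>n. ennreal (diameter (I (Suc n)))) \<and>
      hausdorff_dim (upper_level_set I T \<psi> 0) = 1 \<and>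
      hausdorff_dim (lower_level_set I T \<psi> 0) = 1) \<and>
     (\<forall>\<alpha>::ereal. 0 < \<alpha> \<longrightarrow>
      hausdorff_dim (upper_level_set I T \<psi> \<alpha>) =
        1 / (ereal (\<gamma> - 1) * lower_root_growth \<psi> + 1) \<and>
      hausdorff_dim (lower_level_set I T \<psi> \<alpha>) =
        1 / (ereal (\<gamma> - 1) * upper_root_growth \<psi> + 1))"
proof -
  obtain C \<sigma> e G where "branch_system I T \<gamma> C \<sigma> e G"
    using markov_renyi_branch_system[OF assms(1)] by blast
  then interpret branch_system I T \<gamma> C \<sigma> e G .
  have \<psi>: "n \<ge> 1 \<Longrightarrow> \<psi> n > 0" for n using assms(2) by blast
  have "upper_level_set I T \<psi> 0 \<in> sets lebesgue \<and>
      emeasure lebesgue (upper_level_set I T \<psi> 0) = (\<Sum>n. ennreal (diameter (I (Suc n)))) \<and>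
      hausdorff_dim (upper_level_set I T \<psi> 0) = 1"
    by (rule zero_level_full_measure[OF \<psi> assms(3)])
       (auto simp: upper_level_set_def repeller_def lim_imp_Limsup)
  moreover have "lower_level_set I T \<psi> 0 \<in> sets lebesgue \<and>
      emeasure lebesgue (lower_level_set I T \<psi> 0) = (\<Sum>n. ennreal (diameter (I (Suc n)))) \<and>
      hausdorff_dim (lower_level_set I T \<psi> 0) = 1"
    by (rule zero_level_full_measure[OF \<psi> assms(3)])
       (auto simp: lower_level_set_def repeller_def lim_imp_Liminf)
  moreover have "hausdorff_dim (upper_level_set I T \<psi> \<alpha>) = 1 / (ereal (\<gamma> - 1) * lower_root_growth \<psi> + 1)"
    if "0 < \<alpha>" for \<alpha>
    by (intro antisym upper_level_set_dim_le upper_level_set_dim_ge \<psi> assms(3) that)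
  moreover have "hausdorff_dim (lower_level_set I T \<psi> \<alpha>) = 1 / (ereal (\<gamma> - 1) * upper_root_growth \<psi> + 1)"
    if "0 < \<alpha>" for \<alpha>
    by (intro antisym lower_level_set_dim_le lower_level_set_dim_ge \<psi> assms(3) that)
  ultimately show ?thesis by blast
qed

end
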